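(* Let $\mathbb{F}\in\{\mathbb{R},\mathbb{C},\mathbb{H}\}$ and put $\beta=1,2,4$ for $\mathbb{F}=\mathbb{R},\mathbb{C},\mathbb{H}$ respectively. Let $U(n)=U(n,\mathbb{F})$ act on the manifold $\overset{\circ}{\mathcal{H}}$ of $n\times n$ hermitian matrices over $\mathbb{F}$ with pairwise distinct eigenvalues by $(U,S)\mapsto USU^*$, with the Frobenius metric on $\overset{\circ}{\mathcal{H}}$. Then there is a constant $c$, depending only on $n$ (for given $\mathbb{F}$), such that the Riemannian volume of the orbit of a matrix with eigenvalues $\lambda_1>\cdots>\lambda_n$ is $$c\cdot\prod_{a<b}(\lambda_a-\lambda_b)^\beta .$$
   Context: $\mathbb{H}$ denotes the quaternions. $A^*$ is the (conjugate) transpose over $\mathbb{F}$; hermitian means $A=A^*$; $U(n,\mathbb{F})$ is the group of matrices with $UU^*=I$. The Frobenius metric is $\langle A,B\rangle=\operatorname{Re}\operatorname{Tr}(AB^* )$. The volume of an orbit is its Riemannian volume, in the dimension of the orbit, for the induced submanifold metric. *)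

theory Defs
  imports "HOL-Analysis.Analysis"
begin

section \<open>Quaternions\<close>

datatype quat = Quat (qre: real) (qim1: real) (qim2: real) (qim3: real)

lemma quat_eqI:
  "\<lbrakk>qre x = qre y; qim1 x = qim1 y; qim2 x = qim2 y; qim3 x = qim3 y\<rbrakk> \<Longrightarrow> x = y"
  by (rule quat.expand) simp

lemma quat_eq_iff:
  "x = y \<longleftrightarrow> qre x = qre y \<and> qim1 x = qim1 y \<and> qim2 x = qim2 y \<and> qim3 x = qim3 y"
  using quat_eqI by blast

instantiation quat :: ring_1
begin

definition "0 = Quat 0 0 0 0"
definition "1 = Quat 1 0 0 0"
definition "x + y = Quat (qre x + qre y) (qim1 x + qim1 y) (qim2 x + qim2 y) (qim3 x + qim3 y)"
definition "- x = Quat (- qre x) (- qim1 x) (- qim2 x) (- qim3 x)"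
definition "x - y = Quat (qre x - qre y) (qim1 x - qim1 y) (qim2 x - qim2 y) (qim3 x - qim3 y)"
definition "x * y = Quat
  (qre x * qre y - qim1 x * qim1 y - qim2 x * qim2 y - qim3 x * qim3 y)
  (qre x * qim1 y + qim1 x * qre y + qim2 x * qim3 y - qim3 x * qim2 y)
  (qre x * qim2 y - qim1 x * qim3 y + qim2 x * qre y + qim3 x * qim1 y)
  (qre x * qim3 y + qim1 x * qim2 y - qim2 x * qim1 y + qim3 x * qre y)"

lemmas quat_ring_defs = zero_quat_def one_quat_def plus_quat_def uminus_quat_def
  minus_quat_def times_quat_def

instance
  by standard (simp_all add: quat_eq_iff quat_ring_defs algebra_simps)

end

instantiation quat :: real_vector
begin

definition scaleR_quat_def:
  "r *\<^sub>R x = Quat (r * qre x) (r * qim1 x) (r * qim2 x) (r * qim3 x)"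

instance
  by standard (simp_all add: quat_eq_iff quat_ring_defs scaleR_quat_def algebra_simps)

end

instantiation quat :: real_inner
begin

definition inner_quat_def:
  "x \<bullet> y = qre x * qre y + qim1 x * qim1 y + qim2 x * qim2 y + qim3 x * qim3 y"
definition norm_quat_def:
  "norm (x::quat) = sqrt ((qre x)\<^sup>2 + (qim1 x)\<^sup>2 + (qim2 x)\<^sup>2 + (qim3 x)\<^sup>2)"
definition "sgn (x::quat) = x /\<^sub>R norm x"
definition "dist (x::quat) y = norm (x - y)"
definition
  "(uniformity :: (quat \<times> quat) filter) = (INF e\<in>{0 <..}. principal {(x, y). dist x y < e})"
definition
  "open (U :: quat set) \<longleftrightarrow> (\<forall>x\<in>U. eventually (\<lambda>(x', y). x' = x \<longrightarrow> y \<in> U) uniformity)"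

instance
proof
  fix x y z :: quat and r s :: real and U :: "quat set"
  show "x \<bullet> y = y \<bullet> x" "(x + y) \<bullet> z = x \<bullet> z + y \<bullet> z" "(r *\<^sub>R x) \<bullet> y = r * (x \<bullet> y)"
    by (auto simp: inner_quat_def quat_ring_defs scaleR_quat_def ring_distribs)
  show "0 \<le> x \<bullet> x"
    by (simp add: inner_quat_def)
  show "x \<bullet> x = 0 \<longleftrightarrow> x = 0"
    unfolding inner_quat_def by (simp add: quat_eq_iff zero_quat_def add_nonneg_eq_0_iff)
  show "norm x = sqrt (x \<bullet> x)"
    by (simp add: inner_quat_def norm_quat_def power2_eq_square)
qed (rule sgn_quat_def dist_quat_def uniformity_quat_def open_quat_def)+

end

instantiation quat :: euclidean_space
begin

definition Basis_quat_def:
  "Basis = {Quat 1 0 0 0, Quat 0 1 0 0, Quat 0 0 1 0, Quat 0 0 0 1}"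

instance
proof
  show "(Basis :: quat set) \<noteq> {}" "finite (Basis :: quat set)"
    by (simp_all add: Basis_quat_def)
  show "u \<bullet> v = (if u = v then 1 else 0)" if "u \<in> Basis" "v \<in> Basis" for u v :: quat
    using that unfolding Basis_quat_def by (elim insertE emptyE) (simp_all add: inner_quat_def)
  show "(\<forall>u\<in>Basis. x \<bullet> u = 0) \<longleftrightarrow> x = 0" for x :: quat
    by (cases x) (simp add: Basis_quat_def inner_quat_def zero_quat_def)
qed

end

instantiation quat :: real_normed_div_algebra
begin

definition "inverse x = inverse (x \<bullet> x) *\<^sub>R Quat (qre x) (- qim1 x) (- qim2 x) (- qim3 x)"
definition "x div (y::quat) = x * inverse y"

instance
proof
  fix x y :: quat and r :: real
  show scaleR_left: "r *\<^sub>R x * y = r *\<^sub>R (x * y)" for r and x y :: quat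
    by (simp add: quat_eq_iff quat_ring_defs scaleR_quat_def algebra_simps)
  show scaleR_right: "x * r *\<^sub>R y = r *\<^sub>R (x * y)" for r and x y :: quat
    by (simp add: quat_eq_iff quat_ring_defs scaleR_quat_def algebra_simps)
  show "x div y = x * inverse y"
    by (rule divide_quat_def)
  show "inverse (0::quat) = 0"
    by (simp add: inverse_quat_def scaleR_quat_def zero_quat_def)
  show "norm (x * y) = norm x * norm y"
    unfolding norm_quat_def real_sqrt_mult [symmetric]
    unfolding times_quat_def quat.sel by (rule arg_cong[of _ _ sqrt]) algebra
  assume "x \<noteq> 0"
  then have n: "x \<bullet> x \<noteq> 0" by simp
  show "inverse x * x = 1"
  proof -
    have "Quat (qre x) (- qim1 x) (- qim2 x) (- qim3 x) * x = (x \<bullet> x) *\<^sub>R 1"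
      by (simp add: quat_eq_iff quat_ring_defs scaleR_quat_def inner_quat_def)
    then show ?thesis
      using n by (simp add: inverse_quat_def scaleR_left)
  qed
  show "x * inverse x = 1"
  proof -
    have "x * Quat (qre x) (- qim1 x) (- qim2 x) (- qim3 x) = (x \<bullet> x) *\<^sub>R 1"
      by (simp add: quat_eq_iff quat_ring_defs scaleR_quat_def inner_quat_def)
    then show ?thesis
      using n by (simp add: inverse_quat_def scaleR_right)
  qed
qed

end

section \<open>The division algebras and their conjugation\<close>

text \<open>
  By the theorem of Frobenius the only instances up to isomorphism are the real numbers, the
  complex numbers and the quaternions, with their standard conjugation and inner product.
\<close>

class star_division_algebra = real_normed_div_algebra + euclidean_space +
  fixes star :: "'a \<Rightarrow> 'a"
    and real_part :: "'a \<Rightarrow> real"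
  assumes star_star [simp]: "star (star x) = x"
    and star_add: "star (x + y) = star x + star y"
    and star_scaleR: "star (r *\<^sub>R x) = r *\<^sub>R star x"
    and star_mult: "star (x * y) = star y * star x"
    and real_part_eq: "real_part x *\<^sub>R 1 = (1 / 2) *\<^sub>R (x + star x)"
    and inner_eq_real_part: "x \<bullet> y = real_part (x * star y)"

instantiation real :: star_division_algebra
begin
definition star_real_def: "star (x::real) = x"
definition real_part_real_def: "real_part (x::real) = x"
instance
  by standard (simp_all add: star_real_def real_part_real_def)
end

instantiation complex :: star_division_algebra
begin
definition star_complex_def: "star (x::complex) = cnj x"
definition real_part_complex_def: "real_part (x::complex) = Re x"
instance
  by standard
    (simp_all add: star_complex_def real_part_complex_def inner_complex_def complex_eq_iff)
end

instantiation quat :: star_division_algebra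
begin
definition star_quat_def: "star x = Quat (qre x) (- qim1 x) (- qim2 x) (- qim3 x)"
definition real_part_quat_def: "real_part x = qre x"
instance
  by standard
    (simp_all add: star_quat_def real_part_quat_def inner_quat_def quat_eq_iff quat_ring_defs
      scaleR_quat_def algebra_simps)
end


section \<open>Hermitian matrices and unitary orbits\<close>

definition adjoint_matrix :: "'f::star_division_algebra ^'n ^'m \<Rightarrow> 'f ^'m ^'n" where
  "adjoint_matrix A = (\<chi> i j. star (A $ j $ i))"

definition hermitian :: "'f::star_division_algebra ^'n ^'n \<Rightarrow> bool" where
  "hermitian A \<longleftrightarrow> A = adjoint_matrix A"

definition unitary_group :: "('f::star_division_algebra ^'n ^'n) set" where
  "unitary_group = {U. U ** adjoint_matrix U = mat 1}"

definition frobenius :: "'f::star_division_algebra ^'n ^'n \<Rightarrow> 'f ^'n ^'n \<Rightarrow> real" where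
  "frobenius A B = real_part (trace (A ** adjoint_matrix B))"

text \<open>
  Scalars act on column vectors from the right, which matters over the quaternions only: these are
  the right eigenvalues.
\<close>

definition eigenvalues :: "'f::star_division_algebra ^'n ^'n \<Rightarrow> 'f set" where
  "eigenvalues A = {\<mu>. \<exists>v. v \<noteq> 0 \<and> A *v v = (\<chi> i. v $ i * \<mu>)}"

text \<open>A hermitian matrix of size \<open>n\<close> has pairwise distinct eigenvalues iff the set of its eigenvalues
  has exactly \<open>n\<close> elements.\<close>

definition simple_hermitian :: "('f::star_division_algebra ^'n ^'n) set" where
  "simple_hermitian = {S. hermitian S \<and> card (eigenvalues S) = CARD('n)}"

lemma star_1 [simp]: "star (1 :: 'f::star_division_algebra) = 1"
  using star_mult[of 1 "star (1 :: 'f)"] by simp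

lemma real_part_eq_inner_1: "real_part x = x \<bullet> (1 :: 'f::star_division_algebra)"
  by (simp add: inner_eq_real_part)

lemma frobenius_eq_inner:
  fixes A B :: "'f::star_division_algebra ^'n ^'n"
  shows "frobenius A B = A \<bullet> B"
proof -
  have "frobenius A B = (\<Sum>i\<in>UNIV. \<Sum>k\<in>UNIV. real_part (A $ i $ k * star (B $ i $ k)))"
    by (simp add: frobenius_def trace_def matrix_matrix_mult_def adjoint_matrix_def
        real_part_eq_inner_1 inner_sum_left)
  then show ?thesis
    by (simp add: inner_vec_def inner_eq_real_part)
qed

definition unitary_orbit ::
    "'f::star_division_algebra ^'n ^'n \<Rightarrow> ('f ^'n ^'n) set" where
  "unitary_orbit S = {U ** S ** adjoint_matrix U |U. U \<in> unitary_group}"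


section \<open>Riemannian volume of embedded submanifolds\<close>

text \<open>
  Coordinates on a \<open>d\<close>-dimensional submanifold take values in the set of functions on
  \<open>{..<d}\<close>, so that \<open>d\<close> may be any natural number, including 0 (where this set is a point of
  Lebesgue measure 1).
\<close>

definition coord_space :: "nat \<Rightarrow> (nat \<Rightarrow> real) topology" where
  "coord_space d = product_topology (\<lambda>_. euclideanreal) {..<d}"

definition coord_lebesgue :: "nat \<Rightarrow> (nat \<Rightarrow> real) measure" where
  "coord_lebesgue d = PiM {..<d} (\<lambda>_. lborel)"

definition partial_deriv ::
    "nat \<Rightarrow> ((nat \<Rightarrow> real) \<Rightarrow> 'a::real_normed_vector) \<Rightarrow> (nat \<Rightarrow> real) \<Rightarrow> 'a" where
  "partial_deriv i \<phi> x = vector_derivative (\<lambda>t. \<phi> (x(i := t))) (at (x i))"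

definition C1_on_coords ::
    "nat \<Rightarrow> (nat \<Rightarrow> real) set \<Rightarrow> ((nat \<Rightarrow> real) \<Rightarrow> 'a::real_normed_vector) \<Rightarrow> bool" where
  "C1_on_coords d U \<phi> \<longleftrightarrow>
     (\<forall>i<d. (\<forall>x\<in>U. (\<lambda>t. \<phi> (x(i := t))) differentiable (at (x i))) \<and>
            continuous_map (subtopology (coord_space d) U) euclidean (partial_deriv i \<phi>))"

text \<open>
  A local parametrization is a \<open>C\<^sup>1\<close> immersion that is a homeomorphism onto a relatively open part
  of \<open>M\<close>.
\<close>

definition local_parametrization ::
    "nat \<Rightarrow> 'a::real_normed_vector set \<Rightarrow> (nat \<Rightarrow> real) set \<Rightarrow> ((nat \<Rightarrow> real) \<Rightarrow> 'a) \<Rightarrow> bool" where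
  "local_parametrization d M U \<phi> \<longleftrightarrow>
     openin (coord_space d) U \<and>
     openin (top_of_set M) (\<phi> ` U) \<and>
     homeomorphic_map (subtopology (coord_space d) U) (top_of_set (\<phi> ` U)) \<phi> \<and>
     C1_on_coords d U \<phi> \<and>
     (\<forall>x\<in>U. \<forall>a. (\<Sum>i<d. a i *\<^sub>R partial_deriv i \<phi> x) = 0 \<longrightarrow> (\<forall>i<d. a i = 0))"

definition embedded_submanifold :: "nat \<Rightarrow> 'a::real_normed_vector set \<Rightarrow> bool" where
  "embedded_submanifold d M \<longleftrightarrow>
     (\<forall>p\<in>M. \<exists>U \<phi>. local_parametrization d M U \<phi> \<and> p \<in> \<phi> ` U)"

text \<open>
  The Leibniz formula, for a matrix \<open>G\<close> whose size is a number and not a type.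
\<close>

definition det_upto :: "nat \<Rightarrow> (nat \<Rightarrow> nat \<Rightarrow> real) \<Rightarrow> real" where
  "det_upto d G = (\<Sum>p | p permutes {..<d}. of_int (sign p) * (\<Prod>i<d. G i (p i)))"

text \<open>
  In the following, \<open>g\<close> is an inner product on the ambient space.  It induces on a submanifold the
  metric with coefficients \<open>g\<^sub>i\<^sub>j = g (\<partial>\<^sub>i \<phi>) (\<partial>\<^sub>j \<phi>)\<close>, whose volume density in the chart is
  the square root of \<open>det (g\<^sub>i\<^sub>j)\<close>.
\<close>

definition volume_density ::
    "('a \<Rightarrow> 'a \<Rightarrow> real) \<Rightarrow> nat \<Rightarrow> ((nat \<Rightarrow> real) \<Rightarrow> 'a::real_normed_vector) \<Rightarrow> (nat \<Rightarrow> real) \<Rightarrow> real" where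
  "volume_density g d \<phi> x =
     sqrt (det_upto d (\<lambda>i j. g (partial_deriv i \<phi> x) (partial_deriv j \<phi> x)))"

definition is_riemannian_measure ::
    "('a \<Rightarrow> 'a \<Rightarrow> real) \<Rightarrow> nat \<Rightarrow> 'a::real_normed_vector set \<Rightarrow> 'a measure \<Rightarrow> bool" where
  "is_riemannian_measure g d M \<mu> \<longleftrightarrow>
     space \<mu> = M \<and> sets \<mu> = sets (restrict_space borel M) \<and>
     (\<forall>U \<phi> A. local_parametrization d M U \<phi> \<longrightarrow> A \<in> sets (coord_lebesgue d) \<longrightarrow> A \<subseteq> U \<longrightarrow>
        emeasure \<mu> (\<phi> ` A) = (\<integral>\<^sup>+x\<in>A. ennreal (volume_density g d \<phi> x) \<partial>coord_lebesgue d))"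

text \<open>
  The volume of a smooth submanifold does not depend on whether \<open>C\<^sup>1\<close> or smooth charts are used.
  On an embedded submanifold of dimension \<open>d\<close> there is exactly one such measure, as countably many
  local parametrizations cover it.
\<close>

definition riemannian_measure ::
    "('a \<Rightarrow> 'a \<Rightarrow> real) \<Rightarrow> nat \<Rightarrow> 'a::real_normed_vector set \<Rightarrow> 'a measure" where
  "riemannian_measure g d M = (THE \<mu>. is_riemannian_measure g d M \<mu>)"

text \<open>The dimension \<open>d\<close> of a nonempty embedded submanifold is unique.\<close>

definition has_riemannian_volume ::
    "('a \<Rightarrow> 'a \<Rightarrow> real) \<Rightarrow> 'a::real_normed_vector set \<Rightarrow> real \<Rightarrow> bool" where
  "has_riemannian_volume g M v \<longleftrightarrow>
     (\<exists>d. embedded_submanifold d M \<and> 0 \<le> v \<and> emeasure (riemannian_measure g d M) M = ennreal v)"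

end

theory Submission
  imports Defs
begin

text \<open>
  A hermitian matrix with distinct eigenvalues is determined by its eigenvalues and its eigenspaces, so
  near an orbit the hermitian matrices look like the product of the orbit with the space of eigenvalues.
  How Lebesgue measure on the hermitian matrices splits in this product is the content of Weyl's
  integration formula, and the volume of the orbit is read off from it.

  Fix a box \<open>B\<close> of eigenvalue vectors, with disjoint intervals as sides. The tube over a part \<open>E\<close> of the
  orbit of \<open>diagmat v\<close> consists of the matrices that arise from some \<open>X\<close> in \<open>E\<close> by keeping the
  eigenspaces and replacing the eigenvalues \<open>v\<close> by some \<open>w\<close> in \<open>B\<close>. In an eigenbasis of \<open>X\<close> this
  replacement multiplies the entry \<open>(a, b)\<close> of a tangent vector of the orbit by
  \<open>(w a - w b) / (v a - v b)\<close> (\<open>dreeigen_tangent\<close>), and each entry above the diagonal has \<open>\<beta>\<close> real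
  coordinates. The Jacobian of the map from chart coordinates and eigenvalues to the tube is therefore
  the volume density of the chart times the quotient of the \<open>\<beta>\<close>-th powers of the Vandermonde products
  of \<open>w\<close> and \<open>v\<close> (\<open>tube_jacobian\<close>). A change of variables and Fubini's theorem give, for every
  chart \<open>\<phi>\<close> and with \<open>V\<close> for the absolute value of the \<open>\<beta>\<close>-th power of the Vandermonde product,
  that the volume of the tube over \<open>\<phi> ` A\<close> is the integral of the density over \<open>A\<close> times
  \<open>K / V v\<close>, where \<open>K\<close> is the integral of \<open>V\<close> over \<open>B\<close> (\<open>tube_volume\<close>).

  So the volume of the tube over \<open>E\<close>, times \<open>V v / K\<close>, is a measure on the orbit with the right
  density in every chart. It is the Riemannian measure, as there is only one such measure
  (\<open>riemannian_measure_unique\<close>, \<open>orbit_riemannian_measure\<close>). The tube over the whole orbit is the set of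
  all hermitian matrices with eigenvalues in \<open>B\<close>, for every \<open>v\<close> (\<open>tube_orbit\<close>); its volume divided
  by \<open>K\<close> is the constant \<open>c\<close>.

  That the orbit is an embedded submanifold (\<open>embedded_submanifold_orbit\<close>) comes from the inverse
  function theorem: near one of its points the orbit is the set of the hermitian matrices \<open>X\<close> for which
  \<open>p(X)\<close> has zero diagonal in an eigenbasis of that point, \<open>p\<close> the polynomial with roots \<open>v\<close>. The arguments are the same for the three
  division algebras, and \<open>\<beta>\<close> is the real dimension of the algebra.
\<close>

section \<open>The star operation and matrices over a star division algebra\<close>

lemma linear_star: "linear (star :: 'f::star_division_algebra \<Rightarrow> 'f)"
  by (intro linearI) (simp_all add: star_add star_scaleR)

lemma star_0 [simp]: "star (0 :: 'f::star_division_algebra) = 0" by (rule linear_0[OF linear_star])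

lemma star_of_real [simp]: "star (of_real r :: 'f::star_division_algebra) = of_real r"
  by (simp add: of_real_def star_scaleR)

lemma star_diff: "star (x - y) = star x - star (y :: 'f::star_division_algebra)"
  by (rule linear_diff[OF linear_star])

lemma star_sum: "star (sum g A) = (\<Sum>i\<in>A. star (g i :: 'f::star_division_algebra))"
  by (rule linear_sum[OF linear_star])

lemma mult_star_self: "x * star x = of_real (x \<bullet> (x :: 'f::star_division_algebra))"
proof -
  have "real_part (x * star x) *\<^sub>R (1 :: 'f) = (1 / 2) *\<^sub>R (x * star x + star (x * star x))"
    by (rule real_part_eq)
  also have "\<dots> = x * star x" by (simp add: star_mult)
  finally show ?thesis by (simp add: inner_eq_real_part of_real_def)
qed

lemma star_mult_self: "star x * x = of_real (x \<bullet> (x :: 'f::star_division_algebra))"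
proof (cases "x = 0")
  case False
  have "x * (star x * x) = x * of_real (x \<bullet> x)"
    unfolding mult.assoc[symmetric] mult_star_self by (simp add: of_real_def)
  then show ?thesis using False by (simp only: mult_left_cancel not_False_eq_True)
qed simp

text \<open>
  Both products of \<open>x\<close> with \<open>star x\<close> are the square of the norm of \<open>x\<close>, so \<open>star\<close> preserves
  the norm and, by polarization, the inner product.
\<close>

lemma norm_star [simp]: "norm (star x) = norm (x :: 'f::star_division_algebra)"
proof -
  have "(of_real (star x \<bullet> star x) :: 'f) = of_real (x \<bullet> x)"
    using mult_star_self[of "star x"] unfolding star_star star_mult_self by (rule sym)
  then show ?thesis by (simp only: norm_eq_sqrt_inner of_real_eq_iff)
qed

lemma inner_star [simp]: "star x \<bullet> star y = x \<bullet> (y :: 'f::star_division_algebra)"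
  by (simp only: dot_norm star_add[symmetric] norm_star)

lemma inner_mult_right_star: "(x * y) \<bullet> z = x \<bullet> (z * star (y :: 'f::star_division_algebra))"
  by (simp add: inner_eq_real_part star_mult mult.assoc)

lemma adjoint_matrix_nth [simp]: "adjoint_matrix A $ i $ j = star (A $ j $ i)"
  by (simp add: adjoint_matrix_def)

lemma adjoint_adjoint [simp]: "adjoint_matrix (adjoint_matrix A) = A" by (simp add: vec_eq_iff)

lemma adjoint_mult: "adjoint_matrix (A ** B) = adjoint_matrix B ** adjoint_matrix A"
  by (simp add: vec_eq_iff matrix_matrix_mult_def star_sum star_mult)

lemma adjoint_diff: "adjoint_matrix (A - B) = adjoint_matrix A - adjoint_matrix B"
  by (simp add: vec_eq_iff star_diff)

lemma adjoint_mat_1 [simp]: "adjoint_matrix (mat 1 :: 'f::star_division_algebra^'n^'n) = mat 1"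
  by (simp add: vec_eq_iff mat_def)

lemma linear_adjoint: "linear (adjoint_matrix :: 'f::star_division_algebra^'n^'m \<Rightarrow> _)"
  by (intro linearI) (simp_all add: vec_eq_iff star_add star_scaleR)

lemma continuous_on_adjoint [continuous_intros]:
  fixes f :: "'a::topological_space \<Rightarrow> 'f::star_division_algebra^'n^'m"
  assumes "continuous_on S f"
  shows "continuous_on S (\<lambda>x. adjoint_matrix (f x))"
  using bounded_linear.continuous_on[OF linear_conv_bounded_linear[THEN iffD1, OF linear_adjoint] assms] .

lemma subspace_hermitian: "subspace {A :: 'f::star_division_algebra^'n^'n. hermitian A}"
proof -
  have "subspace {A :: 'f^'n^'n. A - adjoint_matrix A = 0}"
    by (intro linear_subspace_kernel linear_compose_sub linear_ident linear_adjoint)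
  then show ?thesis by (simp add: hermitian_def)
qed

lemma hermitian_nth: "hermitian A \<Longrightarrow> A $ i $ j = star (A $ j $ i)"
  by (metis adjoint_matrix_nth hermitian_def)

lemma bounded_bilinear_matrix_mult:
  "bounded_bilinear ((**) :: 'f::star_division_algebra^'n^'n \<Rightarrow> 'f^'n^'n \<Rightarrow> 'f^'n^'n)"
  unfolding bilinear_conv_bounded_bilinear[symmetric] bilinear_def by (intro conjI allI linearI)
    (simp_all add: vec_eq_iff matrix_matrix_mult_def distrib_left distrib_right sum.distrib
      scaleR_sum_right)

lemmas matrix_mult_simps =
  bounded_bilinear.scaleR_left[OF bounded_bilinear_matrix_mult]
  bounded_bilinear.scaleR_right[OF bounded_bilinear_matrix_mult]
  bounded_bilinear.diff_left[OF bounded_bilinear_matrix_mult]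
  bounded_bilinear.diff_right[OF bounded_bilinear_matrix_mult]
  bounded_bilinear.add_left[OF bounded_bilinear_matrix_mult]
  bounded_bilinear.add_right[OF bounded_bilinear_matrix_mult]
  bounded_bilinear.zero_left[OF bounded_bilinear_matrix_mult]
  bounded_bilinear.zero_right[OF bounded_bilinear_matrix_mult]
  bounded_bilinear.sum_left[OF bounded_bilinear_matrix_mult]
  bounded_bilinear.sum_right[OF bounded_bilinear_matrix_mult]

lemma continuous_on_matrix_mult [continuous_intros]:
  fixes f g :: "'a::topological_space \<Rightarrow> 'f::star_division_algebra^'n^'n"
  assumes "continuous_on S f" "continuous_on S g"
  shows "continuous_on S (\<lambda>x. f x ** g x)"
  using bounded_bilinear.continuous_on[OF bounded_bilinear_matrix_mult assms] .

lemma inner_matrix_mult_right: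
  fixes A B C :: "'f::star_division_algebra^'n^'n"
  shows "(A ** B) \<bullet> C = A \<bullet> (C ** adjoint_matrix B)"
proof -
  have "(A ** B) \<bullet> C = (\<Sum>i\<in>UNIV. \<Sum>j\<in>UNIV. \<Sum>k\<in>UNIV. A $ i $ k \<bullet> (C $ i $ j * star (B $ k $ j)))"
    by (simp add: inner_vec_def matrix_matrix_mult_def inner_sum_left inner_mult_right_star)
  also have "\<dots> = (\<Sum>i\<in>UNIV. \<Sum>k\<in>UNIV. \<Sum>j\<in>UNIV. A $ i $ k \<bullet> (C $ i $ j * star (B $ k $ j)))"
    by (intro sum.cong refl sum.swap)
  finally show ?thesis by (simp add: inner_vec_def matrix_matrix_mult_def inner_sum_right)
qed

lemma inner_adjoint:
  fixes A B :: "'f::star_division_algebra^'n^'n"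
  shows "adjoint_matrix A \<bullet> adjoint_matrix B = A \<bullet> B"
  unfolding inner_vec_def adjoint_matrix_nth inner_star by (rule sum.swap)

lemma inner_matrix_mult_left:
  fixes A B C :: "'f::star_division_algebra^'n^'n"
  shows "(A ** B) \<bullet> C = B \<bullet> (adjoint_matrix A ** C)"
proof -
  have "(A ** B) \<bullet> C = (adjoint_matrix B ** adjoint_matrix A) \<bullet> adjoint_matrix C"
    by (simp only: adjoint_mult[symmetric] inner_adjoint)
  also have "\<dots> = adjoint_matrix B \<bullet> adjoint_matrix (adjoint_matrix A ** C)"
    by (simp add: inner_matrix_mult_right adjoint_mult)
  finally show ?thesis by (simp only: inner_adjoint)
qed

section \<open>The unitary group and conjugation\<close>

text \<open>
  A one-sided inverse in a finite-dimensional algebra is two-sided. As the entries need not commute,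
  the reason is not a determinant but the rank of right multiplication by \<open>B\<close> as a real-linear map.
\<close>

lemma matrix_one_sided_inverse:
  fixes A B :: "'f::star_division_algebra^'n^'n"
  assumes "A ** B = mat 1"
  shows "B ** A = mat 1"
proof -
  have lin: "linear (\<lambda>X :: 'f^'n^'n. X ** C)" for C :: "'f^'n^'n"
    by (intro linearI) (simp_all add: matrix_mult_simps)
  have "(\<lambda>X :: 'f^'n^'n. X ** B) \<circ> (\<lambda>X. X ** A) = id"
    using assms by (auto simp: fun_eq_iff matrix_mul_assoc[symmetric])
  then have "(\<lambda>X :: 'f^'n^'n. X ** A) \<circ> (\<lambda>X. X ** B) = id"
    by (rule iffD1[OF linear_inverse_left[OF lin lin]])
  from fun_cong[OF this, of "mat 1"] show ?thesis by simp
qed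

lemma unitary_right: "U \<in> unitary_group \<Longrightarrow> U ** adjoint_matrix U = mat 1"
  by (simp add: unitary_group_def)

lemma unitary_left: "U \<in> unitary_group \<Longrightarrow> adjoint_matrix U ** U = mat 1"
  by (rule matrix_one_sided_inverse) (rule unitary_right)

lemma unitary_mat_1 [simp]: "mat 1 \<in> unitary_group" by (simp add: unitary_group_def)

lemma unitary_adjoint: "U \<in> unitary_group \<Longrightarrow> adjoint_matrix U \<in> unitary_group"
  using unitary_left by (auto simp: unitary_group_def)

lemma unitary_mult:
  assumes "U \<in> unitary_group" "V \<in> unitary_group"
  shows "U ** V \<in> unitary_group"
proof -
  have "(U ** V) ** adjoint_matrix (U ** V) = U ** (V ** adjoint_matrix V) ** adjoint_matrix U"
    by (simp add: adjoint_mult matrix_mul_assoc)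
  then show ?thesis using assms by (simp add: unitary_group_def)
qed

definition conj_by ::
    "'f::star_division_algebra^'n^'n \<Rightarrow> 'f^'n^'n \<Rightarrow> 'f^'n^'n" where
  "conj_by U X = U ** X ** adjoint_matrix U"

lemma conj_by_conj_by: "conj_by U (conj_by V X) = conj_by (U ** V) X"
  by (simp add: conj_by_def adjoint_mult matrix_mul_assoc)

lemma conj_by_mat_1 [simp]: "conj_by (mat 1) X = X" by (simp add: conj_by_def)

lemma conj_by_adjoint [simp]:
  assumes "U \<in> unitary_group"
  shows "conj_by U (conj_by (adjoint_matrix U) X) = X" "conj_by (adjoint_matrix U) (conj_by U X) = X"
  using assms by (simp_all add: conj_by_conj_by unitary_left unitary_right)

lemma linear_conj_by: "linear (conj_by U)"
  by (intro linearI) (simp_all add: conj_by_def matrix_mult_simps)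

lemma continuous_on_conj_by:
  fixes f :: "'a::topological_space \<Rightarrow> 'f::star_division_algebra^'n^'n"
  assumes "continuous_on S f"
  shows "continuous_on S (\<lambda>x. conj_by U (f x))"
  unfolding conj_by_def by (intro continuous_intros assms)

lemma adjoint_conj_by: "adjoint_matrix (conj_by U X) = conj_by U (adjoint_matrix X)"
  by (simp add: conj_by_def adjoint_mult matrix_mul_assoc)

lemma hermitian_conj_by: "hermitian X \<Longrightarrow> hermitian (conj_by U X)"
  unfolding hermitian_def adjoint_conj_by by simp

lemma conj_by_mult:
  assumes "U \<in> unitary_group"
  shows "conj_by U (X ** Y) = conj_by U X ** conj_by U Y"
proof -
  have "conj_by U X ** conj_by U Y = U ** X ** (adjoint_matrix U ** U) ** Y ** adjoint_matrix U"
    by (simp add: conj_by_def matrix_mul_assoc)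
  then show ?thesis using assms by (simp add: conj_by_def unitary_left matrix_mul_assoc)
qed

lemma conj_by_unit: "U \<in> unitary_group \<Longrightarrow> conj_by U (mat 1) = mat 1"
  by (simp add: conj_by_def unitary_right)

lemma conj_by_minus_scaleR:
  assumes "U \<in> unitary_group"
  shows "conj_by U X - r *\<^sub>R mat 1 = conj_by U (X - r *\<^sub>R mat 1)"
  using assms by (simp add: linear_diff[OF linear_conj_by] linear_cmul[OF linear_conj_by] conj_by_unit)

lemma inner_conj_by:
  assumes "U \<in> unitary_group"
  shows "conj_by U X \<bullet> conj_by U Y = X \<bullet> Y"
proof -
  have "conj_by U X \<bullet> conj_by U Y = (U ** X) \<bullet> (conj_by U Y ** U)"
    unfolding conj_by_def[of U X] by (simp add: inner_matrix_mult_right)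
  also have "\<dots> = X \<bullet> (adjoint_matrix U ** (conj_by U Y ** U))" by (rule inner_matrix_mult_left)
  also have "adjoint_matrix U ** (conj_by U Y ** U) = conj_by (adjoint_matrix U) (conj_by U Y)"
    by (simp add: conj_by_def[of "adjoint_matrix U"] matrix_mul_assoc)
  finally show ?thesis using assms by simp
qed

lemma unitary_orbit_eq: "unitary_orbit S = (\<lambda>U. conj_by U S) ` unitary_group"
  by (auto simp: unitary_orbit_def conj_by_def)

lemma unitary_orbit_conj_by:
  fixes S V :: "'f::star_division_algebra^'n^'n"
  assumes "V \<in> unitary_group"
  shows "unitary_orbit (conj_by V S) = unitary_orbit S"
proof -
  have 1: "\<exists>W\<in>unitary_group. conj_by U S = conj_by W (conj_by V S)" if U: "U \<in> unitary_group" for U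
  proof (rule bexI)
    show "conj_by U S = conj_by (U ** adjoint_matrix V) (conj_by V S)"
      by (simp only: conj_by_conj_by[of U, symmetric] conj_by_adjoint[OF assms])
    show "U ** adjoint_matrix V \<in> unitary_group" by (intro unitary_mult unitary_adjoint U assms)
  qed
  have 2: "\<exists>W\<in>unitary_group. conj_by U (conj_by V S) = conj_by W S" if U: "U \<in> unitary_group" for U
    using unitary_mult[OF U assms] conj_by_conj_by by blast
  show ?thesis
    unfolding unitary_orbit_eq
  proof (rule subset_antisym; rule image_subsetI)
    fix U :: "'f^'n^'n" assume U: "U \<in> unitary_group"
    show "conj_by U (conj_by V S) \<in> (\<lambda>U. conj_by U S) ` unitary_group"
      using 2[OF U] by (simp only: image_iff)
    show "conj_by U S \<in> (\<lambda>U. conj_by U (conj_by V S)) ` unitary_group"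
      using 1[OF U] by (simp only: image_iff)
  qed
qed

lemma compact_unitary_group: "compact (unitary_group :: ('f::star_division_algebra^'n^'n) set)"
proof -
  have "norm U = norm (mat 1 :: 'f^'n^'n)" if "U \<in> unitary_group" for U :: "'f^'n^'n"
  proof -
    have "U \<bullet> U = (mat 1 ** U) \<bullet> U" by simp
    also have "\<dots> = mat 1 \<bullet> (mat 1 :: 'f^'n^'n)"
      by (subst inner_matrix_mult_right) (simp add: that unitary_right)
    finally show ?thesis by (simp add: norm_eq_sqrt_inner)
  qed
  then have "bounded (unitary_group :: ('f^'n^'n) set)"
    by (intro boundedI[of _ "norm (mat 1 :: 'f^'n^'n)"]) (rule eq_refl)
  moreover have "closed (unitary_group :: ('f^'n^'n) set)"
    unfolding unitary_group_def by (intro closed_Collect_eq continuous_intros)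
  ultimately show ?thesis by (simp add: compact_eq_bounded_closed)
qed

lemma compact_unitary_orbit: "compact (unitary_orbit (S :: 'f::star_division_algebra^'n^'n))"
  unfolding unitary_orbit_eq conj_by_def
  by (intro compact_continuous_image compact_unitary_group continuous_intros)

section \<open>Diagonal matrices and diagonalization\<close>

definition diagmat :: "('n \<Rightarrow> real) \<Rightarrow> 'f::star_division_algebra^'n^'n" where
  "diagmat v = (\<chi> i j. if i = j then of_real (v i) else 0)"

lemma diagmat_nth: "diagmat v $ i $ j = (if i = j then of_real (v i) else 0)"
  by (simp add: diagmat_def)

lemma hermitian_diagmat: "hermitian (diagmat v)"
  by (auto simp: hermitian_def vec_eq_iff diagmat_nth)

lemma mult_diagmat_nth: "(A ** diagmat v) $ i $ j = v j *\<^sub>R (A $ i $ j)"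
proof -
  have "(A ** diagmat v) $ i $ j = (\<Sum>k\<in>UNIV. if k = j then A $ i $ k * of_real (v k) else 0)"
    unfolding matrix_matrix_mult_def diagmat_nth vec_lambda_beta by (rule sum.cong) auto
  then show ?thesis by (simp add: of_real_def)
qed

lemma diagmat_mult_nth: "(diagmat v ** A) $ i $ j = v i *\<^sub>R (A $ i $ j)"
proof -
  have "(diagmat v ** A) $ i $ j = (\<Sum>k\<in>UNIV. if i = k then of_real (v k) * A $ k $ j else 0)"
    unfolding matrix_matrix_mult_def diagmat_nth vec_lambda_beta by (rule sum.cong) auto
  then show ?thesis by (simp add: of_real_def)
qed

lemma diagmat_scaleR: "diagmat (\<lambda>i. r * v i) = r *\<^sub>R diagmat v"
  by (simp add: vec_eq_iff diagmat_nth of_real_def)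

lemma diagmat_sum: "diagmat (\<lambda>i. \<Sum>a\<in>I. f a i) = (\<Sum>a\<in>I. diagmat (f a))"
  by (auto simp: vec_eq_iff diagmat_nth)

lemma diagmat_mult_diagmat: "diagmat v ** diagmat w = diagmat (\<lambda>i. v i * w i)"
  by (auto simp: vec_eq_iff mult_diagmat_nth diagmat_nth of_real_def)

lemma diagmat_minus: "diagmat v - r *\<^sub>R mat 1 = diagmat (\<lambda>i. v i - r)"
  by (auto simp: vec_eq_iff diagmat_nth mat_def of_real_def scaleR_diff_left)

text \<open>
  Eigenvectors of a hermitian matrix for distinct real eigenvalues are orthogonal: the Gram matrix
  \<open>H\<close> of the eigenvectors commutes with the diagonal matrix of the eigenvalues.
\<close>

lemma hermitian_diagonalization:
  fixes X :: "'f::star_division_algebra^'n^'n" and v :: "'n \<Rightarrow> real"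
  assumes herm: "hermitian X" and inj: "inj v"
    and ev: "\<And>a. \<exists>w. w \<noteq> 0 \<and> X *v w = v a *\<^sub>R w"
  shows "\<exists>U\<in>unitary_group. X = conj_by U (diagmat v)"
proof -
  obtain w0 where w0: "\<And>a. w0 a \<noteq> 0" "\<And>a. X *v w0 a = v a *\<^sub>R w0 a" using ev by metis
  define w where "w a = (1 / norm (w0 a)) *\<^sub>R w0 a" for a
  define U where "U = (\<chi> i a. w a $ i)"
  have lin: "X *v (r *\<^sub>R y) = r *\<^sub>R (X *v y)" for r y
    by (simp add: vec_eq_iff matrix_vector_mult_def scaleR_sum_right)
  have norm_w: "w a \<bullet> w a = 1" for a
  proof -
    have "norm (w a) = 1" using w0(1) by (simp add: w_def)
    then show ?thesis by (simp add: norm_eq_sqrt_inner)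
  qed
  have Xw: "X *v w a = v a *\<^sub>R w a" for a by (simp add: w_def lin w0(2))
  have XU: "X ** U = U ** diagmat v"
  proof -
    have "(X ** U) $ i $ a = (X *v w a) $ i" for i a
      by (simp add: U_def matrix_matrix_mult_def matrix_vector_mult_def)
    then show ?thesis by (simp add: vec_eq_iff mult_diagmat_nth Xw) (simp add: U_def)
  qed
  define H where "H = adjoint_matrix U ** U"
  have "H ** diagmat v = adjoint_matrix U ** (X ** U)" by (simp add: XU H_def matrix_mul_assoc)
  also have "\<dots> = adjoint_matrix (X ** U) ** U"
    using herm by (simp add: adjoint_mult matrix_mul_assoc hermitian_def)
  also have "\<dots> = diagmat v ** H"
    using hermitian_diagmat[of v, where 'a='f]
    by (simp add: XU H_def adjoint_mult matrix_mul_assoc hermitian_def)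
  finally have comm: "H ** diagmat v = diagmat v ** H" .
  have "H $ a $ b = mat 1 $ a $ b" for a b
  proof (cases "a = b")
    case True
    have "H $ a $ a = of_real (\<Sum>i\<in>UNIV. w a $ i \<bullet> w a $ i)"
      by (simp add: H_def U_def matrix_matrix_mult_def star_mult_self del: inner_real_def)
    then show ?thesis using True norm_w[of a] by (simp add: inner_vec_def mat_def del: of_real_sum)
  next
    case False
    have "v b *\<^sub>R (H $ a $ b) = v a *\<^sub>R (H $ a $ b)"
      using comm by (metis diagmat_mult_nth mult_diagmat_nth)
    then show ?thesis using False inj by (auto simp: mat_def inj_eq)
  qed
  then have "H = mat 1" by (simp add: vec_eq_iff)
  then have UU: "U ** adjoint_matrix U = mat 1" unfolding H_def by (rule matrix_one_sided_inverse)
  have "X = X ** (U ** adjoint_matrix U)" by (simp add: UU)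
  also have "\<dots> = conj_by U (diagmat v)" by (simp add: matrix_mul_assoc XU conj_by_def)
  finally show ?thesis using UU by (auto simp: unitary_group_def)
qed

section \<open>Products of linear factors\<close>

text \<open>
  These are the real polynomials in a matrix that occur here: the polynomial that
  vanishes on an orbit, and the spectral projections.
\<close>

primrec lin_prod :: "real list \<Rightarrow> 'f::star_division_algebra^'n^'n \<Rightarrow> 'f^'n^'n" where
  "lin_prod [] X = mat 1"
| "lin_prod (r # rs) X = (X - r *\<^sub>R mat 1) ** lin_prod rs X"

primrec dlin_prod ::
    "real list \<Rightarrow> 'f::star_division_algebra^'n^'n \<Rightarrow> 'f^'n^'n \<Rightarrow> 'f^'n^'n" where
  "dlin_prod [] X H = 0"
| "dlin_prod (r # rs) X H = H ** lin_prod rs X + (X - r *\<^sub>R mat 1) ** dlin_prod rs X H"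

lemma has_derivative_matrix_mult:
  fixes f g :: "'a::real_normed_vector \<Rightarrow> 'f::star_division_algebra^'n^'n"
  assumes "(f has_derivative f') (at x within S)" "(g has_derivative g') (at x within S)"
  shows "((\<lambda>x. f x ** g x) has_derivative (\<lambda>h. f x ** g' h + f' h ** g x)) (at x within S)"
  using bounded_bilinear.FDERIV[OF bounded_bilinear_matrix_mult assms] .

lemma has_derivative_lin_prod: "(lin_prod rs has_derivative dlin_prod rs X) (at X)"
proof (induction rs)
  case Nil
  then show ?case using has_derivative_const[of "mat 1" "at X"] by (simp add: fun_eq_iff[symmetric])
next
  case (Cons r rs)
  have "((\<lambda>X. (X - r *\<^sub>R mat 1) ** lin_prod rs X) has_derivative
      (\<lambda>H. (X - r *\<^sub>R mat 1) ** dlin_prod rs X H + (H - 0) ** lin_prod rs X)) (at X)"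
    by (intro has_derivative_matrix_mult has_derivative_diff has_derivative_ident
        has_derivative_const Cons)
  then show ?case by (simp add: add.commute)
qed

lemma continuous_on_lin_prod [continuous_intros]:
  "continuous_on S f \<Longrightarrow> continuous_on S (\<lambda>x. lin_prod rs (f x))"
  by (induction rs) (auto intro!: continuous_intros)

lemma continuous_on_dlin_prod: "continuous_on UNIV (\<lambda>X. dlin_prod rs X H)"
  by (induction rs) (auto intro!: continuous_intros)

lemma lin_prod_commute: "X ** lin_prod rs X = lin_prod rs X ** X"
proof (induction rs)
  case (Cons r rs)
  have "X ** lin_prod (r # rs) X = (X - r *\<^sub>R mat 1) ** (X ** lin_prod rs X)"
    by (simp add: matrix_mult_simps matrix_mul_assoc)
  then show ?case by (simp add: Cons matrix_mul_assoc)
qed simp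

lemma lin_prod_remove1:
  "r \<in> set rs \<Longrightarrow> lin_prod rs X = (X - r *\<^sub>R mat 1) ** lin_prod (remove1 r rs) X"
proof (induction rs)
  case (Cons s rs)
  show ?case
  proof (cases "r = s")
    case False
    have "(X - s *\<^sub>R mat 1) ** (X - r *\<^sub>R mat 1) = (X - r *\<^sub>R mat 1) ** (X - s *\<^sub>R mat 1)"
      by (simp add: matrix_mult_simps algebra_simps)
    then show ?thesis using False Cons by (simp add: matrix_mul_assoc)
  qed simp
qed simp

lemma lin_prod_conj_by:
  assumes "U \<in> unitary_group"
  shows "lin_prod rs (conj_by U X) = conj_by U (lin_prod rs X)"
  using assms by (induction rs) (simp_all add: conj_by_unit conj_by_minus_scaleR conj_by_mult)

lemma lin_prod_adjoint: "adjoint_matrix (lin_prod rs X) = lin_prod rs (adjoint_matrix X)"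
proof (induction rs)
  case (Cons r rs)
  have "adjoint_matrix (lin_prod (r # rs) X)
      = lin_prod rs (adjoint_matrix X) ** (adjoint_matrix X - r *\<^sub>R mat 1)"
    by (simp add: adjoint_mult adjoint_diff Cons linear_cmul[OF linear_adjoint])
  then show ?case by (simp add: matrix_mult_simps lin_prod_commute)
qed simp

lemma lin_prod_diagmat: "lin_prod rs (diagmat v) = diagmat (\<lambda>i. \<Prod>r\<leftarrow>rs. v i - r)"
proof (induction rs)
  case Nil
  then show ?case by (simp add: vec_eq_iff diagmat_nth mat_def)
next
  case (Cons r rs)
  then show ?case by (simp add: diagmat_minus diagmat_mult_diagmat)
qed

text \<open>The derivative at \<open>t\<close> of the monic polynomial with roots \<open>rs\<close>.\<close>

primrec dprod :: "real list \<Rightarrow> real \<Rightarrow> real" where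
  "dprod [] t = 0"
| "dprod (r # rs) t = (\<Prod>s\<leftarrow>rs. t - s) + (t - r) * dprod rs t"

lemma dprod_nonzero:
  assumes "distinct rs" "t \<in> set rs"
  shows "dprod rs t \<noteq> 0"
  using assms
proof (induction rs)
  case (Cons r rs)
  show ?case
  proof (cases "t = r")
    case True
    then show ?thesis using Cons.prems by (auto simp: prod_list_zero_iff)
  next
    case False
    then have "(\<Prod>s\<leftarrow>rs. t - s) = 0" using Cons.prems by (auto simp: prod_list_zero_iff)
    then show ?thesis using False Cons by simp
  qed
qed simp

lemma dlin_prod_diagmat_diagonal:
  "dlin_prod rs (diagmat v) H $ i $ i = dprod rs (v i) *\<^sub>R (H $ i $ i)"
proof (induction rs)
  case (Cons r rs)
  then show ?case
    by (simp add: diagmat_minus lin_prod_diagmat mult_diagmat_nth diagmat_mult_nth scaleR_add_left)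
qed simp

section \<open>Orthonormal coordinates on the hermitian matrices\<close>

definition rank :: "'n::finite \<Rightarrow> nat" where
  "rank = (SOME h. bij_betw h UNIV {..<CARD('n)})"

lemma bij_betw_rank: "bij_betw (rank :: 'n::finite \<Rightarrow> nat) UNIV {..<CARD('n)}"
  unfolding rank_def by (rule someI_ex[where P = "\<lambda>h. bij_betw h UNIV {..<CARD('n)}"])
    (metis atLeast0LessThan ex_bij_betw_finite_nat finite)

lemma inj_rank: "inj (rank :: 'n::finite \<Rightarrow> nat)" using bij_betw_rank by (rule bij_betw_imp_inj_on)

lemma rank_less: "rank (a :: 'n::finite) < CARD('n)"
  using bij_betw_rank[where 'n='n] by (auto simp: bij_betw_def)

lemma rank_neqE:
  fixes a b :: "'n::finite"
  assumes "a \<noteq> b"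
  obtains "rank a < rank b" | "rank b < rank a"
  using assms inj_rank by (metis injD linorder_neqE_nat)

text \<open>
  The off-diagonal part of a hermitian matrix has one real coordinate for each entry above the diagonal
  and each basis element of the algebra; their number is the dimension of the orbits.
\<close>

definition offdiag_index :: "('n::finite \<times> 'n \<times> 'f::star_division_algebra) set" where
  "offdiag_index = (SIGMA a:UNIV. {b. rank a < rank b} \<times> Basis)"

definition orbit_dim :: "('f::star_division_algebra^'n^'n) itself \<Rightarrow> nat" where
  "orbit_dim _ = card (offdiag_index :: ('n \<times> 'n \<times> 'f) set)"

lemma finite_offdiag_index: "finite (offdiag_index :: ('n::finite \<times> 'n \<times> 'f::star_division_algebra) set)"
  by (simp add: offdiag_index_def)

definition oidx :: "nat \<Rightarrow> 'n::finite \<times> 'n \<times> 'f::star_division_algebra" where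
  "oidx = (SOME h. bij_betw h {..<orbit_dim TYPE('f^'n^'n)} offdiag_index)"

lemma bij_betw_oidx:
  "bij_betw (oidx :: nat \<Rightarrow> 'n::finite \<times> 'n \<times> 'f::star_division_algebra)
    {..<orbit_dim TYPE('f^'n^'n)} offdiag_index"
  unfolding oidx_def
  by (rule someI_ex[where P = "\<lambda>h. bij_betw h {..<orbit_dim TYPE('f^'n^'n)} offdiag_index"])
    (metis atLeast0LessThan orbit_dim_def ex_bij_betw_nat_finite finite_offdiag_index)

definition orow :: "('f::star_division_algebra^'n^'n) itself \<Rightarrow> nat \<Rightarrow> 'n" where
  "orow _ k = fst (oidx k :: 'n \<times> 'n \<times> 'f)"

definition ocol :: "('f::star_division_algebra^'n^'n) itself \<Rightarrow> nat \<Rightarrow> 'n" where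
  "ocol _ k = fst (snd (oidx k :: 'n \<times> 'n \<times> 'f))"

definition ounit :: "('f::star_division_algebra^'n^'n) itself \<Rightarrow> nat \<Rightarrow> 'f" where
  "ounit _ k = snd (snd (oidx k :: 'n \<times> 'n \<times> 'f))"

lemma oidx_less:
  fixes T :: "('f::star_division_algebra^'n^'n) itself"
  assumes "k < orbit_dim T"
  shows "rank (orow T k) < rank (ocol T k)" "ounit T k \<in> Basis"
proof -
  have "(oidx k :: 'n \<times> 'n \<times> 'f) \<in> offdiag_index"
    using bij_betw_apply[OF bij_betw_oidx[where 'n='n and 'f='f], of k] assms
    by (simp add: orbit_dim_def)
  then show "rank (orow T k) < rank (ocol T k)" "ounit T k \<in> Basis"
    by (auto simp: offdiag_index_def orow_def ocol_def ounit_def)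
qed

lemma oidx_inj:
  fixes T :: "('f::star_division_algebra^'n^'n) itself"
  assumes "j < orbit_dim T" "k < orbit_dim T"
    and "orow T j = orow T k" "ocol T j = ocol T k" "ounit T j = ounit T k"
  shows "j = k"
proof -
  have "(oidx j :: 'n \<times> 'n \<times> 'f) = oidx k"
    using assms(3-) by (simp add: prod_eq_iff orow_def ocol_def ounit_def)
  then show ?thesis
    using bij_betw_imp_inj_on[OF bij_betw_oidx[where 'n='n and 'f='f]] assms(1,2)
    by (auto simp: inj_on_def orbit_dim_def)
qed

text \<open>
  The factor \<open>sqrt 2\<close> accounts for the two mirror entries of a hermitian matrix and makes these
  coordinates orthonormal for the Frobenius metric.
\<close>

definition herm_coord :: "nat \<Rightarrow> 'f::star_division_algebra^'n^'n \<Rightarrow> real" where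
  "herm_coord k X =
    (let T = TYPE('f^'n^'n); a = inv rank (k - orbit_dim T) in
     if k < orbit_dim T then sqrt 2 * (X $ orow T k $ ocol T k \<bullet> ounit T k) else X $ a $ a \<bullet> 1)"

lemma linear_herm_coord: "linear (herm_coord k)"
  by (intro linearI) (simp_all add: herm_coord_def Let_def inner_add_left algebra_simps)

lemma herm_coord_offdiag:
  "k < orbit_dim TYPE('f^'n^'n) \<Longrightarrow>
    herm_coord k (X :: 'f::star_division_algebra^'n^'n) =
      sqrt 2 * (X $ orow TYPE('f^'n^'n) k $ ocol TYPE('f^'n^'n) k \<bullet> ounit TYPE('f^'n^'n) k)"
  by (simp add: herm_coord_def)

lemma herm_coord_diag:
  "herm_coord (orbit_dim TYPE('f^'n^'n) + rank a) (X :: 'f::star_division_algebra^'n^'n) = X $ a $ a \<bullet> 1"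
  by (simp add: herm_coord_def Let_def inv_f_f[OF inj_rank])

lemma self_adjoint_real:
  fixes x :: "'f::star_division_algebra"
  assumes "x = star x"
  shows "x = (x \<bullet> 1) *\<^sub>R 1"
proof -
  have "real_part x *\<^sub>R (1 :: 'f) = (1 / 2) *\<^sub>R (x + x)" using real_part_eq[of x] assms by simp
  then show ?thesis by (simp add: real_part_eq_inner_1)
qed

lemma sum_oidx:
  fixes g :: "'n::finite \<Rightarrow> 'n \<Rightarrow> 'f::star_division_algebra \<Rightarrow> real"
  defines "T \<equiv> TYPE('f^'n^'n)"
  shows "(\<Sum>k<orbit_dim T. g (orow T k) (ocol T k) (ounit T k))
    = (\<Sum>a\<in>UNIV. \<Sum>b\<in>{b. rank a < rank b}. \<Sum>u\<in>Basis. g a b u)"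
proof -
  have "(\<Sum>k<orbit_dim T. g (orow T k) (ocol T k) (ounit T k))
      = (\<Sum>(a, b, u)\<in>offdiag_index. g a b u)"
    unfolding T_def orow_def ocol_def ounit_def
    using sum.reindex_bij_betw[OF bij_betw_oidx[where 'n='n and 'f='f], of "\<lambda>(a, b, u). g a b u"]
    by (simp add: case_prod_beta)
  also have "\<dots> = (\<Sum>a\<in>UNIV. \<Sum>b\<in>{b. rank a < rank b}. \<Sum>u\<in>Basis. g a b u)"
    unfolding offdiag_index_def sum.cartesian_product by (subst sum.Sigma) (simp_all add: case_prod_beta)
  finally show ?thesis .
qed

lemma prod_oidx:
  fixes g :: "'n::finite \<Rightarrow> 'n \<Rightarrow> real"
  defines "T \<equiv> TYPE('f::star_division_algebra^'n^'n)"
  shows "(\<Prod>k<orbit_dim T. g (orow T k) (ocol T k))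
    = (\<Prod>a\<in>UNIV. \<Prod>b\<in>{b. rank a < rank b}. g a b) ^ DIM('f)"
proof -
  have "(\<Prod>k<orbit_dim T. g (orow T k) (ocol T k))
      = (\<Prod>(a, b, u)\<in>(offdiag_index :: ('n \<times> 'n \<times> 'f) set). g a b)"
    unfolding T_def orow_def ocol_def ounit_def
    using prod.reindex_bij_betw[OF bij_betw_oidx[where 'n='n and 'f='f], of "\<lambda>(a, b, u). g a b"]
    by (simp add: case_prod_beta)
  also have "\<dots> = (\<Prod>a\<in>UNIV. \<Prod>b\<in>{b. rank a < rank b}. \<Prod>u\<in>(Basis :: 'f set). g a b)"
    unfolding offdiag_index_def prod.cartesian_product by (subst prod.Sigma) (simp_all add: case_prod_beta)
  finally show ?thesis by (simp add: prod_power_distrib)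
qed

lemma sum_offdiag_pairs:
  fixes h :: "'n::finite \<Rightarrow> 'n \<Rightarrow> real"
  assumes sym: "\<And>a b. h a b = h b a"
  shows "(\<Sum>a\<in>UNIV. \<Sum>b\<in>UNIV. h a b)
    = (\<Sum>a\<in>UNIV. h a a) + 2 * (\<Sum>a\<in>UNIV. \<Sum>b\<in>{b. rank a < rank b}. h a b)"
proof -
  have split: "(\<Sum>b\<in>UNIV. h a b) =
      h a a + (\<Sum>b\<in>{b. rank a < rank b}. h a b) + (\<Sum>b\<in>{b. rank b < rank a}. h a b)" for a
  proof -
    have "(UNIV :: 'n set) = insert a ({b. rank a < rank b} \<union> {b. rank b < rank a})"
      by (auto elim: rank_neqE)
    then have "(\<Sum>b\<in>UNIV. h a b) = (\<Sum>b\<in>insert a ({b. rank a < rank b} \<union> {b. rank b < rank a}). h a b)"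
      by (rule arg_cong)
    also have "\<dots> = h a a + (\<Sum>b\<in>{b. rank a < rank b} \<union> {b. rank b < rank a}. h a b)"
      by (rule sum.insert) auto
    also have "(\<Sum>b\<in>{b. rank a < rank b} \<union> {b. rank b < rank a}. h a b) =
        (\<Sum>b\<in>{b. rank a < rank b}. h a b) + (\<Sum>b\<in>{b. rank b < rank a}. h a b)"
      by (rule sum.union_disjoint) auto
    finally show ?thesis by simp
  qed
  have "(\<Sum>a\<in>UNIV. \<Sum>b\<in>{b. rank b < rank a}. h a b) = (\<Sum>b\<in>UNIV. \<Sum>a\<in>{a. rank b < rank a}. h a b)"
    using sum.swap_restrict[of UNIV UNIV "\<lambda>a b. h a b" "\<lambda>a b. rank b < rank a"]
    by (simp only: finite UNIV_I simp_thms)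
  also have "\<dots> = (\<Sum>b\<in>UNIV. \<Sum>a\<in>{a. rank b < rank a}. h b a)" by (simp add: sym)
  finally show ?thesis by (simp add: split sum.distrib)
qed

lemma sum_lessThan_add: "(\<Sum>k<m + n. g k) = (\<Sum>k<m. g k) + (\<Sum>k<n. g (m + k :: nat) :: real)"
  by (induction n) simp_all

text \<open>
  Parseval's identity. The entries below the diagonal contribute as much as those above, because \<open>star\<close>
  preserves the inner product, and the diagonal entries are real.
\<close>

lemma inner_eq_sum_herm_coord:
  fixes X Y :: "'f::star_division_algebra^'n^'n"
  assumes "hermitian X" "hermitian Y"
  shows "X \<bullet> Y = (\<Sum>k<orbit_dim TYPE('f^'n^'n) + CARD('n). herm_coord k X * herm_coord k Y)"
proof -
  let ?T = "TYPE('f^'n^'n)"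
  define d where "d = orbit_dim ?T"
  have "(\<Sum>k<d + CARD('n). herm_coord k X * herm_coord k Y) =
      (\<Sum>k<d. herm_coord k X * herm_coord k Y) +
      (\<Sum>k<CARD('n). herm_coord (d + k) X * herm_coord (d + k) Y)" by (rule sum_lessThan_add)
  moreover have "(\<Sum>k<d. herm_coord k X * herm_coord k Y)
      = 2 * (\<Sum>a\<in>UNIV. \<Sum>b\<in>{b. rank a < rank b}. X $ a $ b \<bullet> Y $ a $ b)"
  proof -
    have "(\<Sum>k<d. herm_coord k X * herm_coord k Y)
        = (\<Sum>k<d. 2 * ((X $ orow ?T k $ ocol ?T k \<bullet> ounit ?T k) * (Y $ orow ?T k $ ocol ?T k \<bullet> ounit ?T k)))"
      by (intro sum.cong refl) (simp add: d_def herm_coord_offdiag)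
    also have "\<dots> = (\<Sum>a\<in>UNIV. \<Sum>b\<in>{b. rank a < rank b}. \<Sum>u\<in>Basis. 2 * ((X $ a $ b \<bullet> u) * (Y $ a $ b \<bullet> u)))"
      unfolding d_def by (rule sum_oidx)
    also have "\<dots> = 2 * (\<Sum>a\<in>UNIV. \<Sum>b\<in>{b. rank a < rank b}. X $ a $ b \<bullet> Y $ a $ b)"
      by (simp add: sum_distrib_left[symmetric] euclidean_inner[symmetric])
    finally show ?thesis .
  qed
  moreover have "(\<Sum>k<CARD('n). herm_coord (d + k) X * herm_coord (d + k) Y)
      = (\<Sum>a\<in>UNIV. X $ a $ a \<bullet> Y $ a $ a)"
  proof -
    have "(\<Sum>k<CARD('n). herm_coord (d + k) X * herm_coord (d + k) Y) =
        (\<Sum>a\<in>UNIV. (X $ a $ a \<bullet> 1) * (Y $ a $ a \<bullet> 1))"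
      using sum.reindex_bij_betw[OF bij_betw_rank[where 'n='n], of "\<lambda>k. herm_coord (d + k) X * herm_coord (d + k) Y"]
      by (simp add: d_def herm_coord_diag)
    moreover have "(X $ a $ a \<bullet> 1) * (Y $ a $ a \<bullet> 1) = X $ a $ a \<bullet> Y $ a $ a" for a
      using arg_cong[OF self_adjoint_real[OF hermitian_nth[OF assms(1), of a a]],
          of "\<lambda>z. z \<bullet> Y $ a $ a"] by (simp add: inner_commute)
    ultimately show ?thesis by simp
  qed
  moreover have "X \<bullet> Y = (\<Sum>a\<in>UNIV. X $ a $ a \<bullet> Y $ a $ a) +
      2 * (\<Sum>a\<in>UNIV. \<Sum>b\<in>{b. rank a < rank b}. X $ a $ b \<bullet> Y $ a $ b)"
    unfolding inner_vec_def
  proof (rule sum_offdiag_pairs)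
    show "X $ a $ b \<bullet> Y $ a $ b = X $ b $ a \<bullet> Y $ b $ a" for a b
      using hermitian_nth[OF assms(1), of a b] hermitian_nth[OF assms(2), of a b] by simp
  qed
  ultimately show ?thesis unfolding d_def by linarith
qed

lemma hermitian_eq_0I:
  fixes X :: "'f::star_division_algebra^'n^'n"
  assumes "hermitian X" "\<And>k. k < orbit_dim TYPE('f^'n^'n) + CARD('n) \<Longrightarrow> herm_coord k X = 0"
  shows "X = 0"
proof -
  have "X \<bullet> X = 0"
    unfolding inner_eq_sum_herm_coord[OF assms(1,1)] by (rule sum.neutral) (simp add: assms(2))
  then show ?thesis by (simp only: inner_eq_zero_iff)
qed

definition offdiag_unit :: "nat \<Rightarrow> 'f::star_division_algebra^'n^'n" where
  "offdiag_unit k =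
    (let T = TYPE('f^'n^'n); a = orow T k; b = ocol T k; u = ounit T k in
     (1 / sqrt 2) *\<^sub>R (\<chi> i j. if i = a \<and> j = b then u else if i = b \<and> j = a then star u else 0))"

lemma hermitian_offdiag_unit:
  assumes "k < orbit_dim TYPE('f^'n^'n)"
  shows "hermitian (offdiag_unit k :: 'f::star_division_algebra^'n^'n)"
proof -
  have "orow TYPE('f^'n^'n) k \<noteq> ocol TYPE('f^'n^'n) k"
    using oidx_less(1)[OF assms] by (metis less_irrefl)
  then have "(offdiag_unit k :: 'f^'n^'n) $ i $ j = star ((offdiag_unit k :: 'f^'n^'n) $ j $ i)" for i j
    unfolding offdiag_unit_def Let_def vector_scaleR_component vec_lambda_beta star_scaleR by simp
  then show ?thesis unfolding hermitian_def vec_eq_iff adjoint_matrix_nth by blast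
qed

lemma offdiag_unit_diag:
  assumes "k < orbit_dim TYPE('f^'n^'n)"
  shows "(offdiag_unit k :: 'f::star_division_algebra^'n^'n) $ i $ i = 0"
  using oidx_less(1)[OF assms] by (auto simp: offdiag_unit_def Let_def)

lemma herm_coord_offdiag_unit:
  assumes "j < orbit_dim TYPE('f^'n^'n)" "k < orbit_dim TYPE('f^'n^'n)"
  shows "herm_coord j (offdiag_unit k :: 'f::star_division_algebra^'n^'n) = (if j = k then 1 else 0)"
proof -
  let ?T = "TYPE('f^'n^'n)"
  show ?thesis
  proof (cases "orow ?T j = orow ?T k \<and> ocol ?T j = ocol ?T k")
    case True
    then have "herm_coord j (offdiag_unit k :: 'f^'n^'n) = ounit ?T k \<bullet> ounit ?T j"
      using assms by (simp add: herm_coord_offdiag offdiag_unit_def Let_def)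
    also have "\<dots> = (if j = k then 1 else 0)"
      using oidx_less(2)[OF assms(1)] oidx_less(2)[OF assms(2)] oidx_inj[OF assms] True
      by (auto simp: inner_Basis)
    finally show ?thesis .
  next
    case False
    have "\<not> (orow ?T j = ocol ?T k \<and> ocol ?T j = orow ?T k)"
      using oidx_less(1)[OF assms(1)] oidx_less(1)[OF assms(2)] by auto
    then show ?thesis using assms False by (auto simp: herm_coord_offdiag offdiag_unit_def Let_def)
  qed
qed

lemma herm_coord_diagmat:
  assumes "k < orbit_dim TYPE('f^'n^'n)"
  shows "herm_coord k (diagmat v :: 'f::star_division_algebra^'n^'n) = 0"
  using oidx_less(1)[OF assms] assms by (auto simp: herm_coord_offdiag diagmat_nth)

definition offdiag_of :: "(nat \<Rightarrow> real) \<Rightarrow> 'f::star_division_algebra^'n^'n" where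
  "offdiag_of x = (\<Sum>k<orbit_dim TYPE('f^'n^'n). x k *\<^sub>R offdiag_unit k)"

lemma hermitian_offdiag_of: "hermitian (offdiag_of x :: 'f::star_division_algebra^'n^'n)"
proof -
  have "(offdiag_of x :: 'f^'n^'n) \<in> {A. hermitian A}"
    unfolding offdiag_of_def by (intro subspace_sum subspace_scale subspace_hermitian)
      (simp add: hermitian_offdiag_unit)
  then show ?thesis by simp
qed

lemma offdiag_of_diag: "offdiag_of x $ i $ i = 0" by (simp add: offdiag_of_def offdiag_unit_diag)

lemma herm_coord_offdiag_of:
  assumes "k < orbit_dim TYPE('f^'n^'n)"
  shows "herm_coord k (offdiag_of x :: 'f::star_division_algebra^'n^'n) = x k"
proof -
  let ?d = "orbit_dim TYPE('f^'n^'n)"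
  have "herm_coord k (offdiag_of x :: 'f^'n^'n)
      = (\<Sum>j<?d. x j * herm_coord k (offdiag_unit j :: 'f^'n^'n))"
    unfolding offdiag_of_def linear_sum[OF linear_herm_coord]
    by (simp add: linear_cmul[OF linear_herm_coord])
  also have "\<dots> = (\<Sum>j<?d. if j = k then x j else 0)"
    by (intro sum.cong refl) (use assms in \<open>auto simp: herm_coord_offdiag_unit\<close>)
  finally show ?thesis using assms by simp
qed

lemma offdiag_of_herm_coord:
  fixes X :: "'f::star_division_algebra^'n^'n"
  assumes "hermitian X" "\<And>i. X $ i $ i = 0"
  shows "offdiag_of (\<lambda>k. herm_coord k X) = X"
proof -
  have "offdiag_of (\<lambda>k. herm_coord k X) - X = 0"
  proof (rule hermitian_eq_0I)
    show "hermitian (offdiag_of (\<lambda>k. herm_coord k X) - X)"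
      using subspace_diff[OF subspace_hermitian, of "offdiag_of (\<lambda>k. herm_coord k X)" X] assms(1)
      by (simp add: hermitian_offdiag_of)
    fix k assume k: "k < orbit_dim TYPE('f^'n^'n) + CARD('n)"
    show "herm_coord k (offdiag_of (\<lambda>k. herm_coord k X) - X) = 0"
    proof (cases "k < orbit_dim TYPE('f^'n^'n)")
      case True
      then show ?thesis by (simp add: linear_diff[OF linear_herm_coord] herm_coord_offdiag_of)
    next
      case False
      then show ?thesis using assms(2) by (simp add: herm_coord_def Let_def offdiag_of_diag)
    qed
  qed
  then show ?thesis by simp
qed

lemma offdiag_of_cong:
  assumes "\<And>k. k < orbit_dim TYPE('f^'n^'n) \<Longrightarrow> x k = y k"
  shows "(offdiag_of x :: 'f::star_division_algebra^'n^'n) = offdiag_of y"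
  unfolding offdiag_of_def by (intro sum.cong) (simp_all add: assms)

section \<open>Orbits as zero sets\<close>

definition eigs :: "('n::finite \<Rightarrow> real) \<Rightarrow> real list" where
  "eigs v = sorted_list_of_set (range v)"

lemma eigs [simp]: "set (eigs v) = range v" "distinct (eigs v)" by (simp_all add: eigs_def)

lemma lin_prod_eigs_diagmat: "lin_prod (eigs v) (diagmat v) = 0"
proof -
  have "(\<Prod>r\<leftarrow>eigs v. v i - r) = 0" for i by (force simp: prod_list_zero_iff)
  then show ?thesis by (simp add: lin_prod_diagmat vec_eq_iff diagmat_nth)
qed

lemma orbitE:
  assumes "X \<in> unitary_orbit S"
  obtains U where "U \<in> unitary_group" "X = conj_by U S" using assms by (auto simp: unitary_orbit_eq)

lemma orbitI: "U \<in> unitary_group \<Longrightarrow> conj_by U S \<in> unitary_orbit S" by (auto simp: unitary_orbit_eq)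

lemma hermitian_orbit: "X \<in> unitary_orbit (diagmat v) \<Longrightarrow> hermitian X"
  by (elim orbitE) (simp add: hermitian_conj_by hermitian_diagmat)

lemma lin_prod_eigs_orbit: "X \<in> unitary_orbit (diagmat v) \<Longrightarrow> lin_prod (eigs v) X = 0"
  by (elim orbitE) (simp add: lin_prod_conj_by lin_prod_eigs_diagmat linear_0[OF linear_conj_by])

text \<open>The spectral projection for the eigenvalue \<open>v a\<close>, by Lagrange interpolation.\<close>

definition spectral_proj :: "('n::finite \<Rightarrow> real) \<Rightarrow> 'n \<Rightarrow> 'f::star_division_algebra^'n^'n \<Rightarrow> 'f^'n^'n" where
  "spectral_proj v a X =
    (1 / (\<Prod>r\<leftarrow>remove1 (v a) (eigs v). v a - r)) *\<^sub>R lin_prod (remove1 (v a) (eigs v)) X"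

lemma spectral_proj_diagmat:
  assumes "inj v"
  shows "spectral_proj v a (diagmat v) = diagmat (\<lambda>i. if i = a then 1 else 0)"
proof -
  let ?c = "\<lambda>i. \<Prod>r\<leftarrow>remove1 (v a) (eigs v). v i - r"
  have "?c a \<noteq> 0" by (auto simp: prod_list_zero_iff)
  moreover have "?c i = 0" if "i \<noteq> a" for i
    using that assms by (auto simp: prod_list_zero_iff inj_eq)
  ultimately have "1 / ?c a * ?c i = (if i = a then 1 else 0)" for i by auto
  then show ?thesis unfolding spectral_proj_def lin_prod_diagmat diagmat_scaleR[symmetric] by simp
qed

lemma spectral_proj_conj_by:
  "U \<in> unitary_group \<Longrightarrow> spectral_proj v a (conj_by U X) = conj_by U (spectral_proj v a X)"
  by (simp add: spectral_proj_def lin_prod_conj_by linear_cmul[OF linear_conj_by])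

lemma continuous_on_spectral_proj [continuous_intros]:
  "continuous_on S f \<Longrightarrow> continuous_on S (\<lambda>x. spectral_proj v a (f x))"
  unfolding spectral_proj_def by (intro continuous_intros)

lemma eigenvalue_spectral_proj:
  assumes "lin_prod (eigs v) X = 0"
  shows "X ** spectral_proj v a X = v a *\<^sub>R spectral_proj v a X"
proof -
  have "(X - v a *\<^sub>R mat 1) ** lin_prod (remove1 (v a) (eigs v)) X = 0"
    using lin_prod_remove1[of "v a" "eigs v" X] assms by simp
  then show ?thesis by (simp add: spectral_proj_def matrix_mult_simps scaleR_left_commute)
qed

text \<open>
  If all spectral projections of \<open>X\<close> are nonzero, their columns provide an eigenvector for each of the
  \<open>n\<close> prescribed eigenvalues.
\<close>

lemma orbit_diagmatI:
  fixes X :: "'f::star_division_algebra^'n^'n"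
  assumes "hermitian X" "inj v" "lin_prod (eigs v) X = 0" and nz: "\<And>a. spectral_proj v a X \<noteq> 0"
  shows "X \<in> unitary_orbit (diagmat v)"
proof -
  have "\<exists>w. w \<noteq> 0 \<and> X *v w = v a *\<^sub>R w" for a
  proof -
    let ?P = "spectral_proj v a X"
    obtain i j where ij: "?P $ i $ j \<noteq> 0" using nz[of a] by (auto simp: vec_eq_iff)
    define w where "w = (\<chi> k. ?P $ k $ j)"
    have "w $ i \<noteq> 0" using ij by (simp add: w_def)
    then have "w \<noteq> 0" by (metis zero_index)
    moreover
    have "(X *v w) $ k = (v a *\<^sub>R w) $ k" for k
    proof -
      have "(X *v w) $ k = (X ** ?P) $ k $ j"
        by (simp add: matrix_vector_mult_def matrix_matrix_mult_def w_def)
      then show ?thesis by (simp add: eigenvalue_spectral_proj[OF assms(3)] w_def)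
    qed
    then have "X *v w = v a *\<^sub>R w" unfolding vec_eq_iff by blast
    ultimately show ?thesis by blast
  qed
  then obtain U where "U \<in> unitary_group" "X = conj_by U (diagmat v)"
    using hermitian_diagonalization[OF assms(1,2)] by blast
  then show ?thesis by (simp add: orbitI)
qed

lemma norm_vec_le_sum: "norm x \<le> (\<Sum>i\<in>UNIV. norm (x $ i))"
  unfolding norm_vec_def by (rule L2_set_le_sum) simp

text \<open>
  Near the diagonal matrix \<open>D\<close> the orbit is cut out by the diagonal entries of \<open>Q = p(X)\<close> alone, \<open>p\<close>
  the polynomial with roots \<open>v\<close>. As \<open>Q\<close> commutes with \<open>X\<close>, the norm of \<open>Q D - D Q\<close> is small compared
  with that of \<open>Q\<close>. The entries of this commutator are those of \<open>Q\<close> times differences of eigenvalues,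
  so if the diagonal of \<open>Q\<close> is zero, then all of \<open>Q\<close> is small compared with itself, that is, \<open>Q = 0\<close>.
\<close>

lemma orbit_near_diagmat:
  fixes v :: "'n::finite \<Rightarrow> real"
  assumes inj: "inj v"
  obtains e where "e > 0" "\<And>X :: 'f::star_division_algebra^'n^'n.
    hermitian X \<Longrightarrow> dist X (diagmat v) < e \<Longrightarrow> (\<And>i. lin_prod (eigs v) X $ i $ i = 0) \<Longrightarrow>
    X \<in> unitary_orbit (diagmat v)"
proof -
  let ?D = "diagmat v :: 'f^'n^'n"
  have "\<exists>K>0. \<forall>(A :: 'f^'n^'n) B :: 'f^'n^'n. norm (A ** B) \<le> norm A * norm B * K"
    by (rule bounded_bilinear.pos_bounded[OF bounded_bilinear_matrix_mult])
  then obtain K where K: "K > 0" "\<And>(A :: 'f^'n^'n) B :: 'f^'n^'n. norm (A ** B) \<le> norm A * norm B * K"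
    by blast
  have "\<exists>g>0. \<forall>a b. a \<noteq> b \<longrightarrow> g \<le> \<bar>v a - v b\<bar>"
  proof (intro exI conjI allI impI)
    let ?G = "insert 1 ((\<lambda>(a, b). \<bar>v a - v b\<bar>) ` {(a, b). a \<noteq> b})"
    show "0 < Min ?G" by (subst Min_gr_iff) (use inj in \<open>auto simp: inj_eq\<close>)
    show "Min ?G \<le> \<bar>v a - v b\<bar>" if "a \<noteq> b" for a b
      by (rule Min_le) (use that in \<open>auto intro!: image_eqI[of _ _ "(a, b)"]\<close>)
  qed
  then obtain g where g: "g > 0" "\<And>a b. a \<noteq> b \<Longrightarrow> g \<le> \<bar>v a - v b\<bar>" by blast
  define m where "m = real CARD('n)"
  have m: "m > 0" by (simp add: m_def)
  define e1 where "e1 = g / (2 * m * m * (2 * K))"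
  have e1: "e1 > 0" using g K m by (simp add: e1_def)
  have Q0: "lin_prod (eigs v) X = 0"
    if X: "dist X ?D < e1" and diag: "\<And>i. lin_prod (eigs v) X $ i $ i = 0" for X
  proof (rule ccontr)
    define Q where "Q = lin_prod (eigs v) X"
    assume "lin_prod (eigs v) X \<noteq> 0"
    then have nQ: "norm Q > 0" by (simp add: Q_def)
    have "Q ** ?D - ?D ** Q = (X - ?D) ** Q - Q ** (X - ?D)"
      using lin_prod_commute[of X "eigs v"] by (simp add: matrix_mult_simps Q_def)
    then have "norm (Q ** ?D - ?D ** Q) \<le> norm ((X - ?D) ** Q) + norm (Q ** (X - ?D))"
      using norm_triangle_ineq4 by metis
    also have "\<dots> \<le> 2 * K * norm (X - ?D) * norm Q"
      using K(2)[of "X - ?D" Q] K(2)[of Q "X - ?D"] by (simp add: algebra_simps)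
    finally have comm: "norm (Q ** ?D - ?D ** Q) \<le> 2 * K * norm (X - ?D) * norm Q" .
    have entry: "norm (Q $ a $ b) \<le> 2 * K * norm (X - ?D) * norm Q / g" for a b
    proof (cases "a = b")
      case True
      then show ?thesis using diag[of a] K g by (simp add: Q_def)
    next
      case False
      have "g * norm (Q $ a $ b) \<le> \<bar>v b - v a\<bar> * norm (Q $ a $ b)"
        using g(2)[of b a] False by (intro mult_right_mono) auto
      also have "\<dots> = norm ((Q ** ?D - ?D ** Q) $ a $ b)"
        by (simp add: mult_diagmat_nth diagmat_mult_nth flip: scaleR_diff_left)
      also have "\<dots> \<le> norm (Q ** ?D - ?D ** Q)"
        by (rule order_trans[OF Finite_Cartesian_Product.norm_nth_le Finite_Cartesian_Product.norm_nth_le])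
      finally show ?thesis using comm g(1) by (simp add: field_simps)
    qed
    have "norm Q \<le> (\<Sum>a\<in>UNIV. \<Sum>b\<in>UNIV. norm (Q $ a $ b))"
      by (intro order_trans[OF norm_vec_le_sum] sum_mono norm_vec_le_sum)
    also have "\<dots> \<le> (\<Sum>a\<in>(UNIV :: 'n set). \<Sum>b\<in>(UNIV :: 'n set). 2 * K * norm (X - ?D) * norm Q / g)"
      by (intro sum_mono entry)
    also have "\<dots> = (2 * K * m * m / g * norm (X - ?D)) * norm Q" by (simp add: m_def)
    also have "\<dots> \<le> (1 / 2) * norm Q"
    proof (intro mult_right_mono)
      have "2 * K * m * m / g * norm (X - ?D) \<le> 2 * K * m * m / g * e1"
        using X K m g by (intro mult_left_mono) (auto simp: dist_norm)
      also have "\<dots> = 1 / 2" using K m g by (simp add: e1_def)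
      finally show "2 * K * m * m / g * norm (X - ?D) \<le> 1 / 2" .
    qed simp
    finally show False using nQ by simp
  qed
  have "open (\<Inter>a. spectral_proj v a -` (- {0 :: 'f^'n^'n}))"
    by (intro open_INT finite ballI open_vimage continuous_intros)
  moreover have "?D \<in> (\<Inter>a. spectral_proj v a -` (- {0 :: 'f^'n^'n}))"
  proof -
    have "spectral_proj v a ?D $ a $ a \<noteq> 0" for a
      by (simp add: spectral_proj_diagmat[OF inj] diagmat_nth)
    then have "spectral_proj v a ?D \<noteq> 0" for a by (metis zero_index)
    then show ?thesis unfolding INT_iff vimage_eq Compl_iff singleton_iff by blast
  qed
  ultimately obtain e2 where e2: "e2 > 0" "ball ?D e2 \<subseteq> (\<Inter>a. spectral_proj v a -` (- {0}))"
    by (rule openE)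
  show thesis
  proof
    show "min e1 e2 > 0" using e1 e2 by simp
    fix X :: "'f^'n^'n"
    assume X: "hermitian X" "dist X ?D < min e1 e2" "\<And>i. lin_prod (eigs v) X $ i $ i = 0"
    have "X \<in> ball ?D e2" using X(2) by (simp add: dist_commute)
    then have nz: "spectral_proj v a X \<noteq> 0" for a using e2(2) by blast
    have "lin_prod (eigs v) X = 0" using X(2) by (intro Q0 X(3)) simp
    then show "X \<in> unitary_orbit ?D" by (intro orbit_diagmatI[OF X(1) inj] nz)
  qed
qed

section \<open>Charts of an orbit\<close>

text \<open>
  This map straightens the orbit: near \<open>diagmat v\<close>, a hermitian matrix lies on the
  orbit iff its image has zero diagonal.
\<close>

definition straighten :: "('n::finite \<Rightarrow> real) \<Rightarrow> 'f::star_division_algebra^'n^'n \<Rightarrow> 'f^'n^'n" where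
  "straighten v X = (\<chi> i j. if i = j then lin_prod (eigs v) X $ i $ j else X $ i $ j)"

definition dstraighten ::
    "('n::finite \<Rightarrow> real) \<Rightarrow> 'f::star_division_algebra^'n^'n \<Rightarrow> 'f^'n^'n \<Rightarrow> 'f^'n^'n" where
  "dstraighten v X H = (\<chi> i j. if i = j then dlin_prod (eigs v) X H $ i $ j else H $ i $ j)"

lemma has_derivative_straighten: "(straighten v has_derivative dstraighten v X) (at X)"
proof -
  define P where "P Y = (\<chi> i j. if i = j then Y $ i $ j else 0)" for Y :: "'a^'b^'b"
  define Q where "Q Y = (\<chi> i j. if i = j then 0 else Y $ i $ j)" for Y :: "'a^'b^'b"
  have "linear P" "linear Q" by (intro linearI; simp add: P_def Q_def vec_eq_iff)+
  then have bl: "bounded_linear P" "bounded_linear Q" by (simp_all add: linear_conv_bounded_linear)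
  have "((\<lambda>X. P (lin_prod (eigs v) X) + Q X) has_derivative
      (\<lambda>H. P (dlin_prod (eigs v) X H) + Q H)) (at X)"
    by (intro has_derivative_add bounded_linear.has_derivative[OF bl(1)]
        bounded_linear.has_derivative[OF bl(2)] has_derivative_lin_prod has_derivative_ident)
  moreover have "(\<lambda>X. P (lin_prod (eigs v) X) + Q X) = straighten v"
    "(\<lambda>H. P (dlin_prod (eigs v) X H) + Q H) = dstraighten v X"
    by (auto simp: fun_eq_iff vec_eq_iff P_def Q_def straighten_def dstraighten_def)
  ultimately show ?thesis by simp
qed

lemma bounded_linear_dstraighten: "bounded_linear (dstraighten v X)"
  by (rule has_derivative_bounded_linear[OF has_derivative_straighten])

lemma continuous_on_dstraighten: "continuous_on UNIV (\<lambda>X. dstraighten v X H)"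
  unfolding dstraighten_def
proof (intro continuous_on_vec_lambda)
  fix i j
  have "continuous_on UNIV (\<lambda>X. dlin_prod (eigs v) X H $ i $ j)"
    by (intro continuous_on_component continuous_on_dlin_prod)
  then show "continuous_on UNIV (\<lambda>X. if i = j then dlin_prod (eigs v) X H $ i $ j else H $ i $ j)"
    by (cases "i = j") simp_all
qed

lemma straighten_adjoint: "straighten v (adjoint_matrix X) = adjoint_matrix (straighten v X)"
proof -
  have "lin_prod (eigs v) (adjoint_matrix X) $ i $ i = star (lin_prod (eigs v) X $ i $ i)" for i
    by (simp add: lin_prod_adjoint[symmetric])
  then show ?thesis by (simp add: vec_eq_iff straighten_def)
qed

lemma straighten_on_orbit:
  fixes X :: "'f::star_division_algebra^'n^'n"
  assumes "X \<in> unitary_orbit (diagmat v)"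
  shows "straighten v X = offdiag_of (\<lambda>k. herm_coord k X)"
proof -
  let ?G = "straighten v X"
  have herm: "hermitian X" using assms by (rule hermitian_orbit)
  have "hermitian ?G" using herm straighten_adjoint[of v X] unfolding hermitian_def by simp
  moreover have "?G $ i $ i = 0" for i by (simp add: straighten_def lin_prod_eigs_orbit[OF assms])
  ultimately have "offdiag_of (\<lambda>k. herm_coord k ?G) = ?G" by (rule offdiag_of_herm_coord)
  moreover have "herm_coord k ?G = herm_coord k X" if "k < orbit_dim TYPE('f^'n^'n)" for k
  proof -
    have "orow TYPE('f^'n^'n) k \<noteq> ocol TYPE('f^'n^'n) k"
      using oidx_less(1)[OF that] by (metis less_irrefl)
    then show ?thesis using that by (simp add: herm_coord_offdiag straighten_def)
  qed
  then have "(offdiag_of (\<lambda>k. herm_coord k ?G) :: 'f^'n^'n) = offdiag_of (\<lambda>k. herm_coord k X)"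
    by (rule offdiag_of_cong)
  ultimately show ?thesis by metis
qed

text \<open>
  If \<open>F x\<close> stretches all vectors at least by \<open>B\<close>, then so does \<open>F y\<close> by \<open>B / 2\<close> for \<open>y\<close> near \<open>x\<close>.
  This keeps the solution \<open>w y\<close> of \<open>F y (w y) = e\<close> bounded and makes its distance to \<open>w x\<close> at most
  a multiple of the distance between \<open>F y\<close> and \<open>F x\<close>.
\<close>

lemma continuous_on_inv_blinfun:
  fixes F :: "'a::metric_space \<Rightarrow> 'e::euclidean_space \<Rightarrow>\<^sub>L 'e"
  assumes cont: "continuous_on S F" and bij: "\<And>x. x \<in> S \<Longrightarrow> bij (blinfun_apply (F x))"
  shows "continuous_on S (\<lambda>x. inv (blinfun_apply (F x)) e)"
  unfolding continuous_on_def
proof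
  fix x assume x: "x \<in> S"
  define w where "w y = inv (blinfun_apply (F y)) e" for y
  have Fw: "F y (w y) = e" if "y \<in> S" for y
    unfolding w_def using bij[OF that] by (rule bij_inv_eq_iff[THEN iffD1, OF _ refl])
  obtain B where B: "B > 0" "\<And>u. B * norm u \<le> norm (F x u)"
    using linear_inj_bounded_below_pos[of "blinfun_apply (F x)"] bij[OF x]
    by (metis bij_is_inj blinfun.bounded_linear_right bounded_linear.linear)
  have lim: "((\<lambda>y. norm (F y - F x)) \<longlongrightarrow> 0) (at x within S)"
    using cont x by (simp add: continuous_on_def tendsto_norm_zero LIM_zero)
  have "\<forall>\<^sub>F y in at x within S. norm (F y - F x) < B / 2"
    using order_tendstoD(2)[OF lim, of "B / 2"] B(1) by simp
  moreover have in_S: "\<forall>\<^sub>F y in at x within S. y \<in> S" by (simp add: eventually_at_filter)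
  ultimately have "\<forall>\<^sub>F y in at x within S. norm (w y - w x) \<le> (2 * norm (w x) / B) * norm (F y - F x)"
  proof eventually_elim
    fix y assume y: "norm (F y - F x) < B / 2" "y \<in> S"
    have "B * norm (w y - w x) \<le> norm (F x (w y) - F x (w x))"
      using B(2)[of "w y - w x"] by (simp add: blinfun.diff_right)
    also have "F x (w y) - F x (w x) = - ((F y - F x) (w y))"
      by (simp add: Fw x y blinfun.diff_left)
    also have "norm (- ((F y - F x) (w y))) \<le> norm (F y - F x) * norm (w y)"
      by (simp only: norm_minus_cancel norm_blinfun)
    finally have *: "B * norm (w y - w x) \<le> norm (F y - F x) * norm (w y)" .
    also have "\<dots> \<le> B / 2 * norm (w y)" using y by (intro mult_right_mono) auto
    finally have "norm (w y - w x) \<le> norm (w y) / 2" using B(1) by (simp add: field_simps)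
    then have "norm (w y) \<le> 2 * norm (w x)" using norm_triangle_ineq2[of "w y" "w x"] by linarith
    then have "norm (F y - F x) * norm (w y) \<le> norm (F y - F x) * (2 * norm (w x))"
      by (intro mult_left_mono) auto
    with * show "norm (w y - w x) \<le> (2 * norm (w x) / B) * norm (F y - F x)"
      using B(1) by (simp add: field_simps)
  qed
  moreover have "((\<lambda>y. (2 * norm (w x) / B) * norm (F y - F x)) \<longlongrightarrow> 0) (at x within S)"
    by (rule tendsto_mult_right_zero[OF lim])
  ultimately have "((\<lambda>y. w y - w x) \<longlongrightarrow> 0) (at x within S)" by (rule Lim_null_comparison)
  then show "((\<lambda>y. inv (blinfun_apply (F y)) e) \<longlongrightarrow> inv (blinfun_apply (F x)) e) (at x within S)"
    unfolding w_def[symmetric] by (rule LIM_zero_cancel)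
qed

lemma continuous_map_offdiag_of:
  "continuous_map (coord_space (orbit_dim TYPE('f^'n^'n))) euclidean
    (offdiag_of :: _ \<Rightarrow> 'f::star_division_algebra^'n^'n)"
  unfolding offdiag_of_def coord_space_def
proof (rule continuous_map_sum)
  fix k assume "k \<in> {..<orbit_dim TYPE('f^'n^'n)}"
  then have "continuous_map (product_topology (\<lambda>_. euclideanreal) {..<orbit_dim TYPE('f^'n^'n)})
      euclideanreal (\<lambda>x. x k)" by (rule continuous_map_product_projection)
  moreover have "continuous_map euclideanreal euclidean (\<lambda>r. r *\<^sub>R (offdiag_unit k :: 'f^'n^'n))"
    by (simp only: continuous_map_iff_continuous2) (intro continuous_intros)
  ultimately show "continuous_map (product_topology (\<lambda>_. euclideanreal) {..<orbit_dim TYPE('f^'n^'n)})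
      euclidean (\<lambda>x. x k *\<^sub>R (offdiag_unit k :: 'f^'n^'n))"
    using continuous_map_compose[unfolded o_def] by blast
qed simp

lemma offdiag_of_update:
  assumes "i < orbit_dim TYPE('f^'n^'n)"
  shows "(offdiag_of (x(i := t)) :: 'f::star_division_algebra^'n^'n)
    = offdiag_of x + (t - x i) *\<^sub>R offdiag_unit i"
proof -
  have "(offdiag_of (x(i := t)) :: 'f^'n^'n) - offdiag_of x =
      (\<Sum>k<orbit_dim TYPE('f^'n^'n). ((x(i := t)) k - x k) *\<^sub>R offdiag_unit k)"
    unfolding offdiag_of_def sum_subtractf[symmetric] scaleR_diff_left ..
  also have "\<dots> = (\<Sum>k<orbit_dim TYPE('f^'n^'n). if k = i then (t - x i) *\<^sub>R offdiag_unit i else 0)"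
    by (rule sum.cong) simp_all
  also have "\<dots> = (t - x i) *\<^sub>R offdiag_unit i" using assms by simp
  finally show ?thesis by (simp add: algebra_simps)
qed

text \<open>
  At \<open>diagmat v\<close> the derivative of \<open>straighten v\<close> keeps the off-diagonal entries and multiplies the
  diagonal ones by nonzero numbers, so there is a local inverse \<open>g\<close>, whose restriction to the
  off-diagonal hermitian matrices is a chart. Its inverse takes the off-diagonal coordinates of a
  matrix. Conjugation carries this chart to all points of the orbit.
\<close>

lemma embedded_submanifold_orbit:
  fixes v :: "'n::finite \<Rightarrow> real"
  assumes inj: "inj v"
  defines "d \<equiv> orbit_dim TYPE('f::star_division_algebra^'n^'n)"
    and "M \<equiv> unitary_orbit (diagmat v :: 'f^'n^'n)"
  shows "embedded_submanifold d M"
  unfolding embedded_submanifold_def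
proof
  fix p assume "p \<in> M"
  then obtain R where R: "R \<in> unitary_group" "p = conj_by R (diagmat v)"
    unfolding M_def by (rule orbitE)
  let ?D = "diagmat v :: 'f^'n^'n" and ?G = "straighten v :: 'f^'n^'n \<Rightarrow> _"
  define F where "F X = Blinfun (dstraighten v (X :: 'f^'n^'n))" for X
  have F: "blinfun_apply (F X) = dstraighten v X" for X
    unfolding F_def by (rule bounded_linear_Blinfun_apply[OF bounded_linear_dstraighten])
  define L where "L H = (\<chi> i j. if i = j then (1 / dprod (eigs v) (v i)) *\<^sub>R H $ i $ j else H $ i $ j)"
    for H :: "'f^'n^'n"
  have "linear L" by (intro linearI) (simp_all add: L_def vec_eq_iff scaleR_add_right)
  then have bl: "bounded_linear L" by (simp add: linear_conv_bounded_linear)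
  have LD: "L (dstraighten v ?D H) = H" for H
  proof -
    have "dprod (eigs v) (v i) \<noteq> 0" for i by (rule dprod_nonzero) simp_all
    then show ?thesis by (simp add: vec_eq_iff L_def dstraighten_def dlin_prod_diagmat_diagonal)
  qed
  have contF: "continuous_on UNIV F"
    by (rule continuous_on_blinfun_componentwise) (simp add: F continuous_on_dstraighten)
  obtain U' V g g' where U': "open U'" "?D \<in> U'" and V: "open V" "?G ?D \<in> V"
    and hom: "homeomorphism U' V ?G g"
    and dg: "\<And>y. y \<in> V \<Longrightarrow> (g has_derivative (g' y)) (at y)"
    and g': "\<And>y. y \<in> V \<Longrightarrow> g' y = inv (blinfun_apply (F (g y)))"
    and bij: "\<And>y. y \<in> V \<Longrightarrow> bij (blinfun_apply (F (g y)))"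
  proof (rule inverse_function_theorem[of UNIV ?G F ?D "Blinfun L"])
    show "(?G has_derivative blinfun_apply (F X)) (at X)" for X
      unfolding F by (rule has_derivative_straighten)
    show "Blinfun L o\<^sub>L F ?D = id_blinfun"
      by (rule blinfun_eqI) (simp add: bounded_linear_Blinfun_apply[OF bl] F LD)
  qed (use contF in simp_all)
  note Gg = homeomorphism_apply2[OF hom] and gG = homeomorphism_apply1[OF hom]
  obtain e where e: "e > 0" "\<And>X :: 'f^'n^'n. hermitian X \<Longrightarrow> dist X ?D < e \<Longrightarrow>
      (\<And>i. lin_prod (eigs v) X $ i $ i = 0) \<Longrightarrow> X \<in> M"
    using orbit_near_diagmat[OF inj, where 'f='f] unfolding M_def by blast
  \<comment> \<open>For \<open>X\<close> in \<open>W\<close> both \<open>X\<close> and its adjoint lie in \<open>U'\<close>, where \<open>straighten v\<close> is injective; this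
    makes \<open>X\<close> hermitian as soon as its image is.\<close>
  define W where "W = U' \<inter> adjoint_matrix -` U' \<inter> ball ?D e"
  have "open W"
    unfolding W_def by (intro open_Int U'(1) open_vimage open_ball continuous_intros)
  have contg: "continuous_on V g" using hom by (simp add: homeomorphism_def)
  define V' where "V' = V \<inter> g -` W"
  have "open V'" unfolding V'_def by (rule continuous_open_preimage[OF contg V(1) \<open>open W\<close>])
  define U where "U = {x \<in> topspace (coord_space d). (offdiag_of x :: 'f^'n^'n) \<in> V'}"
  define \<psi> where "\<psi> x = g (offdiag_of x)" for x
  define \<kappa> where "\<kappa> X = (\<lambda>k\<in>{..<d}. herm_coord k (X :: 'f^'n^'n))" for X
  have openU: "openin (coord_space d) U"
    unfolding U_def d_def
    by (rule openin_continuous_map_preimage[OF continuous_map_offdiag_of]) (simp add: \<open>open V'\<close>)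
  have UD: "x \<in> extensional {..<d}" "offdiag_of x \<in> V" "\<psi> x \<in> W" if "x \<in> U" for x
    using that by (auto simp: U_def V'_def \<psi>_def coord_space_def PiE_def)
  have G\<psi>: "?G (\<psi> x) = offdiag_of x" if "x \<in> U" for x
    unfolding \<psi>_def by (rule Gg) (rule UD(2)[OF that])
  have \<psi>M: "\<psi> x \<in> M" if x: "x \<in> U" for x
  proof (rule e(2))
    have "?G (adjoint_matrix (\<psi> x)) = ?G (\<psi> x)"
      using hermitian_offdiag_of[of x] unfolding hermitian_def
      by (metis straighten_adjoint G\<psi>[OF x])
    moreover have "\<psi> x \<in> U'" "adjoint_matrix (\<psi> x) \<in> U'" using UD(3)[OF x] by (simp_all add: W_def)
    ultimately show "hermitian (\<psi> x)" unfolding hermitian_def using gG by metis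
    show "dist (\<psi> x) ?D < e" using UD(3)[OF x] by (simp add: W_def dist_commute)
    show "lin_prod (eigs v) (\<psi> x) $ i $ i = 0" for i
    proof -
      have "lin_prod (eigs v) (\<psi> x) $ i $ i = ?G (\<psi> x) $ i $ i" by (simp add: straighten_def)
      then show ?thesis by (simp add: G\<psi>[OF x] offdiag_of_diag)
    qed
  qed
  have \<kappa>\<psi>: "\<kappa> (\<psi> x) = x" if x: "x \<in> U" for x
  proof
    fix k
    show "\<kappa> (\<psi> x) k = x k"
    proof (cases "k < d")
      case True
      have "(offdiag_of (\<lambda>k. herm_coord k (\<psi> x)) :: 'f^'n^'n) = offdiag_of x"
        using straighten_on_orbit[of "\<psi> x" v] \<psi>M[OF x] G\<psi>[OF x] by (simp add: M_def)
      then have "herm_coord k (offdiag_of (\<lambda>k. herm_coord k (\<psi> x)) :: 'f^'n^'n)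
          = herm_coord k (offdiag_of x :: 'f^'n^'n)" by (rule arg_cong)
      then show ?thesis using True by (simp add: \<kappa>_def d_def herm_coord_offdiag_of)
    next
      case False
      then show ?thesis using extensional_arb[OF UD(1)[OF x], of k] by (simp add: \<kappa>_def)
    qed
  qed
  have off\<kappa>: "offdiag_of (\<kappa> X) = ?G X" if "X \<in> M" for X
  proof -
    have "offdiag_of (\<kappa> X) = (offdiag_of (\<lambda>k. herm_coord k X) :: 'f^'n^'n)"
      by (rule offdiag_of_cong) (simp add: \<kappa>_def d_def)
    then show ?thesis using straighten_on_orbit[of X v] that by (simp add: M_def)
  qed
  have \<kappa>U: "\<kappa> X \<in> U" "\<psi> (\<kappa> X) = X" if X: "X \<in> M" "X \<in> W" for X
  proof -
    have XU: "X \<in> U'" using X(2) by (simp add: W_def)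
    have GV: "?G X \<in> V" using homeomorphism_image1[OF hom] XU by blast
    show "\<psi> (\<kappa> X) = X" by (simp add: \<psi>_def off\<kappa>[OF X(1)] gG[OF XU])
    have "\<kappa> X \<in> topspace (coord_space d)" by (simp add: \<kappa>_def coord_space_def)
    then show "\<kappa> X \<in> U" using GV X(2) by (simp add: U_def V'_def off\<kappa>[OF X(1)] gG[OF XU])
  qed
  have im: "\<psi> ` U = M \<inter> W"
  proof
    show "\<psi> ` U \<subseteq> M \<inter> W" using \<psi>M UD(3) by blast
    show "M \<inter> W \<subseteq> \<psi> ` U" using \<kappa>U by (metis IntD1 IntD2 image_eqI subsetI)
  qed
  \<comment> \<open>The chart \<open>\<psi>\<close> at the diagonal matrix is moved to \<open>p\<close> by conjugation.\<close>
  let ?R = "adjoint_matrix R"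
  define \<phi> where "\<phi> x = conj_by R (\<psi> x)" for x
  have conjM: "conj_by Q X \<in> M" if "Q \<in> unitary_group" "X \<in> M" for Q X
    using that unfolding M_def by (elim orbitE) (simp add: conj_by_conj_by orbitI unitary_mult)
  have im\<phi>: "\<phi> ` U = M \<inter> conj_by ?R -` W"
  proof -
    have "\<phi> ` U = conj_by R ` (M \<inter> W)"
      unfolding \<phi>_def im[symmetric] image_image ..
    also have "\<dots> = M \<inter> conj_by ?R -` W"
    proof
      show "conj_by R ` (M \<inter> W) \<subseteq> M \<inter> conj_by ?R -` W" using R(1) conjM by auto
      show "M \<inter> conj_by ?R -` W \<subseteq> conj_by R ` (M \<inter> W)"
      proof
        fix X assume "X \<in> M \<inter> conj_by ?R -` W"
        then have "conj_by ?R X \<in> M \<inter> W" using conjM[OF unitary_adjoint[OF R(1)]] by auto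
        then show "X \<in> conj_by R ` (M \<inter> W)" by (rule rev_image_eqI) (simp add: R(1))
      qed
    qed
    finally show ?thesis .
  qed
  have cont_off: "continuous_map (subtopology (coord_space d) U) (top_of_set V)
      (offdiag_of :: _ \<Rightarrow> 'f^'n^'n)"
    unfolding continuous_map_in_subtopology
    using UD(2) continuous_map_from_subtopology[OF continuous_map_offdiag_of[where 'f='f and 'n='n], of U]
    by (auto simp: d_def)
  have cont_via_V: "continuous_map (subtopology (coord_space d) U) euclidean (\<lambda>x. h (offdiag_of x))"
    if "continuous_on V h" for h :: "'f^'n^'n \<Rightarrow> 'f^'n^'n"
  proof -
    have "continuous_map (top_of_set V) euclidean h" using that by simp
    from continuous_map_compose[OF cont_off this] show ?thesis by (simp only: o_def)
  qed
  have "homeomorphic_maps (subtopology (coord_space d) U) (top_of_set (\<phi> ` U)) \<phi> (\<lambda>X. \<kappa> (conj_by ?R X))"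
    unfolding homeomorphic_maps_def
  proof (intro conjI ballI)
    show "continuous_map (subtopology (coord_space d) U) (top_of_set (\<phi> ` U)) \<phi>"
      unfolding continuous_map_in_subtopology
      using cont_via_V[OF continuous_on_conj_by[OF contg]] by (auto simp: \<phi>_def[abs_def] \<psi>_def)
    have "continuous_on (\<phi> ` U) (\<lambda>X. herm_coord k (conj_by ?R X))" for k
      by (intro linear_continuous_on_compose[where g = "herm_coord k"] linear_herm_coord
          continuous_on_conj_by continuous_on_id)
    then have "continuous_map (top_of_set (\<phi> ` U)) (coord_space d) (\<lambda>X. \<kappa> (conj_by ?R X))"
      unfolding coord_space_def continuous_map_componentwise by (auto simp: \<kappa>_def extensional_def)
    then show "continuous_map (top_of_set (\<phi> ` U)) (subtopology (coord_space d) U) (\<lambda>X. \<kappa> (conj_by ?R X))"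
      unfolding continuous_map_in_subtopology using \<kappa>\<psi> R(1) by (auto simp: \<phi>_def)
    show "\<kappa> (conj_by ?R (\<phi> x)) = x" if "x \<in> topspace (subtopology (coord_space d) U)" for x
      using that R(1) \<kappa>\<psi>[of x] by (simp add: \<phi>_def)
    show "\<phi> (\<kappa> (conj_by ?R y)) = y" if "y \<in> topspace (top_of_set (\<phi> ` U))" for y
    proof -
      have "conj_by ?R y \<in> M" "conj_by ?R y \<in> W"
        using that im\<phi> conjM[OF unitary_adjoint[OF R(1)]] by auto
      then show ?thesis by (simp add: \<phi>_def \<kappa>U(2) R(1))
    qed
  qed
  then have hmap: "homeomorphic_map (subtopology (coord_space d) U) (top_of_set (\<phi> ` U)) \<phi>"
    unfolding homeomorphic_map_maps by blast
  have bl_R: "bounded_linear (conj_by R)"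
    using linear_conj_by by (simp add: linear_conv_bounded_linear)
  have deriv: "((\<lambda>t. \<phi> (x(i := t))) has_vector_derivative
      conj_by R (inv (blinfun_apply (F (\<psi> x))) (offdiag_unit i))) (at (x i))"
    if x: "x \<in> U" and i: "i < d" for x i
  proof -
    have "((\<lambda>t. offdiag_of x + (t - x i) *\<^sub>R offdiag_unit i :: 'f^'n^'n) has_derivative
        (\<lambda>h. h *\<^sub>R offdiag_unit i)) (at (x i))" by (auto intro!: derivative_eq_intros)
    moreover have "(g has_derivative g' (offdiag_of x)) (at (offdiag_of x + (x i - x i) *\<^sub>R offdiag_unit i))"
      using dg[OF UD(2)[OF x]] by simp
    ultimately have "(g \<circ> (\<lambda>t. offdiag_of x + (t - x i) *\<^sub>R offdiag_unit i) has_derivative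
        g' (offdiag_of x) \<circ> (\<lambda>h. h *\<^sub>R offdiag_unit i)) (at (x i))" by (rule diff_chain_at)
    moreover have "g \<circ> (\<lambda>t. offdiag_of x + (t - x i) *\<^sub>R offdiag_unit i) = (\<lambda>t. \<psi> (x(i := t)))"
      using i by (simp add: fun_eq_iff \<psi>_def offdiag_of_update d_def)
    moreover have "g' (offdiag_of x) (h *\<^sub>R offdiag_unit i) = h *\<^sub>R g' (offdiag_of x) (offdiag_unit i)" for h
      using has_derivative_linear[OF dg[OF UD(2)[OF x]]] by (rule linear_cmul)
    ultimately have "((\<lambda>t. \<psi> (x(i := t))) has_vector_derivative
        inv (blinfun_apply (F (\<psi> x))) (offdiag_unit i)) (at (x i))"
      by (simp add: has_vector_derivative_def o_def g'[OF UD(2)[OF x]] \<psi>_def)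
    then show ?thesis unfolding \<phi>_def by (rule bounded_linear.has_vector_derivative[OF bl_R])
  qed
  have pd: "partial_deriv i \<phi> x = conj_by R (inv (blinfun_apply (F (\<psi> x))) (offdiag_unit i))"
    if "x \<in> U" "i < d" for x i
    unfolding partial_deriv_def by (rule vector_derivative_at[OF deriv[OF that]])
  have C1: "C1_on_coords d U \<phi>"
    unfolding C1_on_coords_def
  proof (intro allI impI conjI ballI)
    fix i assume i: "i < d"
    show "(\<lambda>t. \<phi> (x(i := t))) differentiable (at (x i))" if "x \<in> U" for x
      using deriv[OF that i] by (auto simp: has_vector_derivative_def differentiable_def)
    have "continuous_on V (\<lambda>y. F (g y))" using continuous_on_compose2[OF contF contg] by simp
    then have "continuous_on V (\<lambda>y. inv (blinfun_apply (F (g y))) (offdiag_unit i))"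
      by (rule continuous_on_inv_blinfun) (rule bij)
    from cont_via_V[OF continuous_on_conj_by[OF this]]
    show "continuous_map (subtopology (coord_space d) U) euclidean (partial_deriv i \<phi>)"
      by (rule continuous_map_eq) (use i in \<open>simp add: pd \<psi>_def\<close>)
  qed
  have indep: "\<forall>i<d. a i = 0" if x: "x \<in> U" and 0: "(\<Sum>i<d. a i *\<^sub>R partial_deriv i \<phi> x) = 0" for x a
  proof (intro allI impI)
    fix i assume i: "i < d"
    let ?e = "\<lambda>i. inv (blinfun_apply (F (\<psi> x))) (offdiag_unit i)"
    have b: "bij (blinfun_apply (F (\<psi> x)))" unfolding \<psi>_def by (rule bij[OF UD(2)[OF x]])
    have "conj_by R (\<Sum>i<d. a i *\<^sub>R ?e i) = 0"
      using 0 x by (simp add: pd linear_sum[OF linear_conj_by] linear_cmul[OF linear_conj_by])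
    then have "conj_by ?R (conj_by R (\<Sum>i<d. a i *\<^sub>R ?e i)) = 0"
      by (simp only: linear_0[OF linear_conj_by])
    then have "F (\<psi> x) (\<Sum>i<d. a i *\<^sub>R ?e i) = 0" by (simp add: R(1))
    moreover have "F (\<psi> x) (\<Sum>i<d. a i *\<^sub>R ?e i) = offdiag_of a"
      unfolding offdiag_of_def d_def using b
      by (simp add: blinfun.sum_right blinfun.scaleR_right surj_f_inv_f bij_is_surj)
    ultimately have "herm_coord i (offdiag_of a :: 'f^'n^'n) = 0"
      by (simp add: linear_0[OF linear_herm_coord])
    then show "a i = 0" using i by (simp add: herm_coord_offdiag_of d_def)
  qed
  have "open (conj_by ?R -` W)"
    by (intro open_vimage \<open>open W\<close> continuous_on_conj_by continuous_on_id)
  then have "local_parametrization d M U \<phi>"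
    unfolding local_parametrization_def using openU hmap C1 indep im\<phi> by (auto simp: openin_open)
  moreover have "?D \<in> W"
    using U'(2) e(1) hermitian_diagmat[of v, where 'a='f]
    by (simp add: W_def hermitian_def[symmetric]) (simp add: hermitian_def)
  then have "p \<in> \<phi> ` U" unfolding im\<phi> using \<open>p \<in> M\<close> by (simp add: R)
  ultimately show "\<exists>U \<phi>. local_parametrization d M U \<phi> \<and> p \<in> \<phi> ` U" by blast
qed

section \<open>Coordinate spaces\<close>

lemma space_coord_lebesgue: "space (coord_lebesgue d) = extensional {..<d}"
  by (simp add: coord_lebesgue_def space_PiM PiE_def)

lemma topspace_coord_space: "topspace (coord_space d) = extensional {..<d}"
  by (simp add: coord_space_def PiE_def)

lemma openin_coord_space_boxE:
  assumes "openin (coord_space d) S" "x \<in> S"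
  obtains V where "\<And>i. i < d \<Longrightarrow> open (V i)" "x \<in> Pi\<^sub>E {..<d} V" "Pi\<^sub>E {..<d} V \<subseteq> S"
proof -
  have "\<exists>V. finite {i \<in> {..<d}. V i \<noteq> topspace euclideanreal} \<and>
      (\<forall>i\<in>{..<d}. openin euclideanreal (V i)) \<and> x \<in> Pi\<^sub>E {..<d} V \<and> Pi\<^sub>E {..<d} V \<subseteq> S"
    using assms unfolding coord_space_def openin_product_topology_alt by blast
  then obtain V where "\<forall>i\<in>{..<d}. openin euclideanreal (V i)" "x \<in> Pi\<^sub>E {..<d} V" "Pi\<^sub>E {..<d} V \<subseteq> S"
    by blast
  then show thesis by (intro that[of V]) auto
qed

lemma openin_coord_space_ballE:
  assumes "openin (coord_space d) S" "x \<in> S"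
  obtains e where "e > 0"
    "\<And>y. y \<in> extensional {..<d} \<Longrightarrow> (\<And>i. i < d \<Longrightarrow> \<bar>y i - x i\<bar> < e) \<Longrightarrow> y \<in> S"
proof -
  obtain V where V: "\<And>i. i < d \<Longrightarrow> open (V i)" "x \<in> Pi\<^sub>E {..<d} V" "Pi\<^sub>E {..<d} V \<subseteq> S"
    using openin_coord_space_boxE[OF assms] by metis
  have "\<exists>r>0. ball (x i) r \<subseteq> V i" if "i < d" for i
    using V(1)[OF that] V(2) that by (meson PiE_mem lessThan_iff openE)
  then obtain r where r: "\<And>i. i < d \<Longrightarrow> r i > 0" "\<And>i. i < d \<Longrightarrow> ball (x i) (r i) \<subseteq> V i" by metis
  define e where "e = Min (insert 1 (r ` {..<d}))"
  have e: "e \<le> r i" if "i < d" for i unfolding e_def using that by (intro Min_le) auto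
  show thesis
  proof
    show "e > 0" unfolding e_def by (subst Min_gr_iff) (use r(1) in auto)
    fix y assume y: "y \<in> extensional {..<d}" "\<And>i. i < d \<Longrightarrow> \<bar>y i - x i\<bar> < e"
    have "y i \<in> V i" if "i < d" for i
    proof -
      have "y i \<in> ball (x i) (r i)"
        using y(2)[OF that] e[OF that] by (simp add: dist_real_def abs_minus_commute)
      then show ?thesis using r(2)[OF that] by blast
    qed
    then show "y \<in> S" using y(1) V(3) by (auto simp: PiE_def)
  qed
qed

lemma openin_coord_space_measurable:
  assumes "openin (coord_space d) S"
  shows "S \<in> sets (coord_lebesgue d)"
proof -
  obtain B :: "real set set" where B: "countable B" "topological_basis B"
    using ex_countable_basis by blast
  define F where "F = {P \<in> Pi\<^sub>E {..<d} (\<lambda>_. B). Pi\<^sub>E {..<d} P \<subseteq> S}"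
  have "countable (Pi\<^sub>E {..<d} (\<lambda>_. B))" by (intro countable_PiE B) auto
  then have "countable F" unfolding F_def by (rule countable_subset[rotated]) auto
  moreover have "S = (\<Union>P\<in>F. Pi\<^sub>E {..<d} P)"
  proof
    show "S \<subseteq> (\<Union>P\<in>F. Pi\<^sub>E {..<d} P)"
    proof
      fix x assume x: "x \<in> S"
      obtain V where V: "\<And>i. i < d \<Longrightarrow> open (V i)" "x \<in> Pi\<^sub>E {..<d} V" "Pi\<^sub>E {..<d} V \<subseteq> S"
        using openin_coord_space_boxE[OF assms x] by metis
      have "\<exists>P. P \<in> B \<and> x i \<in> P \<and> P \<subseteq> V i" if "i < d" for i
        using topological_basisE[OF B(2) V(1)[OF that], of "x i"] V(2) that by (metis PiE_mem lessThan_iff)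
      then obtain P where P: "\<And>i. i < d \<Longrightarrow> P i \<in> B" "\<And>i. i < d \<Longrightarrow> x i \<in> P i" "\<And>i. i < d \<Longrightarrow> P i \<subseteq> V i"
        by metis
      let ?P = "restrict P {..<d}"
      have "Pi\<^sub>E {..<d} ?P \<subseteq> Pi\<^sub>E {..<d} V" by (rule PiE_mono) (use P(3) in auto)
      then have "?P \<in> F" using V(3) P(1) by (auto simp: F_def)
      moreover have "x \<in> Pi\<^sub>E {..<d} ?P" using V(2) P(2) by (auto simp: PiE_def)
      ultimately show "x \<in> (\<Union>P\<in>F. Pi\<^sub>E {..<d} P)" by blast
    qed
  qed (auto simp: F_def)
  moreover have "Pi\<^sub>E {..<d} P \<in> sets (coord_lebesgue d)" if "P \<in> F" for P
    unfolding coord_lebesgue_def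
  proof (rule sets_PiM_I_finite)
    show "P i \<in> sets lborel" if "i \<in> {..<d}" for i
      using that \<open>P \<in> F\<close> topological_basis_open[OF B(2)] by (auto simp: F_def PiE_def Pi_def)
  qed simp
  ultimately show ?thesis by (metis (no_types, lifting) sets.countable_UN'')
qed

lemma continuous_map_coord_space_measurable:
  fixes f :: "_ \<Rightarrow> 'b::topological_space"
  assumes "openin (coord_space d) U" "continuous_map (subtopology (coord_space d) U) euclidean f"
  shows "f \<in> borel_measurable (restrict_space (coord_lebesgue d) U)"
proof (rule borel_measurableI)
  fix S :: "'b set" assume "open S"
  have Ud: "U \<subseteq> extensional {..<d}"
    using openin_subset[OF assms(1)] by (simp add: topspace_coord_space)
  have "openin (subtopology (coord_space d) U) {x \<in> topspace (subtopology (coord_space d) U). f x \<in> S}"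
    using assms(2) \<open>open S\<close> by (intro openin_continuous_map_preimage) auto
  then have "openin (coord_space d) {x \<in> topspace (subtopology (coord_space d) U). f x \<in> S}"
    using assms(1) by (rule openin_trans_full)
  moreover have "{x \<in> topspace (subtopology (coord_space d) U). f x \<in> S}
      = f -` S \<inter> space (restrict_space (coord_lebesgue d) U)"
    using Ud by (auto simp: space_restrict_space space_coord_lebesgue topspace_coord_space)
  ultimately have "f -` S \<inter> space (restrict_space (coord_lebesgue d) U) \<in> sets (coord_lebesgue d)"
    using openin_coord_space_measurable by metis
  then show "f -` S \<inter> space (restrict_space (coord_lebesgue d) U) \<in> sets (restrict_space (coord_lebesgue d) U)"
    using openin_coord_space_measurable[OF assms(1)] sets.sets_into_space
    by (subst sets_restrict_space_iff) (auto simp: space_restrict_space)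
qed

text \<open>
  Continuous partial derivatives give differentiability: change one coordinate at a time and apply the
  mean value inequality to each step.
\<close>

lemma C1_on_coords_estimate:
  fixes \<phi> :: "(nat \<Rightarrow> real) \<Rightarrow> 'a::real_normed_vector"
  assumes opn: "openin (coord_space d) U" and C1: "C1_on_coords d U \<phi>" and x: "x \<in> U" and e: "e > 0"
  obtains r where "r > 0" "\<And>y. y \<in> extensional {..<d} \<Longrightarrow> (\<And>i. i < d \<Longrightarrow> \<bar>y i - x i\<bar> < r) \<Longrightarrow>
    norm (\<phi> y - \<phi> x - (\<Sum>i<d. (y i - x i) *\<^sub>R partial_deriv i \<phi> x)) \<le> e * (\<Sum>i<d. \<bar>y i - x i\<bar>)"
proof -
  define A where "A i = {y \<in> U. norm (partial_deriv i \<phi> y - partial_deriv i \<phi> x) < e}" for i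
  have UX: "U \<subseteq> extensional {..<d}" using openin_subset[OF opn] by (simp add: topspace_coord_space)
  have openA: "openin (coord_space d) (A i)" if "i < d" for i
  proof -
    have "openin (subtopology (coord_space d) U)
        {y \<in> topspace (subtopology (coord_space d) U). partial_deriv i \<phi> y \<in> ball (partial_deriv i \<phi> x) e}"
      using C1 that by (intro openin_continuous_map_preimage) (auto simp: C1_on_coords_def)
    moreover have "{y \<in> topspace (subtopology (coord_space d) U). partial_deriv i \<phi> y \<in> ball (partial_deriv i \<phi> x) e} = A i"
      using UX by (auto simp: A_def topspace_coord_space dist_norm norm_minus_commute)
    ultimately show ?thesis using openin_trans_full[OF _ opn] by metis
  qed
  have "openin (coord_space d) (U \<inter> ((\<Inter>i\<in>{..<d}. A i) \<inter> topspace (coord_space d)))"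
    by (intro openin_Int opn openin_INT) (auto intro: openA)
  moreover have "x \<in> U \<inter> ((\<Inter>i\<in>{..<d}. A i) \<inter> topspace (coord_space d))"
    using x UX e by (auto simp: A_def topspace_coord_space)
  ultimately obtain r where r: "r > 0"
    "\<And>y. y \<in> extensional {..<d} \<Longrightarrow> (\<And>i. i < d \<Longrightarrow> \<bar>y i - x i\<bar> < r) \<Longrightarrow>
      y \<in> U \<inter> ((\<Inter>i\<in>{..<d}. A i) \<inter> topspace (coord_space d))"
    by (rule openin_coord_space_ballE) (rule that, assumption, blast)
  show thesis
  proof (rule that[OF r(1)])
    fix y assume y: "y \<in> extensional {..<d}" "\<And>i. i < d \<Longrightarrow> \<bar>y i - x i\<bar> < r"
    define z where "z m = (\<lambda>i. if i < m then y i else x i)" for m :: nat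
    have z0: "z 0 = x" by (simp add: z_def)
    have zd: "z d = y"
    proof
      fix i show "z d i = y i"
        using extensional_arb[OF y(1), of i] extensional_arb[OF subsetD[OF UX x], of i]
        by (simp add: z_def)
    qed
    have main: "norm (\<phi> (z m) - \<phi> x - (\<Sum>i<m. (y i - x i) *\<^sub>R partial_deriv i \<phi> x))
        \<le> e * (\<Sum>i<m. \<bar>y i - x i\<bar>)" if "m \<le> d" for m
      using that
    proof (induction m)
      case 0
      then show ?case by (simp add: z0)
    next
      case (Suc m)
      then have m: "m < d" by simp
      define w where "w = partial_deriv m \<phi> x"
      define S where "S = closed_segment (x m) (y m)"
      define h where "h t = \<phi> ((z m)(m := t)) - t *\<^sub>R w" for t
      define w' where "w' t = partial_deriv m \<phi> ((z m)(m := t)) - w" for t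
      have near: "(z m)(m := t) \<in> U" "norm (w' t) < e" if "t \<in> S" for t
      proof -
        have t: "\<bar>t - x m\<bar> \<le> \<bar>y m - x m\<bar>"
          using that unfolding S_def by (auto simp: closed_segment_eq_real_ivl split: if_splits)
        have "(z m)(m := t) \<in> U \<inter> ((\<Inter>i\<in>{..<d}. A i) \<inter> topspace (coord_space d))"
        proof (rule r(2))
          show "(z m)(m := t) \<in> extensional {..<d}"
            using y(1) subsetD[OF UX x] m by (auto simp: z_def extensional_def)
          show "\<bar>((z m)(m := t)) i - x i\<bar> < r" if "i < d" for i
            using t y(2)[OF that] y(2)[OF m] r(1) by (auto simp: z_def)
        qed
        then show "(z m)(m := t) \<in> U" "norm (w' t) < e" using m by (auto simp: A_def w_def w'_def)
      qed
      have deriv: "(h has_derivative (\<lambda>s. s *\<^sub>R w' t)) (at t within S)" if "t \<in> S" for t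
      proof -
        have "(\<lambda>s. \<phi> (((z m)(m := t))(m := s))) differentiable (at (((z m)(m := t)) m))"
          using C1 near(1)[OF that] m by (simp only: C1_on_coords_def)
        then have "((\<lambda>s. \<phi> (((z m)(m := t))(m := s))) has_vector_derivative
            partial_deriv m \<phi> ((z m)(m := t))) (at (((z m)(m := t)) m))"
          unfolding partial_deriv_def vector_derivative_works .
        then have "((\<lambda>s. \<phi> ((z m)(m := s))) has_derivative
            (\<lambda>s. s *\<^sub>R partial_deriv m \<phi> ((z m)(m := t)))) (at t)"
          by (simp add: has_vector_derivative_def)
        then have "(h has_derivative (\<lambda>s. s *\<^sub>R partial_deriv m \<phi> ((z m)(m := t)) - s *\<^sub>R w)) (at t)"
          unfolding h_def by (intro has_derivative_diff has_derivative_scaleR_left has_derivative_ident)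
        then show ?thesis unfolding w'_def scaleR_diff_right by (rule has_derivative_at_withinI)
      qed
      have "norm (h (y m) - h (x m)) \<le> e * norm (y m - x m)"
      proof (rule differentiable_bound[OF _ deriv])
        show "onorm (\<lambda>s. s *\<^sub>R w' t) \<le> e" if "t \<in> S" for t
          using near(2)[OF that] e by (intro onorm_bound) (auto intro!: mult_left_mono simp: mult.commute[of e])
      qed (auto simp: S_def)
      moreover have "(z m)(m := y m) = z (Suc m)" "(z m)(m := x m) = z m"
        by (auto simp: z_def fun_eq_iff)
      ultimately have step: "norm (\<phi> (z (Suc m)) - \<phi> (z m) - (y m - x m) *\<^sub>R w) \<le> e * \<bar>y m - x m\<bar>"
        by (simp add: h_def algebra_simps)
      have IH: "norm (\<phi> (z m) - \<phi> x - (\<Sum>i<m. (y i - x i) *\<^sub>R partial_deriv i \<phi> x))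
        \<le> e * (\<Sum>i<m. \<bar>y i - x i\<bar>)" using Suc by simp
      have eq: "\<phi> (z (Suc m)) - \<phi> x - (\<Sum>i<Suc m. (y i - x i) *\<^sub>R partial_deriv i \<phi> x)
          = (\<phi> (z m) - \<phi> x - (\<Sum>i<m. (y i - x i) *\<^sub>R partial_deriv i \<phi> x))
            + (\<phi> (z (Suc m)) - \<phi> (z m) - (y m - x m) *\<^sub>R w)" by (simp add: w_def)
      show ?case
        unfolding eq using norm_triangle_mono[OF IH step]
        by (simp only: sum.lessThan_Suc distrib_left)
    qed
    show "norm (\<phi> y - \<phi> x - (\<Sum>i<d. (y i - x i) *\<^sub>R partial_deriv i \<phi> x)) \<le> e * (\<Sum>i<d. \<bar>y i - x i\<bar>)"
      using main[of d] by (simp add: zd)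
  qed
qed

lemma C1_on_coords_has_derivative:
  fixes \<phi> :: "(nat \<Rightarrow> real) \<Rightarrow> 'a::real_normed_vector"
    and res :: "'e::real_normed_vector \<Rightarrow> nat \<Rightarrow> real"
  assumes opn: "openin (coord_space d) U" and C1: "C1_on_coords d U \<phi>"
    and ext: "\<And>z. res z \<in> extensional {..<d}"
    and lin: "\<And>i. i < d \<Longrightarrow> bounded_linear (\<lambda>z. res z i)"
    and z: "res z \<in> U"
  shows "((\<lambda>z. \<phi> (res z)) has_derivative (\<lambda>h. \<Sum>i<d. res h i *\<^sub>R partial_deriv i \<phi> (res z))) (at z)"
  unfolding has_derivative_at_alt
proof (intro conjI allI impI)
  show "bounded_linear (\<lambda>h. \<Sum>i<d. res h i *\<^sub>R partial_deriv i \<phi> (res z))"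
    by (rule bounded_linear_sum) (rule bounded_linear_compose[OF bounded_linear_scaleR_left lin], simp)
  fix e :: real assume e: "e > 0"
  define c where "c i = onorm (\<lambda>z. res z i)" for i
  define C where "C = 1 + (\<Sum>i<d. c i)"
  have c: "c i \<ge> 0" "\<bar>res h i\<bar> \<le> c i * norm h" if "i < d" for i h
    using onorm_pos_le[OF lin[OF that]] onorm[OF lin[OF that], of h] by (simp_all add: c_def)
  have "(\<Sum>i<d. c i) \<ge> 0" by (rule sum_nonneg) (simp add: c(1))
  then have C: "C > 0" by (simp add: C_def)
  have cC: "c i \<le> C" if "i < d" for i
  proof -
    have "c i \<le> (\<Sum>i<d. c i)" by (rule member_le_sum) (use that c(1) in auto)
    then show ?thesis by (simp add: C_def)
  qed
  have diff: "res y i - res z i = res (y - z) i" if "i < d" for y z i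
    using linear_diff[OF bounded_linear.linear[OF lin[OF that]], of y z] by simp
  have eC: "e / C > 0" using e C by simp
  obtain r where r: "r > 0" "\<And>y. y \<in> extensional {..<d} \<Longrightarrow> (\<And>i. i < d \<Longrightarrow> \<bar>y i - res z i\<bar> < r) \<Longrightarrow>
    norm (\<phi> y - \<phi> (res z) - (\<Sum>i<d. (y i - res z i) *\<^sub>R partial_deriv i \<phi> (res z)))
      \<le> e / C * (\<Sum>i<d. \<bar>y i - res z i\<bar>)"
    by (rule C1_on_coords_estimate[OF opn C1 z eC]) (rule that, assumption, blast)
  show "\<exists>\<delta>>0. \<forall>y. norm (y - z) < \<delta> \<longrightarrow>
      norm (\<phi> (res y) - \<phi> (res z) - (\<Sum>i<d. res (y - z) i *\<^sub>R partial_deriv i \<phi> (res z))) \<le> e * norm (y - z)"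
  proof (intro exI[of _ "r / C"] conjI allI impI)
    show "r / C > 0" using r(1) C by simp
    fix y assume y: "norm (y - z) < r / C"
    have "norm (\<phi> (res y) - \<phi> (res z) - (\<Sum>i<d. (res y i - res z i) *\<^sub>R partial_deriv i \<phi> (res z)))
        \<le> e / C * (\<Sum>i<d. \<bar>res y i - res z i\<bar>)"
    proof (rule r(2)[OF ext])
      fix i assume i: "i < d"
      have "\<bar>res y i - res z i\<bar> \<le> c i * norm (y - z)" using c(2)[OF i] by (simp add: diff[OF i])
      also have "\<dots> \<le> C * norm (y - z)" by (intro mult_right_mono cC i) simp
      also have "\<dots> < r" using y C by (simp add: field_simps)
      finally show "\<bar>res y i - res z i\<bar> < r" .
    qed
    also have "(\<Sum>i<d. (res y i - res z i) *\<^sub>R partial_deriv i \<phi> (res z))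
        = (\<Sum>i<d. res (y - z) i *\<^sub>R partial_deriv i \<phi> (res z))"
      by (rule sum.cong) (simp_all add: diff)
    also have "e / C * (\<Sum>i<d. \<bar>res y i - res z i\<bar>) \<le> e / C * (C * norm (y - z))"
    proof (rule mult_left_mono)
      have "(\<Sum>i<d. \<bar>res y i - res z i\<bar>) \<le> (\<Sum>i<d. c i * norm (y - z))"
        by (rule sum_mono) (simp add: diff c(2))
      also have "\<dots> \<le> C * norm (y - z)"
        unfolding C_def by (simp add: sum_distrib_right[symmetric] distrib_right)
      finally show "(\<Sum>i<d. \<bar>res y i - res z i\<bar>) \<le> C * norm (y - z)" .
    qed (use e C in simp)
    also have "e / C * (C * norm (y - z)) = e * norm (y - z)" using C by simp
    finally show "norm (\<phi> (res y) - \<phi> (res z) - (\<Sum>i<d. res (y - z) i *\<^sub>R partial_deriv i \<phi> (res z)))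
        \<le> e * norm (y - z)" .
  qed
qed

text \<open>Transfer of Lebesgue measure between coordinates indexed by numbers and by a type.\<close>

lemma lborel_eq_distr_PiM:
  fixes \<tau> :: "'k::finite \<Rightarrow> nat"
  assumes bij: "bij_betw \<tau> UNIV {..<N}"
  shows "lborel = distr (PiM {..<N} (\<lambda>_. lborel)) borel (\<lambda>x. \<chi> i. x (\<tau> i) :: real^'k)"
    and "(\<lambda>x. \<chi> i. x (\<tau> i) :: real^'k) \<in> borel_measurable (PiM {..<N} (\<lambda>_. lborel))"
proof -
  interpret product_sigma_finite "\<lambda>_::nat. lborel :: real measure" by standard
  let ?f = "\<lambda>x. \<chi> i. x (\<tau> i) :: real^'k"
  have \<tau>: "\<tau> i < N" for i using bij by (auto simp: bij_betw_def)
  have Basis: "(Basis :: (real^'k) set) = (\<lambda>i. axis i 1) ` UNIV" by (auto simp: Basis_vec_def)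
  show meas: "?f \<in> borel_measurable (PiM {..<N} (\<lambda>_. lborel))"
  proof (subst borel_measurable_euclidean_space, rule ballI)
    fix b :: "real^'k" assume "b \<in> Basis"
    then obtain i where "b = axis i 1" using Basis by auto
    then have "(\<lambda>x. ?f x \<bullet> b) = (\<lambda>x. x (\<tau> i))" by (simp add: inner_axis)
    moreover have "(\<lambda>x. x (\<tau> i)) \<in> PiM {..<N} (\<lambda>_. lborel :: real measure) \<rightarrow>\<^sub>M lborel"
      by (rule measurable_component_singleton) (simp add: \<tau>)
    ultimately show "(\<lambda>x. ?f x \<bullet> b) \<in> borel_measurable (PiM {..<N} (\<lambda>_. lborel))" by simp
  qed
  show "lborel = distr (PiM {..<N} (\<lambda>_. lborel)) borel ?f"
  proof (rule lborel_eqI)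
    fix l u :: "real^'k" assume le: "\<And>b. b \<in> Basis \<Longrightarrow> l \<bullet> b \<le> u \<bullet> b"
    have lu: "l $ i \<le> u $ i" for i using le[of "axis i 1"] by (simp add: Basis inner_axis)
    define \<sigma> where "\<sigma> = inv \<tau>"
    have \<sigma>: "\<sigma> (\<tau> i) = i" for i using bij by (simp add: \<sigma>_def bij_betw_def)
    have all_less: "(\<forall>j<N. Q j) \<longleftrightarrow> (\<forall>i. Q (\<tau> i))" for Q
      using bij_betw_imp_surj_on[OF bij] by (metis lessThan_iff rangeE rangeI)
    have "?f -` box l u \<inter> space (PiM {..<N} (\<lambda>_. lborel)) = Pi\<^sub>E {..<N} (\<lambda>j. {l $ \<sigma> j <..< u $ \<sigma> j})"
      by (auto simp: space_PiM PiE_def Pi_def mem_box_cart all_less \<sigma>)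
    then have "emeasure (distr (PiM {..<N} (\<lambda>_. lborel)) borel ?f) (box l u)
        = emeasure (PiM {..<N} (\<lambda>_. lborel)) (Pi\<^sub>E {..<N} (\<lambda>j. {l $ \<sigma> j <..< u $ \<sigma> j}))"
      by (simp add: emeasure_distr[OF meas])
    also have "\<dots> = (\<Prod>j<N. emeasure lborel {l $ \<sigma> j <..< u $ \<sigma> j})" by (rule emeasure_PiM) auto
    also have "\<dots> = (\<Prod>j<N. ennreal (u $ \<sigma> j - l $ \<sigma> j))" by (simp add: lu)
    also have "\<dots> = (\<Prod>i\<in>UNIV. ennreal (u $ \<sigma> (\<tau> i) - l $ \<sigma> (\<tau> i)))"
      by (rule prod.reindex_bij_betw[OF bij, symmetric])
    also have "\<dots> = ennreal (\<Prod>i\<in>UNIV. u $ i - l $ i)" by (subst prod_ennreal) (simp_all add: \<sigma> lu)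
    also have "(\<Prod>i\<in>UNIV. u $ i - l $ i) = (\<Prod>b\<in>Basis. (u - l) \<bullet> b)"
      unfolding Basis by (subst prod.reindex) (auto simp: inj_on_def axis_eq_axis inner_axis)
    finally show "emeasure (distr (PiM {..<N} (\<lambda>_. lborel)) borel ?f) (box l u)
        = ennreal (\<Prod>b\<in>Basis. (u - l) \<bullet> b)" .
  qed simp
qed

section \<open>Uniqueness of the Riemannian measure\<close>

lemma local_parametrization_measurable:
  fixes \<phi> :: "(nat \<Rightarrow> real) \<Rightarrow> 'a::real_normed_vector"
  assumes "local_parametrization d M U \<phi>"
  shows "U \<in> sets (coord_lebesgue d)" "\<phi> \<in> borel_measurable (restrict_space (coord_lebesgue d) U)"
proof -
  have U: "openin (coord_space d) U" using assms by (simp add: local_parametrization_def)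
  show "U \<in> sets (coord_lebesgue d)" by (rule openin_coord_space_measurable[OF U])
  have "continuous_map (subtopology (coord_space d) U) (top_of_set (\<phi> ` U)) \<phi>"
    using assms unfolding local_parametrization_def by (metis homeomorphic_imp_continuous_map)
  then have "continuous_map (subtopology (coord_space d) U) euclidean \<phi>"
    by (simp add: continuous_map_in_subtopology)
  then show "\<phi> \<in> borel_measurable (restrict_space (coord_lebesgue d) U)"
    by (rule continuous_map_coord_space_measurable[OF U])
qed

text \<open>
  Countably many charts cover the submanifold, and a Borel set is the disjoint union of countably many
  pieces each of which lies in the image of one of them.
\<close>

lemma riemannian_measure_unique:
  fixes M :: "'a::euclidean_space set"
  assumes emb: "embedded_submanifold d M"
    and \<mu>: "is_riemannian_measure g d M \<mu>" and \<nu>: "is_riemannian_measure g d M \<nu>"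
  shows "\<mu> = \<nu>"
proof (rule measure_eqI)
  have sets: "sets \<mu> = sets (restrict_space borel M)" "sets \<nu> = sets (restrict_space borel M)"
    using \<mu> \<nu> by (auto simp: is_riemannian_measure_def)
  then show "sets \<mu> = sets \<nu>" by simp
  fix A assume A: "A \<in> sets \<mu>"
  then have AM: "A \<subseteq> M" using sets.sets_into_space[OF A] \<mu> by (simp add: is_riemannian_measure_def)
  show "emeasure \<mu> A = emeasure \<nu> A"
  proof (cases "M = {}")
    case True
    then show ?thesis using AM by simp
  next
    case False
    define \<O> where "\<O> = {V. open V \<and> (\<exists>U \<phi>. local_parametrization d M U \<phi> \<and> \<phi> ` U = M \<inter> V)}"
    have cover: "M \<subseteq> \<Union>\<O>"
    proof
      fix p assume "p \<in> M"
      then obtain U \<phi> where U: "local_parametrization d M U \<phi>" "p \<in> \<phi> ` U"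
        using emb unfolding embedded_submanifold_def by blast
      then obtain V where "open V" "\<phi> ` U = M \<inter> V"
        unfolding local_parametrization_def openin_open by blast
      then show "p \<in> \<Union>\<O>" using U by (auto simp: \<O>_def)
    qed
    obtain \<C> where \<C>: "\<C> \<subseteq> \<O>" "countable \<C>" "\<Union>\<C> = \<Union>\<O>" using Lindelof[of \<O>] by (auto simp: \<O>_def)
    have "\<C> \<noteq> {}" using \<C>(3) cover False by blast
    define V where "V = from_nat_into \<C>"
    have range_V: "range V = \<C>" unfolding V_def by (rule range_from_nat_into[OF \<open>\<C> \<noteq> {}\<close> \<C>(2)])
    then have V: "V n \<in> \<O>" for n using \<C>(1) by auto
    have open_V: "open (V n)" for n using V by (auto simp: \<O>_def)
    have "disjointed V n \<in> sets borel" for n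
    proof -
      have "range V \<subseteq> sets borel" using open_V by auto
      from sets.range_disjointed_sets[OF this] show ?thesis by blast
    qed
    define B where "B n = A \<inter> disjointed V n" for n
    have B_sets: "B n \<in> sets (restrict_space borel M)" for n
    proof -
      obtain A' where "A' \<in> sets borel" "A = A' \<inter> M"
        using A sets by (auto simp: sets_restrict_space)
      then have "B n = (A' \<inter> disjointed V n) \<inter> M" "A' \<inter> disjointed V n \<in> sets borel"
        using \<open>\<And>n. disjointed V n \<in> sets borel\<close> by (auto simp: B_def)
      then show ?thesis by (auto simp: sets_restrict_space)
    qed
    have disj: "disjoint_family B"
      using disjoint_family_disjointed[of V] by (auto simp: disjoint_family_on_def B_def)
    have "A \<subseteq> \<Union> (range V)" using AM cover \<C>(3) range_V by auto
    then have UB: "(\<Union>n. B n) = A" using UN_disjointed_eq[of V] by (auto simp: B_def)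
    have "emeasure \<mu> (B n) = emeasure \<nu> (B n)" for n
    proof -
      obtain U \<phi> where lp: "local_parametrization d M U \<phi>" and im: "\<phi> ` U = M \<inter> V n"
        using V[of n] by (auto simp: \<O>_def)
      define E where "E = {x \<in> U. \<phi> x \<in> B n}"
      have "B n \<subseteq> \<phi> ` U" using AM disjointed_subset[of V n] by (auto simp: B_def im)
      then have E: "\<phi> ` E = B n" by (auto simp: E_def)
      obtain B' where B': "B' \<in> sets borel" "B n = M \<inter> B'"
        using B_sets[of n] by (auto simp: sets_restrict_space)
      have "E = \<phi> -` B' \<inter> space (restrict_space (coord_lebesgue d) U)"
        using im B'(2) sets.sets_into_space[OF local_parametrization_measurable(1)[OF lp]]
        by (auto simp: E_def space_restrict_space)
      then have "E \<in> sets (restrict_space (coord_lebesgue d) U)"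
        using measurable_sets[OF local_parametrization_measurable(2)[OF lp] B'(1)] by simp
      then have "E \<in> sets (coord_lebesgue d)"
        using local_parametrization_measurable(1)[OF lp]
        by (metis sets.Int_space_eq2 sets_restrict_space_iff)
      moreover have "E \<subseteq> U" by (auto simp: E_def)
      ultimately have "emeasure \<mu> (\<phi> ` E) = emeasure \<nu> (\<phi> ` E)"
        using \<mu> \<nu> lp unfolding is_riemannian_measure_def by metis
      then show ?thesis by (simp add: E)
    qed
    moreover have ran: "range B \<subseteq> sets \<mu>" "range B \<subseteq> sets \<nu>" using B_sets by (auto simp: sets)
    ultimately show ?thesis
      using suminf_emeasure[OF ran(1) disj] suminf_emeasure[OF ran(2) disj] by (simp add: UB)
  qed
qed

lemma riemannian_measure_eqI:
  fixes M :: "'a::euclidean_space set"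
  assumes "embedded_submanifold d M" "is_riemannian_measure g d M \<mu>"
  shows "riemannian_measure g d M = \<mu>"
  unfolding riemannian_measure_def
  using assms(2) riemannian_measure_unique[OF assms(1) _ assms(2)] by (rule the_equality)

section \<open>Gram determinants\<close>

lemma det_eq_det_upto:
  fixes \<tau> :: "'k::finite \<Rightarrow> nat"
  assumes bij: "bij_betw \<tau> UNIV {..<N}"
  shows "det (\<chi> i j. g (\<tau> i) (\<tau> j) :: real^'k^'k) = det_upto N g"
proof -
  let ?m = "map_permutation UNIV \<tau>"
  have inj: "inj \<tau>" and ran: "range \<tau> = {..<N}" using bij by (auto simp: bij_betw_def)
  have m: "?m = (\<lambda>p x. if x \<in> {..<N} then \<tau> (p (inv_into UNIV \<tau> x)) else x)"
    by (auto simp: fun_eq_iff map_permutation_def restrict_id_def ran)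
  have bm: "bij_betw ?m {p. p permutes UNIV} {p. p permutes {..<N}}"
    unfolding m by (rule bij_betw_permutations[OF bij])
  have "det_upto N g = (\<Sum>p | p permutes UNIV. of_int (sign (?m p)) * (\<Prod>i<N. g i (?m p i)))"
    unfolding det_upto_def by (rule sum.reindex_bij_betw[OF bm, symmetric])
  also have "\<dots> = (\<Sum>p | p permutes UNIV. of_int (sign p) * (\<Prod>i\<in>UNIV. g (\<tau> i) (\<tau> (p i))))"
  proof (rule sum.cong[OF refl])
    fix p :: "'k \<Rightarrow> 'k" assume "p \<in> {p. p permutes UNIV}"
    then have "sign (?m p) = sign p" by (intro sign_map_permutation inj) auto
    moreover have "(\<Prod>i<N. g i (?m p i)) = (\<Prod>i\<in>UNIV. g (\<tau> i) (?m p (\<tau> i)))"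
      by (rule prod.reindex_bij_betw[OF bij, symmetric])
    moreover have "?m p (\<tau> i) = \<tau> (p i)" for i using ran by (auto simp: m inv_f_f[OF inj])
    ultimately show "of_int (sign (?m p)) * (\<Prod>i<N. g i (?m p i))
        = of_int (sign p) * (\<Prod>i\<in>UNIV. g (\<tau> i) (\<tau> (p i)))" by simp
  qed
  finally show ?thesis by (simp add: det_def)
qed

text \<open>
  Bordering a matrix by an identity block does not change its determinant: a permutation that moves an
  index of the block contributes a factor 0.
\<close>

lemma det_upto_extend:
  assumes "\<And>i j. i < d \<Longrightarrow> j < d \<Longrightarrow> h i j = g i j"
    and "\<And>i j. d \<le> i \<Longrightarrow> i < d + m \<Longrightarrow> j < d + m \<Longrightarrow> h i j = (if i = j then 1 else 0)"
  shows "det_upto (d + m) h = det_upto d g"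
proof -
  have "det_upto (d + m) h = (\<Sum>p | p permutes {..<d}. of_int (sign p) * (\<Prod>i<d+m. h i (p i)))"
    unfolding det_upto_def
  proof (rule sum.mono_neutral_right)
    show "finite {p. p permutes {..<d + m}}" by (rule finite_permutations) simp
    show "{p. p permutes {..<d}} \<subseteq> {p. p permutes {..<d + m}}" by (auto intro: permutes_subset)
    show "\<forall>p\<in>{p. p permutes {..<d + m}} - {p. p permutes {..<d}}.
        of_int (sign p) * (\<Prod>i<d + m. h i (p i)) = 0"
    proof
      fix p assume p: "p \<in> {p. p permutes {..<d + m}} - {p. p permutes {..<d}}"
      then have "\<exists>i\<in>{..<d + m} - {..<d}. p i \<noteq> i"
        using permutes_superset[of p "{..<d + m}" "{..<d}"] by blast
      then obtain i where i: "d \<le> i" "i < d + m" "p i \<noteq> i" by auto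
      moreover have "p i < d + m" using p i(2) permutes_in_image[of p "{..<d + m}" i] by simp
      ultimately have "h i (p i) = 0" using assms(2) by auto
      then have "(\<Prod>i<d + m. h i (p i)) = 0" using i(2) by (intro prod_zero) auto
      then show "of_int (sign p) * (\<Prod>i<d + m. h i (p i)) = 0" by simp
    qed
  qed
  also have "\<dots> = det_upto d g"
    unfolding det_upto_def
  proof (rule sum.cong[OF refl])
    fix p :: "nat \<Rightarrow> nat" assume "p \<in> {p. p permutes {..<d}}"
    then have p: "p permutes {..<d}" by simp
    have "(\<Prod>i<d + m. h i (p i)) = (\<Prod>i<d. g i (p i))"
    proof (rule prod.mono_neutral_cong_right)
      show "\<forall>i\<in>{..<d + m} - {..<d}. h i (p i) = 1" using assms(2) permutes_not_in[OF p] by auto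
      show "h i (p i) = g i (p i)" if "i \<in> {..<d}" for i
        using that assms(1) permutes_in_image[OF p, of i] by auto
    qed auto
    then show "of_int (sign p) * (\<Prod>i<d + m. h i (p i)) = of_int (sign p) * (\<Prod>i<d. g i (p i))"
      by simp
  qed
  finally show ?thesis .
qed

lemma det_square:
  fixes A :: "real^'k^'k"
  shows "(det A)\<^sup>2 = det (\<chi> i j. \<Sum>l\<in>UNIV. A $ l $ i * A $ l $ j)"
proof -
  have "(det A)\<^sup>2 = det (transpose A ** A)" by (simp add: det_mul power2_eq_square)
  also have "transpose A ** A = (\<chi> i j. \<Sum>l\<in>UNIV. A $ l $ i * A $ l $ j)"
    by (simp add: matrix_matrix_mult_def transpose_def)
  finally show ?thesis .
qed

text \<open>By Parseval's identity the coordinate matrix \<open>A\<close> of the vectors has \<open>transpose A ** A\<close> as Gram matrix.\<close>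

lemma det_herm_coord_square:
  fixes Q :: "nat \<Rightarrow> 'f::star_division_algebra^'n^'n" and \<tau> :: "'k::finite \<Rightarrow> nat"
  assumes bij: "bij_betw \<tau> UNIV {..<orbit_dim TYPE('f^'n^'n) + CARD('n)}"
    and herm: "\<And>j. j < orbit_dim TYPE('f^'n^'n) + CARD('n) \<Longrightarrow> hermitian (Q j)"
  shows "(det (\<chi> i j. herm_coord (\<tau> i) (Q (\<tau> j)) :: real^'k^'k))\<^sup>2
    = det_upto (orbit_dim TYPE('f^'n^'n) + CARD('n)) (\<lambda>i j. Q i \<bullet> Q j)"
proof -
  let ?N = "orbit_dim TYPE('f^'n^'n) + CARD('n)"
  have \<tau>: "\<tau> i < ?N" for i using bij by (auto simp: bij_betw_def)
  have "(\<Sum>l\<in>UNIV. herm_coord (\<tau> l) (Q (\<tau> i)) * herm_coord (\<tau> l) (Q (\<tau> j))) = Q (\<tau> i) \<bullet> Q (\<tau> j)" for i j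
  proof -
    have "(\<Sum>l\<in>UNIV. herm_coord (\<tau> l) (Q (\<tau> i)) * herm_coord (\<tau> l) (Q (\<tau> j)))
        = (\<Sum>k<?N. herm_coord k (Q (\<tau> i)) * herm_coord k (Q (\<tau> j)))"
      by (rule sum.reindex_bij_betw[OF bij])
    also have "\<dots> = Q (\<tau> i) \<bullet> Q (\<tau> j)" by (rule inner_eq_sum_herm_coord[symmetric]) (intro herm \<tau>)+
    finally show ?thesis .
  qed
  then show ?thesis
    unfolding det_square by (simp add: det_eq_det_upto[OF bij, of "\<lambda>i j. Q i \<bullet> Q j"])
qed

section \<open>Changing the eigenvalues\<close>

text \<open>
  On the orbit of \<open>diagmat v\<close> this polynomial replaces the eigenvalues \<open>v\<close> by \<open>w\<close> and keeps the
  eigenspaces.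
\<close>

definition reeigen ::
    "('n::finite \<Rightarrow> real) \<Rightarrow> ('n \<Rightarrow> real) \<Rightarrow> 'f::star_division_algebra^'n^'n \<Rightarrow> 'f^'n^'n" where
  "reeigen v w X = (\<Sum>a\<in>UNIV. w a *\<^sub>R spectral_proj v a X)"

definition dspectral_proj ::
    "('n::finite \<Rightarrow> real) \<Rightarrow> 'n \<Rightarrow> 'f::star_division_algebra^'n^'n \<Rightarrow> 'f^'n^'n \<Rightarrow> 'f^'n^'n" where
  "dspectral_proj v a X H =
    (1 / (\<Prod>r\<leftarrow>remove1 (v a) (eigs v). v a - r)) *\<^sub>R dlin_prod (remove1 (v a) (eigs v)) X H"

definition dreeigen ::
    "('n::finite \<Rightarrow> real) \<Rightarrow> ('n \<Rightarrow> real) \<Rightarrow> 'f::star_division_algebra^'n^'n \<Rightarrow> 'f^'n^'n \<Rightarrow> 'f^'n^'n" where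
  "dreeigen v w X H = (\<Sum>a\<in>UNIV. w a *\<^sub>R dspectral_proj v a X H)"

lemma has_derivative_spectral_proj: "(spectral_proj v a has_derivative dspectral_proj v a X) (at X)"
  unfolding spectral_proj_def[abs_def] dspectral_proj_def[abs_def]
  by (intro has_derivative_scaleR_right has_derivative_lin_prod)

lemma has_derivative_reeigen: "(reeigen v w has_derivative dreeigen v w X) (at X)"
  unfolding reeigen_def[abs_def] dreeigen_def[abs_def]
  by (intro has_derivative_sum has_derivative_scaleR_right has_derivative_spectral_proj)

lemma reeigen_conj_by:
  fixes U :: "'f::star_division_algebra^'n^'n"
  assumes "inj v" "U \<in> unitary_group"
  shows "reeigen v w (conj_by U (diagmat v)) = conj_by U (diagmat w)"
proof -
  have "(diagmat w :: 'f^'n^'n) = (\<Sum>a\<in>UNIV. w a *\<^sub>R diagmat (\<lambda>i. if i = a then 1 else 0))"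
    unfolding diagmat_scaleR[symmetric] diagmat_sum[symmetric] by (simp add: mult_delta_right)
  then show ?thesis
    by (simp add: reeigen_def spectral_proj_conj_by spectral_proj_diagmat assms
        linear_sum[OF linear_conj_by] linear_cmul[OF linear_conj_by])
qed

lemma dlin_prod_conj_by:
  assumes "U \<in> unitary_group"
  shows "dlin_prod rs (conj_by U X) (conj_by U H) = conj_by U (dlin_prod rs X H)"
  using assms
  by (induction rs) (simp_all add: linear_0[OF linear_conj_by] linear_add[OF linear_conj_by]
    conj_by_minus_scaleR conj_by_mult lin_prod_conj_by)

lemma has_derivative_transform_nhds:
  assumes "(f has_derivative f') (at x)" "\<forall>\<^sub>F y in nhds x. f y = g y"
  shows "(g has_derivative f') (at x)"
proof -
  obtain S where "open S" "x \<in> S" "\<And>y. y \<in> S \<Longrightarrow> f y = g y"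
    using assms(2) unfolding eventually_nhds by blast
  then show ?thesis by (rule has_derivative_transform_within_open[OF assms(1)])
qed

text \<open>
  Tangent vectors of an orbit at \<open>X = U D U*\<close>, seen in the eigenbasis \<open>U\<close>, have zero diagonal: the
  polynomial with roots \<open>v\<close> vanishes along the orbit, and on the diagonal its derivative at \<open>D\<close> is
  multiplication by nonzero numbers.
\<close>

lemma tangent_diag_zero:
  fixes c :: "real \<Rightarrow> 'f::star_division_algebra^'n^'n"
  assumes inj: "inj v" and U: "U \<in> unitary_group"
    and ct: "c t = conj_by U (diagmat v)"
    and deriv: "(c has_vector_derivative W) (at t)"
    and on_orbit: "\<forall>\<^sub>F s in nhds t. c s \<in> unitary_orbit (diagmat v)"
  shows "hermitian W" "conj_by (adjoint_matrix U) W $ i $ i = 0"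
proof -
  have dc: "(c has_derivative (\<lambda>s. s *\<^sub>R W)) (at t)"
    using deriv by (simp add: has_vector_derivative_def)
  have zero_deriv: "f W = 0"
    if f: "((\<lambda>s. G (c s)) has_derivative (\<lambda>s. s *\<^sub>R f W)) (at t)"
      and G: "\<And>X. X \<in> unitary_orbit (diagmat v) \<Longrightarrow> G X = 0"
    for G f :: "'f^'n^'n \<Rightarrow> 'f^'n^'n"
  proof -
    have "\<forall>\<^sub>F s in nhds t. G (c s) = 0" using on_orbit by eventually_elim (rule G)
    then have "((\<lambda>_. 0 :: 'f^'n^'n) has_derivative (\<lambda>s. s *\<^sub>R f W)) (at t)"
      by (rule has_derivative_transform_nhds[OF f])
    then have "(\<lambda>s :: real. s *\<^sub>R f W) = (\<lambda>_. 0)"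
      by (rule has_derivative_unique[OF _ has_derivative_const])
    from fun_cong[OF this, of 1] show ?thesis by simp
  qed
  show "hermitian W"
  proof -
    have "W - adjoint_matrix W = 0"
    proof (rule zero_deriv[of "\<lambda>X. X - adjoint_matrix X" "\<lambda>X. X - adjoint_matrix X"])
      have "bounded_linear (adjoint_matrix :: 'f^'n^'n \<Rightarrow> _)"
        using linear_adjoint by (simp add: linear_conv_bounded_linear)
      from has_derivative_diff[OF dc bounded_linear.has_derivative[OF this dc]]
      show "((\<lambda>s. c s - adjoint_matrix (c s)) has_derivative (\<lambda>s. s *\<^sub>R (W - adjoint_matrix W))) (at t)"
        by (simp add: linear_cmul[OF linear_adjoint] scaleR_diff_right)
      show "X - adjoint_matrix X = 0" if "X \<in> unitary_orbit (diagmat v)" for X :: "'f^'n^'n"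
        using hermitian_orbit[OF that] by (simp add: hermitian_def)
    qed
    then show ?thesis by (simp add: hermitian_def)
  qed
  have lin: "linear (dlin_prod (eigs v) X)" for X :: "'f^'n^'n"
    using has_derivative_lin_prod by (rule has_derivative_linear)
  have "dlin_prod (eigs v) (c t) W = 0"
  proof (rule zero_deriv[of "lin_prod (eigs v)" "dlin_prod (eigs v) (c t)"])
    from has_derivative_compose[OF dc has_derivative_lin_prod[of "eigs v"]]
    show "((\<lambda>s. lin_prod (eigs v) (c s)) has_derivative (\<lambda>s. s *\<^sub>R dlin_prod (eigs v) (c t) W)) (at t)"
      by (simp add: linear_cmul[OF lin])
  qed (rule lin_prod_eigs_orbit)
  then have "conj_by (adjoint_matrix U) (dlin_prod (eigs v) (conj_by U (diagmat v)) W) = 0"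
    by (simp add: ct linear_0[OF linear_conj_by])
  then have "dlin_prod (eigs v) (diagmat v) (conj_by (adjoint_matrix U) W) = 0"
    by (subst (asm) dlin_prod_conj_by[OF unitary_adjoint[OF U], symmetric]) (simp add: U)
  then have "dprod (eigs v) (v i) *\<^sub>R (conj_by (adjoint_matrix U) W $ i $ i) = 0"
    by (metis dlin_prod_diagmat_diagonal zero_index)
  moreover have "dprod (eigs v) (v i) \<noteq> 0" by (rule dprod_nonzero) simp_all
  ultimately show "conj_by (adjoint_matrix U) W $ i $ i = 0" by simp
qed

text \<open>
  As \<open>F = reeigen v w X\<close> commutes with \<open>X\<close>, differentiating \<open>F X = X F\<close> along the orbit relates the
  derivatives of \<open>F\<close> and \<open>X\<close> entry by entry in the eigenbasis.
\<close>

lemma dreeigen_tangent: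
  fixes c :: "real \<Rightarrow> 'f::star_division_algebra^'n^'n"
  assumes inj: "inj v" "inj w" and U: "U \<in> unitary_group"
    and ct: "c t = conj_by U (diagmat v)"
    and deriv: "(c has_vector_derivative W) (at t)"
    and on_orbit: "\<forall>\<^sub>F s in nhds t. c s \<in> unitary_orbit (diagmat v)"
  defines "Y \<equiv> dreeigen v w (c t) W"
  shows "hermitian Y" "conj_by (adjoint_matrix U) Y $ i $ i = 0"
    and "(v b - v a) *\<^sub>R (conj_by (adjoint_matrix U) Y $ a $ b)
      = (w b - w a) *\<^sub>R (conj_by (adjoint_matrix U) W $ a $ b)"
proof -
  let ?F = "\<lambda>s. reeigen v w (c s)" and ?U = "adjoint_matrix U"
  have Ft: "?F t = conj_by U (diagmat w)" by (simp add: ct reeigen_conj_by inj U)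
  have orbit: "reeigen v w X \<in> unitary_orbit (diagmat w) \<and> reeigen v w X ** X = X ** reeigen v w X"
    if X: "X \<in> unitary_orbit (diagmat v)" for X :: "'f^'n^'n"
  proof -
    obtain V where V: "V \<in> unitary_group" "X = conj_by V (diagmat v)" using X by (rule orbitE)
    show ?thesis
      unfolding V(2) reeigen_conj_by[OF inj(1) V(1)] conj_by_mult[OF V(1), symmetric]
        diagmat_mult_diagmat using V(1) by (simp add: orbitI mult.commute)
  qed
  have dc: "(c has_derivative (\<lambda>s. s *\<^sub>R W)) (at t)"
    using deriv by (simp add: has_vector_derivative_def)
  have lin: "linear (dreeigen v w X)" for X :: "'f^'n^'n"
    using has_derivative_reeigen by (rule has_derivative_linear)
  have dF: "(?F has_derivative (\<lambda>s. s *\<^sub>R Y)) (at t)"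
    using has_derivative_compose[OF dc has_derivative_reeigen[of v w]]
    by (simp add: linear_cmul[OF lin] Y_def)
  then have dF': "(?F has_vector_derivative Y) (at t)" by (simp add: has_vector_derivative_def)
  have "\<forall>\<^sub>F s in nhds t. ?F s \<in> unitary_orbit (diagmat w)"
    using on_orbit by eventually_elim (simp add: orbit)
  note tangent_diag_zero[of w U ?F t Y, OF inj(2) U Ft dF' this]
  then show "hermitian Y" "conj_by ?U Y $ i $ i = 0" by blast+
  have "\<forall>\<^sub>F s in nhds t. ?F s ** c s = c s ** ?F s"
    using on_orbit by eventually_elim (simp add: orbit)
  moreover have "((\<lambda>s. ?F s ** c s) has_derivative (\<lambda>s. ?F t ** (s *\<^sub>R W) + (s *\<^sub>R Y) ** c t)) (at t)"
    by (rule has_derivative_matrix_mult[OF dF dc])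
  ultimately have "((\<lambda>s. c s ** ?F s) has_derivative (\<lambda>s. ?F t ** (s *\<^sub>R W) + (s *\<^sub>R Y) ** c t)) (at t)"
    by (rule has_derivative_transform_nhds[rotated])
  from has_derivative_unique[OF this has_derivative_matrix_mult[OF dc dF]]
  have "?F t ** W + Y ** c t = c t ** Y + W ** ?F t" by (drule_tac x = 1 in fun_cong) simp
  then have "conj_by ?U (conj_by U (diagmat w) ** W + Y ** conj_by U (diagmat v))
      = conj_by ?U (conj_by U (diagmat v) ** Y + W ** conj_by U (diagmat w))"
    unfolding Ft unfolding ct by (rule arg_cong)
  then have "diagmat w ** conj_by ?U W + conj_by ?U Y ** diagmat v
      = diagmat v ** conj_by ?U Y + conj_by ?U W ** diagmat w"
    by (simp add: linear_add[OF linear_conj_by] conj_by_mult unitary_adjoint U)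
  then have "(diagmat w ** conj_by ?U W + conj_by ?U Y ** diagmat v) $ a $ b
      = (diagmat v ** conj_by ?U Y + conj_by ?U W ** diagmat w) $ a $ b" by simp
  then show "(v b - v a) *\<^sub>R (conj_by ?U Y $ a $ b) = (w b - w a) *\<^sub>R (conj_by ?U W $ a $ b)"
    by (simp add: mult_diagmat_nth diagmat_mult_nth scaleR_diff_left algebra_simps)
qed

section \<open>Tubes around an orbit\<close>

text \<open>
  As these intervals are disjoint, the eigenvalues of a matrix in a tube show which of them belongs to
  which eigenspace.
\<close>

definition eig_box :: "('n::finite \<Rightarrow> real) set" where
  "eig_box = {w. \<forall>a. - 2 * real (rank a) \<le> w a \<and> w a \<le> - 2 * real (rank a) + 1}"

lemma eig_box_inj:
  assumes "w \<in> eig_box" "w' \<in> eig_box" "w a = w' b"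
  shows "a = b"
proof (rule ccontr)
  have bounds: "- 2 * real (rank a) \<le> w a" "w a \<le> - 2 * real (rank a) + 1"
    "- 2 * real (rank b) \<le> w' b" "w' b \<le> - 2 * real (rank b) + 1"
    using assms(1,2) unfolding eig_box_def by blast+
  assume "a \<noteq> b"
  then consider "real (rank a) + 1 \<le> real (rank b)" | "real (rank b) + 1 \<le> real (rank a)"
    by (elim rank_neqE) linarith+
  then show False using bounds assms(3) by cases linarith+
qed

lemma inj_eig_box: "w \<in> eig_box \<Longrightarrow> inj w" by (intro injI) (rule eig_box_inj)

definition tube ::
    "('n::finite \<Rightarrow> real) \<Rightarrow> ('f::star_division_algebra^'n^'n) set \<Rightarrow> ('f^'n^'n) set" where
  "tube v E = (\<lambda>(X, w). reeigen v w X) ` (E \<times> eig_box)"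

text \<open>
  The polynomial with roots \<open>w\<close> vanishes at the common value, hence at the entries of \<open>w'\<close>, which gives \<open>w = w'\<close>
  as the intervals are disjoint. Changing the eigenvalues back to \<open>v\<close> then recovers \<open>X\<close>.
\<close>

lemma reeigen_inj:
  assumes v: "inj v" and X: "X \<in> unitary_orbit (diagmat v)" "X' \<in> unitary_orbit (diagmat v)"
    and w: "w \<in> eig_box" "w' \<in> eig_box" and eq: "reeigen v w X = reeigen v w' X'"
  shows "X = X' \<and> w = w'"
proof -
  obtain U where U: "U \<in> unitary_group" "X = conj_by U (diagmat v)" using X(1) by (rule orbitE)
  obtain U' where U': "U' \<in> unitary_group" "X' = conj_by U' (diagmat v)" using X(2) by (rule orbitE)
  have eq': "conj_by U (diagmat w) = conj_by U' (diagmat w')"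
    using eq unfolding U(2) U'(2) reeigen_conj_by[OF v U(1)] reeigen_conj_by[OF v U'(1)] .
  have "conj_by U' (lin_prod (eigs w) (diagmat w')) = lin_prod (eigs w) (conj_by U (diagmat w))"
    by (simp only: lin_prod_conj_by[OF U'(1)] eq')
  also have "\<dots> = 0"
    by (simp add: lin_prod_conj_by[OF U(1)] lin_prod_eigs_diagmat linear_0[OF linear_conj_by])
  finally have "conj_by (adjoint_matrix U') (conj_by U' (lin_prod (eigs w) (diagmat w')))
      = conj_by (adjoint_matrix U') 0" by (rule arg_cong)
  then have zero: "lin_prod (eigs w) (diagmat w' :: 'b^'a^'a) = 0"
    by (simp add: U'(1) linear_0[OF linear_conj_by])
  have ww: "w' a = w a" for a
  proof -
    have "(lin_prod (eigs w) (diagmat w' :: 'b^'a^'a)) $ a $ a = 0" using zero by simp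
    then have "(\<Prod>r\<leftarrow>eigs w. w' a - r) = 0" by (simp add: lin_prod_diagmat diagmat_nth)
    then obtain b where "w' a = w b" by (auto simp: prod_list_zero_iff)
    then show ?thesis using eig_box_inj[OF w(2,1)] by metis
  qed
  then have "w = w'" by auto
  moreover have "X = reeigen w v (conj_by U (diagmat w))" "X' = reeigen w' v (conj_by U' (diagmat w'))"
    unfolding U(2) U'(2) reeigen_conj_by[OF inj_eig_box[OF w(1)] U(1)]
      reeigen_conj_by[OF inj_eig_box[OF w(2)] U'(1)] by (rule refl)+
  ultimately show ?thesis using eq' by simp
qed

text \<open>
  The tube around the whole orbit consists of the hermitian matrices with eigenvalues in the box and
  therefore is the same for all orbits.
\<close>

lemma tube_orbit:
  assumes "inj v"
  shows "tube v (unitary_orbit (diagmat v)) = (\<lambda>(U, w). conj_by U (diagmat w)) ` (unitary_group \<times> eig_box)"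
proof -
  have "reeigen v w (conj_by U (diagmat v)) = conj_by U (diagmat w)" if "U \<in> unitary_group" for U w
    by (rule reeigen_conj_by[OF assms that])
  then show ?thesis unfolding tube_def unitary_orbit_eq by (force simp: image_iff)
qed

lemma hermitian_reeigen:
  assumes "inj v" "X \<in> unitary_orbit (diagmat v)"
  shows "hermitian (reeigen v w X)"
proof -
  obtain U where U: "U \<in> unitary_group" "X = conj_by U (diagmat v)" using assms(2) by (rule orbitE)
  show ?thesis
    unfolding U(2) reeigen_conj_by[OF assms(1) U(1)] by (intro hermitian_conj_by hermitian_diagmat)
qed

definition vandermonde :: "nat \<Rightarrow> ('n::finite \<Rightarrow> real) \<Rightarrow> real" where
  "vandermonde \<beta> w = (\<Prod>a\<in>UNIV. \<Prod>b\<in>{b. rank a < rank b}. w a - w b) ^ \<beta>"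

lemma vandermonde_nonzero: "inj w \<Longrightarrow> vandermonde \<beta> w \<noteq> 0" by (auto simp: vandermonde_def inj_eq)

section \<open>The Jacobian of the tube\<close>

lemma inner_diagmat: "diagmat v \<bullet> (diagmat w :: 'f::star_division_algebra^'n^'n) = (\<Sum>i\<in>UNIV. v i * w i)"
proof -
  have "(\<Sum>j\<in>UNIV. diagmat v $ i $ j \<bullet> (diagmat w :: 'f^'n^'n) $ i $ j) = v i * w i" for i
  proof -
    have "(\<Sum>j\<in>UNIV. diagmat v $ i $ j \<bullet> (diagmat w :: 'f^'n^'n) $ i $ j)
        = (\<Sum>j\<in>UNIV. if j = i then v i * w i else 0)"
      by (rule sum.cong) (auto simp: diagmat_nth of_real_def dot_square_norm)
    then show ?thesis by simp
  qed
  then show ?thesis by (simp add: inner_vec_def)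
qed

lemma inner_diagmat_zero:
  assumes "\<And>i. Z $ i $ i = 0"
  shows "diagmat v \<bullet> (Z :: 'f::star_division_algebra^'n^'n) = 0"
  unfolding inner_vec_def by (intro sum.neutral ballI) (simp add: diagmat_nth assms)

definition diag_unit :: "'n::finite \<Rightarrow> 'f::star_division_algebra^'n^'n" where
  "diag_unit a = diagmat (\<lambda>i. if i = a then 1 else 0)"

text \<open>
  The tangent vectors of the tube at \<open>reeigen v w X\<close> with \<open>X\<close> in the orbit of \<open>v\<close> are, in the
  eigenbasis, those of the orbit with the coordinate for the entry \<open>(a, b)\<close> multiplied by
  \<open>(w a - w b) / (v a - v b)\<close>, together with the diagonal units.
\<close>

lemma tube_jacobian:
  fixes W Y :: "nat \<Rightarrow> 'f::star_division_algebra^'n^'n" and \<tau> :: "'k::finite \<Rightarrow> nat"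
  defines "d \<equiv> orbit_dim TYPE('f^'n^'n)"
  assumes bij: "bij_betw \<tau> UNIV {..<d + CARD('n)}"
    and inj: "inj v" and U: "U \<in> unitary_group"
    and W: "\<And>k. k < d \<Longrightarrow> hermitian (W k)" "\<And>k i. k < d \<Longrightarrow> conj_by (adjoint_matrix U) (W k) $ i $ i = 0"
    and Y: "\<And>k. k < d \<Longrightarrow> hermitian (Y k)" "\<And>k i. k < d \<Longrightarrow> conj_by (adjoint_matrix U) (Y k) $ i $ i = 0"
    and YW: "\<And>k a b. k < d \<Longrightarrow> (v b - v a) *\<^sub>R (conj_by (adjoint_matrix U) (Y k) $ a $ b)
      = (w b - w a) *\<^sub>R (conj_by (adjoint_matrix U) (W k) $ a $ b)"
    and C: "\<And>k. k < d \<Longrightarrow> C k = Y k" "\<And>a. C (d + rank a) = conj_by U (diag_unit a)"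
  shows "\<bar>det (\<chi> i j. herm_coord (\<tau> i) (C (\<tau> j)) :: real^'k^'k)\<bar>
    = \<bar>vandermonde DIM('f) w\<bar> / \<bar>vandermonde DIM('f) v\<bar> * sqrt (det_upto d (\<lambda>i j. W i \<bullet> W j))"
proof -
  let ?n = "CARD('n)" and ?T = "TYPE('f^'n^'n)" and ?U = "adjoint_matrix U"
  have split: "\<exists>a :: 'n. k = d + rank a" if "d \<le> k" "k < d + ?n" for k
  proof -
    have "k - d \<in> {..<?n}" using that by auto
    then obtain a :: 'n where "k - d = rank a"
      using bij_betw_imp_surj_on[OF bij_betw_rank[where 'n='n]] by (metis imageE)
    then show ?thesis using that(1) by (intro exI[of _ a]) simp
  qed
  define Z where "Z k = (if k < d then conj_by ?U (W k) else diag_unit (inv rank (k - d)))" for k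
  have Z: "Z k = conj_by ?U (W k)" if "k < d" for k using that by (simp add: Z_def)
  have Zd: "Z (d + rank a) = diag_unit a" for a by (simp add: Z_def inv_f_f[OF inj_rank])
  define C' where "C' k = conj_by ?U (C k)" for k
  have C': "C' k = conj_by ?U (Y k)" if "k < d" for k using that by (simp add: C'_def C)
  have C'd: "C' (d + rank a) = diag_unit a" for a by (simp add: C'_def C U)
  have hermC: "hermitian (C k)" if k: "k < d + ?n" for k
  proof (cases "k < d")
    case False
    then obtain a :: 'n where "k = d + rank a" using split[of k] k by (meson linorder_not_less)
    then show ?thesis by (simp add: C(2) diag_unit_def hermitian_conj_by hermitian_diagmat)
  qed (simp add: C Y)
  have hermC': "hermitian (C' k)" if "k < d + ?n" for k
    unfolding C'_def by (rule hermitian_conj_by[OF hermC[OF that]])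
  have hermZ: "hermitian (Z k)" if "k < d + ?n" for k
    by (simp add: Z_def hermitian_conj_by W diag_unit_def hermitian_diagmat)
  define R where "R k = (if k < d then (w (orow ?T k) - w (ocol ?T k)) / (v (orow ?T k) - v (ocol ?T k)) else 1)" for k
  have coord: "herm_coord k (C' l) = R k * herm_coord k (Z l)" if "k < d + ?n" "l < d + ?n" for k l
  proof (cases "l < d")
    case l: True
    show ?thesis
    proof (cases "k < d")
      case k: True
      let ?a = "orow ?T k" and ?b = "ocol ?T k"
      have "v ?a \<noteq> v ?b" using oidx_less(1)[of k ?T] k inj by (auto simp: d_def inj_eq)
      moreover have "(v ?b - v ?a) * (C' l $ ?a $ ?b \<bullet> ounit ?T k) = (w ?b - w ?a) * (Z l $ ?a $ ?b \<bullet> ounit ?T k)"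
        unfolding C'[OF l] Z[OF l] inner_scaleR_left[symmetric] YW[OF l] ..
      ultimately have "C' l $ ?a $ ?b \<bullet> ounit ?T k = R k * (Z l $ ?a $ ?b \<bullet> ounit ?T k)"
        using k by (simp add: R_def field_simps)
      then show ?thesis using k by (simp add: herm_coord_offdiag d_def)
    next
      case False
      then obtain a :: 'n where "k = d + rank a"
        using split[of k] \<open>k < d + ?n\<close> by (meson linorder_not_less)
      then show ?thesis
        by (simp add: d_def herm_coord_diag) (simp add: C'[OF l] Z[OF l] Y(2)[OF l] W(2)[OF l] flip: d_def)
    qed
  next
    case False
    then obtain a :: 'n where l: "l = d + rank a"
      using split[of l] \<open>l < d + ?n\<close> by (meson linorder_not_less)
    have same: "C' l = Z l" by (simp add: l C'd Zd)
    show ?thesis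
    proof (cases "k < d")
      case True
      then have "herm_coord k (Z l) = 0"
        unfolding l Zd diag_unit_def unfolding d_def by (rule herm_coord_diagmat)
      then show ?thesis by (simp add: same)
    qed (simp add: same R_def)
  qed
  have \<tau>: "\<tau> i < d + ?n" for i using bij by (auto simp: bij_betw_def)
  let ?M = "\<lambda>Q. (\<chi> i j. herm_coord (\<tau> i) (Q (\<tau> j) :: 'f^'n^'n)) :: real^'k^'k"
  have "(\<Prod>i\<in>UNIV. R (\<tau> i)) = (\<Prod>k<d + ?n. R k)" by (rule prod.reindex_bij_betw[OF bij])
  also have "\<dots> = (\<Prod>k<d. R k)" by (rule prod.mono_neutral_right) (auto simp: R_def)
  also have "\<dots> = (\<Prod>k<d. (\<lambda>a b. (w a - w b) / (v a - v b)) (orow ?T k) (ocol ?T k))"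
    by (rule prod.cong) (auto simp: R_def)
  also have "\<dots> = vandermonde DIM('f) w / vandermonde DIM('f) v"
    using prod_oidx[where 'f = 'f and g = "\<lambda>a b. w a - w b"] prod_oidx[where 'f = 'f and g = "\<lambda>a b. v a - v b"]
    by (simp add: d_def vandermonde_def prod_dividef)
  finally have R: "(\<Prod>i\<in>UNIV. R (\<tau> i)) = vandermonde DIM('f) w / vandermonde DIM('f) v" .
  \<comment> \<open>Squares of determinants are Gram determinants, which do not see the conjugation by \<open>U\<close>.\<close>
  have "(det (?M C))\<^sup>2 = det_upto (d + ?n) (\<lambda>i j. C i \<bullet> C j)"
    unfolding d_def by (rule det_herm_coord_square) (use bij hermC in \<open>simp_all add: d_def\<close>)
  also have "\<dots> = det_upto (d + ?n) (\<lambda>i j. C' i \<bullet> C' j)"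
    by (simp add: C'_def inner_conj_by unitary_adjoint U)
  also have "\<dots> = (det (?M C'))\<^sup>2"
    unfolding d_def by (rule det_herm_coord_square[symmetric]) (use bij hermC' in \<open>simp_all add: d_def\<close>)
  also have "?M C' = (\<chi> i. R (\<tau> i) *s (\<chi> j. herm_coord (\<tau> i) (Z (\<tau> j))))"
    by (simp add: vec_eq_iff coord \<tau>)
  also have "det \<dots> = vandermonde DIM('f) w / vandermonde DIM('f) v * det (?M Z)"
    unfolding det_rows_mul R ..
  also have "(vandermonde DIM('f) w / vandermonde DIM('f) v * det (?M Z))\<^sup>2
      = (vandermonde DIM('f) w / vandermonde DIM('f) v)\<^sup>2 * (det (?M Z))\<^sup>2"
    by (rule power_mult_distrib)
  also have "(det (?M Z))\<^sup>2 = det_upto (d + ?n) (\<lambda>i j. Z i \<bullet> Z j)"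
    unfolding d_def by (rule det_herm_coord_square) (use bij hermZ in \<open>simp_all add: d_def\<close>)
  also have "\<dots> = det_upto d (\<lambda>i j. W i \<bullet> W j)"
  proof (rule det_upto_extend)
    show "Z i \<bullet> Z j = W i \<bullet> W j" if "i < d" "j < d" for i j
      using that by (simp add: Z inner_conj_by unitary_adjoint U)
    fix i j assume ij: "d \<le> i" "i < d + ?n" "j < d + ?n"
    obtain a :: 'n where a: "i = d + rank a" using split[OF ij(1,2)] by blast
    show "Z i \<bullet> Z j = (if i = j then 1 else 0)"
    proof (cases "j < d")
      case True
      then show ?thesis using ij(1) by (simp add: a Zd Z diag_unit_def inner_diagmat_zero W(2))
    next
      case False
      then obtain b :: 'n where b: "j = d + rank b"
        using split[of j] ij(3) by (meson linorder_not_less)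
      have "(\<Sum>k\<in>UNIV. (if k = a then 1 else 0) * (if k = b then 1 else 0 :: real)) = (if a = b then 1 else 0)"
        by (simp add: mult_delta_left)
      then show ?thesis by (simp add: a b Zd diag_unit_def inner_diagmat inj_eq[OF inj_rank])
    qed
  qed
  finally have "sqrt ((det (?M C))\<^sup>2) = sqrt ((vandermonde DIM('f) w / vandermonde DIM('f) v)\<^sup>2
      * det_upto d (\<lambda>i j. W i \<bullet> W j))" by (rule arg_cong)
  then show ?thesis by (simp add: real_sqrt_mult)
qed

section \<open>The volume of a tube over a chart\<close>

text \<open>
  Points of a tube have \<open>d\<close> coordinates from a chart of the orbit, followed by their
  eigenvalues.
\<close>

definition tail_eigs :: "nat \<Rightarrow> (nat \<Rightarrow> real) \<Rightarrow> 'n::finite \<Rightarrow> real" where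
  "tail_eigs d x = (\<lambda>a. x (d + rank a))"

definition vec_of :: "('k::finite \<Rightarrow> nat) \<Rightarrow> (nat \<Rightarrow> real) \<Rightarrow> real^'k" where
  "vec_of \<tau> x = (\<chi> i. x (\<tau> i))"

definition fun_of :: "('k::finite \<Rightarrow> nat) \<Rightarrow> real^'k \<Rightarrow> nat \<Rightarrow> real" where
  "fun_of \<tau> z = (\<lambda>j. z $ inv \<tau> j)"

definition herm_vec :: "('k::finite \<Rightarrow> nat) \<Rightarrow> 'f::star_division_algebra^'n^'n \<Rightarrow> real^'k" where
  "herm_vec \<tau> X = (\<chi> i. herm_coord (\<tau> i) X)"

lemma bounded_linear_herm_vec: "bounded_linear (herm_vec \<tau>)"
  unfolding linear_conv_bounded_linear[symmetric] by (intro linearI)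
    (simp_all add: herm_vec_def vec_eq_iff linear_add[OF linear_herm_coord] linear_cmul[OF linear_herm_coord])

lemma herm_vec_inj:
  fixes X Y :: "'f::star_division_algebra^'n^'n" and \<tau> :: "'k::finite \<Rightarrow> nat"
  assumes bij: "bij_betw \<tau> UNIV {..<orbit_dim TYPE('f^'n^'n) + CARD('n)}"
    and herm: "hermitian X" "hermitian Y" and eq: "herm_vec \<tau> X = herm_vec \<tau> Y"
  shows "X = Y"
proof -
  have "X - Y = 0"
  proof (rule hermitian_eq_0I)
    show "hermitian (X - Y)" using subspace_diff[OF subspace_hermitian, of X Y] herm by simp
    fix k assume "k < orbit_dim TYPE('f^'n^'n) + CARD('n)"
    then obtain i where "k = \<tau> i" using bij_betw_imp_surj_on[OF bij] by (metis imageE lessThan_iff)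
    moreover have "herm_vec \<tau> X $ i = herm_vec \<tau> Y $ i" by (simp only: eq)
    ultimately show "herm_coord k (X - Y) = 0"
      by (simp add: herm_vec_def linear_diff[OF linear_herm_coord])
  qed
  then show ?thesis by simp
qed

lemma emeasure_differentiable_image:
  fixes g :: "real^'k::{finite,wellorder} \<Rightarrow> real^'k::_"
  assumes S: "S \<in> sets borel" and der: "\<And>x. x \<in> S \<Longrightarrow> (g has_derivative g' x) (at x)"
    and inj: "inj_on g S" and gS: "g ` S \<in> sets borel" "bounded (g ` S)"
  shows "emeasure lborel (g ` S) = (\<integral>\<^sup>+x. ennreal \<bar>det (matrix (g' x))\<bar> * indicator S x \<partial>lborel)"
proof -
  have lm: "g ` S \<in> lmeasurable" using gS by (intro bounded_set_imp_lmeasurable) auto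
  have "((\<lambda>x. \<bar>det (matrix (g' x))\<bar>) has_integral measure lebesgue (g ` S)) S"
  proof (rule has_measure_differentiable_image[THEN iffD1])
    show "S \<in> sets lebesgue" using S by simp
    show "(g has_derivative g' x) (at x within S)" if "x \<in> S" for x
      using der[OF that] by (rule has_derivative_at_withinI)
  qed (use inj lm in auto)
  from nn_integral_has_integral_lebesgue'[OF _ this]
  have "(\<integral>\<^sup>+x. ennreal \<bar>det (matrix (g' x))\<bar> * indicator S x \<partial>lborel) = ennreal (measure lebesgue (g ` S))"
    by simp
  also have "\<dots> = emeasure lebesgue (g ` S)" using lm by (simp add: emeasure_eq_measure2)
  also have "\<dots> = emeasure lborel (g ` S)" using gS(1) by simp
  finally show ?thesis ..
qed

definition box_integral :: "nat \<Rightarrow> nat \<Rightarrow> ('n::finite) itself \<Rightarrow> ennreal" where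
  "box_integral d \<beta> _ = (\<integral>\<^sup>+y. ennreal \<bar>vandermonde \<beta> (tail_eigs d y :: 'n \<Rightarrow> real)\<bar>
      * indicator eig_box (tail_eigs d y :: 'n \<Rightarrow> real) \<partial>PiM {d..<d + CARD('n)} (\<lambda>_. lborel))"

lemma measurable_tail_eigs:
  fixes f :: "'a \<Rightarrow> nat \<Rightarrow> real"
  assumes "\<And>a :: 'n::finite. (\<lambda>x. f x (d + rank a)) \<in> borel_measurable M"
  shows "(\<lambda>x. ennreal \<bar>vandermonde \<beta> (tail_eigs d (f x) :: 'n \<Rightarrow> real)\<bar>
      * indicator eig_box (tail_eigs d (f x) :: 'n \<Rightarrow> real)) \<in> borel_measurable M"
    "(\<lambda>x. indicator eig_box (tail_eigs d (f x) :: 'n \<Rightarrow> real) :: ennreal) \<in> borel_measurable M"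
proof -
  note assms [measurable]
  have "Measurable.pred M (\<lambda>x. \<forall>a :: 'n. - 2 * real (rank a) \<le> f x (d + rank a) \<and> f x (d + rank a) \<le> - 2 * real (rank a) + 1)"
    by measurable
  then have "{x \<in> space M. (tail_eigs d (f x) :: 'n \<Rightarrow> real) \<in> eig_box} \<in> sets M"
    by (simp add: eig_box_def tail_eigs_def pred_def)
  then have "(\<lambda>x. indicator {x \<in> space M. (tail_eigs d (f x) :: 'n \<Rightarrow> real) \<in> eig_box} x :: ennreal) \<in> borel_measurable M"
    by (rule borel_measurable_indicator)
  then show 1: "(\<lambda>x. indicator eig_box (tail_eigs d (f x) :: 'n \<Rightarrow> real) :: ennreal) \<in> borel_measurable M"
    by (rule measurable_cong[THEN iffD1, rotated]) (simp add: indicator_def)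
  have "(\<lambda>x. vandermonde \<beta> (tail_eigs d (f x) :: 'n \<Rightarrow> real)) \<in> borel_measurable M"
    unfolding vandermonde_def tail_eigs_def
    by (intro borel_measurable_power borel_measurable_prod borel_measurable_diff assms)
  then have "(\<lambda>x. ennreal \<bar>vandermonde \<beta> (tail_eigs d (f x) :: 'n \<Rightarrow> real)\<bar>) \<in> borel_measurable M"
    by (intro measurable_compose[OF _ measurable_ennreal] borel_measurable_abs)
  from borel_measurable_times_ennreal[OF this 1]
  show "(\<lambda>x. ennreal \<bar>vandermonde \<beta> (tail_eigs d (f x) :: 'n \<Rightarrow> real)\<bar>
      * indicator eig_box (tail_eigs d (f x) :: 'n \<Rightarrow> real)) \<in> borel_measurable M" .
qed

lemma measurable_tail_component:
  "(\<lambda>y. y (d + rank a)) \<in> borel_measurable (PiM {d..<d + CARD('n)} (\<lambda>_. lborel :: real measure))"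
  for a :: "'n::finite"
  using measurable_component_singleton[of "d + rank a" "{d..<d + CARD('n)}" "\<lambda>_. lborel :: real measure"]
  by (simp add: rank_less)

text \<open>
  On the box the Vandermonde product lies between 1, as neighbouring eigenvalues are at least 1 apart,
  and a constant; the box has volume 1.
\<close>

lemma box_integral_bounds:
  "0 < box_integral d \<beta> TYPE('n::finite)" "box_integral d \<beta> TYPE('n) < \<infinity>"
proof -
  let ?M = "PiM {d..<d + CARD('n)} (\<lambda>_. lborel :: real measure)"
  interpret product_sigma_finite "\<lambda>_::nat. lborel :: real measure" by standard
  define lo where "lo j = - 2 * real (j - d)" for j
  define B where "B = Pi\<^sub>E {d..<d + CARD('n)} (\<lambda>j. {lo j..lo j + 1})"
  define h where "h y = ennreal \<bar>vandermonde \<beta> (tail_eigs d y :: 'n \<Rightarrow> real)\<bar>" for y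
  define C where "C = (\<Prod>a\<in>(UNIV :: 'n set). \<Prod>b\<in>{b :: 'n. rank a < rank b}. 2 * real CARD('n) + 1) ^ \<beta>"
  have B_sets: "B \<in> sets ?M" unfolding B_def by (rule sets_PiM_I_finite; simp)
  have B_vol: "emeasure ?M B = 1"
    unfolding B_def by (subst emeasure_PiM) (simp_all add: prod_ennreal)
  have B_iff: "(tail_eigs d y :: 'n \<Rightarrow> real) \<in> eig_box \<longleftrightarrow> y \<in> B" if y: "y \<in> space ?M" for y
  proof -
    have "(tail_eigs d y :: 'n \<Rightarrow> real) \<in> eig_box \<longleftrightarrow>
        (\<forall>i\<in>range (rank :: 'n \<Rightarrow> nat). y (d + i) \<in> {lo (d + i)..lo (d + i) + 1})"
      by (simp add: eig_box_def tail_eigs_def lo_def)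
    also have "\<dots> \<longleftrightarrow> (\<forall>j\<in>{d..<d + CARD('n)}. y j \<in> {lo j..lo j + 1})"
    proof -
      have "{d..<d + CARD('n)} = (+) d ` range (rank :: 'n \<Rightarrow> nat)"
        by (simp add: bij_betw_imp_surj_on[OF bij_betw_rank] add.commute flip: atLeast0LessThan)
      then show ?thesis by simp
    qed
    also have "\<dots> \<longleftrightarrow> y \<in> B" using y by (auto simp: B_def space_PiM PiE_def Pi_def)
    finally show ?thesis .
  qed
  have gaps: "w a - w b \<ge> 1" "w a - w b \<le> 2 * real CARD('n) + 1"
    if w: "w \<in> eig_box" and "rank a < rank b" for w and a b :: 'n
  proof -
    have "- 2 * real (rank a) \<le> w a \<and> w a \<le> - 2 * real (rank a) + 1"
      "- 2 * real (rank b) \<le> w b \<and> w b \<le> - 2 * real (rank b) + 1"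
      using w unfolding eig_box_def by blast+
    moreover have "real (rank a) + 1 \<le> real (rank b)" "real (rank b) \<le> real CARD('n)"
      using \<open>rank a < rank b\<close> rank_less[of b] by simp_all
    ultimately show "w a - w b \<ge> 1" "w a - w b \<le> 2 * real CARD('n) + 1" by linarith+
  qed
  have vd: "1 \<le> vandermonde \<beta> w" "vandermonde \<beta> w \<le> C" if "w \<in> eig_box" for w :: "'n \<Rightarrow> real"
  proof -
    show "1 \<le> vandermonde \<beta> w"
      unfolding vandermonde_def using gaps(1)[OF that] by (intro one_le_power prod_ge_1) auto
    have ge0: "0 \<le> w a - w b" if "rank a < rank b" for a b
      using gaps(1)[OF \<open>w \<in> eig_box\<close> that] by linarith
    show "vandermonde \<beta> w \<le> C"
      unfolding vandermonde_def C_def using gaps(2)[OF that] ge0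
      by (intro power_mono prod_mono conjI prod_nonneg) auto
  qed
  have integral: "box_integral d \<beta> TYPE('n) = (\<integral>\<^sup>+y\<in>B. h y \<partial>?M)"
    unfolding box_integral_def h_def by (intro nn_integral_cong) (simp add: indicator_def B_iff)
  have h: "1 \<le> h y" "h y \<le> ennreal C" if "y \<in> space ?M" "y \<in> B" for y
    using vd[of "tail_eigs d y"] B_iff[OF that(1)] that(2)
    by (auto simp: h_def ennreal_leI simp flip: ennreal_1)
  have "1 = (\<integral>\<^sup>+y. indicator B y \<partial>?M)" using B_vol B_sets by simp
  also have "\<dots> \<le> (\<integral>\<^sup>+y\<in>B. h y \<partial>?M)" by (intro nn_integral_mono) (simp add: indicator_def h(1))
  finally show "0 < box_integral d \<beta> TYPE('n)"
    unfolding integral by (metis less_le_trans zero_less_one)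
  have "(\<integral>\<^sup>+y\<in>B. h y \<partial>?M) \<le> (\<integral>\<^sup>+y\<in>B. ennreal C \<partial>?M)"
    by (intro nn_integral_mono) (simp add: indicator_def h(2))
  also have "\<dots> = ennreal C" by (simp add: nn_integral_cmult_indicator[OF B_sets] B_vol)
  finally show "box_integral d \<beta> TYPE('n) < \<infinity>" unfolding integral by (rule le_less_trans) simp
qed

lemma continuous_on_reeigen:
  assumes "\<And>a. continuous_on S (\<lambda>x. w x a)" "continuous_on S f"
  shows "continuous_on S (\<lambda>x. reeigen v (w x) (f x))"
  unfolding reeigen_def
  by (intro continuous_on_sum continuous_on_scaleR assms continuous_on_spectral_proj)

definition eig_cbox :: "(real^'n::finite) set" where
  "eig_cbox = cbox (\<chi> a. - 2 * real (rank a)) (\<chi> a. - 2 * real (rank a) + 1)"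

lemma eig_cbox_iff: "y \<in> eig_cbox \<longleftrightarrow> (\<lambda>a. y $ a) \<in> eig_box"
  by (simp add: eig_cbox_def eig_box_def mem_box_cart)

lemma tube_eq_cbox:
  fixes E :: "('f::star_division_algebra^'n^'n) set"
  shows "tube v E = (\<lambda>(X, y). reeigen v (\<lambda>a. y $ a) X) ` (E \<times> eig_cbox)"
    (is "_ = ?R")
proof
  show "tube v E \<subseteq> ?R"
  proof
    fix Z assume "Z \<in> tube v E"
    then obtain X w where X: "X \<in> E" "w \<in> eig_box" "Z = reeigen v w X" unfolding tube_def by auto
    have "(\<chi> a. w a) \<in> eig_cbox" using X(2) by (simp add: eig_cbox_iff)
    moreover have "($) (\<chi> a. w a) = w" by (simp add: fun_eq_iff)
    ultimately show "Z \<in> ?R" using X by (intro image_eqI[of _ _ "(X, \<chi> a. w a)"]) simp_all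
  qed
  show "?R \<subseteq> tube v E"
  proof
    fix Z assume "Z \<in> ?R"
    then obtain X y where X: "X \<in> E" "y \<in> eig_cbox" "Z = reeigen v (\<lambda>a. y $ a) X" by auto
    then show "Z \<in> tube v E"
      unfolding tube_def by (intro image_eqI[of _ _ "(X, \<lambda>a. y $ a)"]) (simp_all add: eig_cbox_iff)
  qed
qed

lemma compact_herm_vec_tube: "compact (herm_vec \<tau> ` tube v (unitary_orbit S))"
proof -
  have "compact ((\<lambda>(X, y). reeigen v (\<lambda>a. y $ a) X) ` (unitary_orbit S \<times> eig_cbox))"
    unfolding case_prod_beta
    by (intro compact_continuous_image continuous_on_reeigen compact_Times compact_unitary_orbit
        continuous_intros) (simp add: eig_cbox_def compact_cbox)
  then show ?thesis
    unfolding tube_eq_cbox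
    by (rule compact_continuous_image[rotated]) (rule linear_continuous_on[OF bounded_linear_herm_vec])
qed

lemma volume_density_measurable:
  fixes \<phi> :: "_ \<Rightarrow> 'f::star_division_algebra^'n^'n"
  assumes lp: "local_parametrization d M U \<phi>" and A: "A \<in> sets (coord_lebesgue d)" "A \<subseteq> U"
  shows "(\<lambda>x. ennreal (volume_density frobenius d \<phi> x) * indicator A x) \<in> borel_measurable (coord_lebesgue d)"
proof -
  have U: "openin (coord_space d) U" "U \<in> sets (coord_lebesgue d)"
    using lp local_parametrization_measurable(1)[OF lp] unfolding local_parametrization_def by blast+
  have C1: "C1_on_coords d U \<phi>" using lp unfolding local_parametrization_def by blast
  have "partial_deriv i \<phi> \<in> borel_measurable (restrict_space (coord_lebesgue d) U)" if "i < d" for i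
    by (rule continuous_map_coord_space_measurable[OF U(1)])
      (use C1 that in \<open>simp add: C1_on_coords_def\<close>)
  moreover have perm: "p i < d" if "p permutes {..<d}" "i < d" for p i
    using permutes_in_image[OF that(1), of i] that(2) by simp
  ultimately have "(\<lambda>x. volume_density frobenius d \<phi> x) \<in> borel_measurable (restrict_space (coord_lebesgue d) U)"
    unfolding volume_density_def det_upto_def frobenius_eq_inner
    by (intro measurable_compose[OF _ borel_measurable_sqrt] borel_measurable_sum borel_measurable_times borel_measurable_prod
        borel_measurable_inner borel_measurable_const) (auto intro: perm)
  then have "(\<lambda>x. ennreal (volume_density frobenius d \<phi> x)) \<in> borel_measurable (restrict_space (coord_lebesgue d) U)"
    by (rule measurable_compose[OF _ measurable_ennreal])
  then have "(\<lambda>x. ennreal (volume_density frobenius d \<phi> x) * indicator U x) \<in> borel_measurable (coord_lebesgue d)"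
    using U(2) by (subst (asm) borel_measurable_restrict_space_iff_ennreal) (auto intro: sets.Int_space_eq2)
  from borel_measurable_times_ennreal[OF this borel_measurable_indicator[OF A(1)]]
  have "(\<lambda>x. (ennreal (volume_density frobenius d \<phi> x) * indicator U x) * indicator A x)
      \<in> borel_measurable (coord_lebesgue d)" .
  moreover have "(\<lambda>x. (ennreal (volume_density frobenius d \<phi> x) * indicator U x) * indicator A x)
      = (\<lambda>x. ennreal (volume_density frobenius d \<phi> x) * indicator A x)"
    using A(2) by (auto simp: fun_eq_iff indicator_def)
  ultimately show ?thesis by simp
qed

lemma fun_of_vec_of:
  assumes "bij_betw \<tau> UNIV {..<N}" "j < N"
  shows "fun_of \<tau> (vec_of \<tau> x) j = x j"
proof -
  obtain i where "j = \<tau> i"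
    using bij_betw_imp_surj_on[OF assms(1)] assms(2) by (metis imageE lessThan_iff)
  then show ?thesis using bij_betw_imp_inj_on[OF assms(1)] by (simp add: fun_of_def vec_of_def)
qed

lemma vec_of_fun_of:
  assumes "bij_betw \<tau> UNIV {..<N}"
  shows "vec_of \<tau> (fun_of \<tau> z) = z"
  using bij_betw_imp_inj_on[OF assms] by (simp add: fun_of_def vec_of_def vec_eq_iff)

lemma vec_of_cong:
  assumes "bij_betw \<tau> UNIV {..<N}" "\<And>j. j < N \<Longrightarrow> x j = y j"
  shows "vec_of \<tau> x = vec_of \<tau> y" using assms by (auto simp: vec_of_def vec_eq_iff bij_betw_def)

text \<open>Tonelli's theorem for the two groups of coordinates.\<close>

lemma nn_integral_chart_eigs:
  fixes \<tau> :: "'k::finite \<Rightarrow> nat" and h :: "('n::finite \<Rightarrow> real) \<Rightarrow> ennreal"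
  assumes bij: "bij_betw \<tau> UNIV {..<d + CARD('n)}"
    and f: "f \<in> borel_measurable (coord_lebesgue d)"
    and h: "(\<lambda>y. h (tail_eigs d y)) \<in> borel_measurable (PiM {d..<d + CARD('n)} (\<lambda>_. lborel))"
  shows "(\<lambda>z. f (restrict (fun_of \<tau> z) {..<d}) * h (tail_eigs d (fun_of \<tau> z))) \<in> borel_measurable borel"
    and "(\<integral>\<^sup>+z. f (restrict (fun_of \<tau> z) {..<d}) * h (tail_eigs d (fun_of \<tau> z)) \<partial>lborel)
      = (\<integral>\<^sup>+x. f x \<partial>coord_lebesgue d) * (\<integral>\<^sup>+y. h (tail_eigs d y) \<partial>PiM {d..<d + CARD('n)} (\<lambda>_. lborel))"
proof -
  let ?N = "d + CARD('n)" and ?F = "\<lambda>z. f (restrict (fun_of \<tau> z) {..<d}) * h (tail_eigs d (fun_of \<tau> z))"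
  let ?I = "{..<d}" and ?J = "{d..<d + CARD('n)}"
  interpret product_sigma_finite "\<lambda>_::nat. lborel :: real measure" by standard
  have comp: "(\<lambda>z. fun_of \<tau> z j) \<in> borel_measurable borel" for j
    unfolding fun_of_def
    by (intro borel_measurable_continuous_onI continuous_on_component continuous_on_id)
  have res: "(\<lambda>z. restrict (fun_of \<tau> z) ?I) \<in> borel \<rightarrow>\<^sub>M coord_lebesgue d"
    unfolding coord_lebesgue_def by (rule measurable_restrict) (simp add: comp)
  have tail_restrict: "tail_eigs d (restrict x ?J) = (tail_eigs d x :: 'n \<Rightarrow> real)" for x
    by (simp add: tail_eigs_def rank_less)
  have "(\<lambda>z. restrict (fun_of \<tau> z) ?J) \<in> borel \<rightarrow>\<^sub>M PiM ?J (\<lambda>_. lborel)"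
    by (rule measurable_restrict) (simp add: comp)
  from measurable_compose[OF this h]
  have tl: "(\<lambda>z. h (tail_eigs d (fun_of \<tau> z))) \<in> borel_measurable borel"
    by (simp add: tail_restrict)
  show F: "?F \<in> borel_measurable borel"
    by (rule borel_measurable_times_ennreal[OF measurable_compose[OF res f] tl])
  have vec: "vec_of \<tau> \<in> borel_measurable (PiM {..<?N} (\<lambda>_. lborel))"
    using lborel_eq_distr_PiM(2)[OF bij] by (simp add: vec_of_def[abs_def])
  have "(\<integral>\<^sup>+z. ?F z \<partial>lborel) = (\<integral>\<^sup>+z. ?F z \<partial>distr (PiM {..<?N} (\<lambda>_. lborel)) borel (vec_of \<tau>))"
    using lborel_eq_distr_PiM(1)[OF bij] by (simp add: vec_of_def[abs_def])
  also have "\<dots> = (\<integral>\<^sup>+x. ?F (vec_of \<tau> x) \<partial>PiM {..<?N} (\<lambda>_. lborel))"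
    by (rule nn_integral_distr[OF vec]) (simp add: F)
  also have "\<dots> = (\<integral>\<^sup>+x. f (restrict x ?I) * h (tail_eigs d x) \<partial>PiM {..<?N} (\<lambda>_. lborel))"
  proof (rule nn_integral_cong)
    fix x
    have "restrict (fun_of \<tau> (vec_of \<tau> x)) ?I = restrict x ?I"
      by (rule restrict_ext) (simp add: fun_of_vec_of[OF bij])
    moreover have "tail_eigs d (fun_of \<tau> (vec_of \<tau> x)) = (tail_eigs d x :: 'n \<Rightarrow> real)"
      by (simp add: tail_eigs_def fun_eq_iff fun_of_vec_of[OF bij] rank_less)
    ultimately show "?F (vec_of \<tau> x) = f (restrict x ?I) * h (tail_eigs d x)" by simp
  qed
  also have "{..<?N} = ?I \<union> ?J" by auto
  also have "(\<integral>\<^sup>+x. f (restrict x ?I) * h (tail_eigs d x) \<partial>PiM (?I \<union> ?J) (\<lambda>_. lborel))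
      = (\<integral>\<^sup>+x. \<integral>\<^sup>+y. f (restrict (merge ?I ?J (x, y)) ?I) * h (tail_eigs d (merge ?I ?J (x, y)))
          \<partial>PiM ?J (\<lambda>_. lborel) \<partial>PiM ?I (\<lambda>_. lborel))"
  proof (rule product_nn_integral_fold)
    have "(\<lambda>x. restrict x ?I) \<in> PiM (?I \<union> ?J) (\<lambda>_. lborel) \<rightarrow>\<^sub>M coord_lebesgue d"
      unfolding coord_lebesgue_def by (rule measurable_restrict_subset) simp
    moreover have "(\<lambda>x. h (tail_eigs d (restrict x ?J))) \<in> borel_measurable (PiM (?I \<union> ?J) (\<lambda>_. lborel))"
      by (rule measurable_compose[OF measurable_restrict_subset h]) simp
    ultimately show "(\<lambda>x. f (restrict x ?I) * h (tail_eigs d x)) \<in> borel_measurable (PiM (?I \<union> ?J) (\<lambda>_. lborel))"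
      unfolding tail_restrict by (intro borel_measurable_times_ennreal measurable_compose[OF _ f])
  qed auto
  also have "\<dots> = (\<integral>\<^sup>+x. \<integral>\<^sup>+y. f x * h (tail_eigs d y) \<partial>PiM ?J (\<lambda>_. lborel) \<partial>PiM ?I (\<lambda>_. lborel))"
  proof (intro nn_integral_cong)
    fix x y :: "nat \<Rightarrow> real" assume "x \<in> space (PiM ?I (\<lambda>_. lborel))"
    then have "restrict (merge ?I ?J (x, y)) ?I = x"
      by (auto simp: space_PiM PiE_def extensional_def fun_eq_iff merge_def)
    moreover have "tail_eigs d (merge ?I ?J (x, y)) = (tail_eigs d y :: 'n \<Rightarrow> real)"
      by (simp add: tail_eigs_def merge_def rank_less)
    ultimately show "f (restrict (merge ?I ?J (x, y)) ?I) * h (tail_eigs d (merge ?I ?J (x, y)))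
        = f x * h (tail_eigs d y)" by simp
  qed
  also have "\<dots> = (\<integral>\<^sup>+x. f x * (\<integral>\<^sup>+y. h (tail_eigs d y) \<partial>PiM ?J (\<lambda>_. lborel)) \<partial>PiM ?I (\<lambda>_. lborel))"
    by (intro nn_integral_cong nn_integral_cmult h)
  also have "\<dots> = (\<integral>\<^sup>+x. f x \<partial>coord_lebesgue d) * (\<integral>\<^sup>+y. h (tail_eigs d y) \<partial>PiM ?J (\<lambda>_. lborel))"
    unfolding coord_lebesgue_def[symmetric] by (rule nn_integral_multc[OF f])
  finally show "(\<integral>\<^sup>+z. ?F z \<partial>lborel)
      = (\<integral>\<^sup>+x. f x \<partial>coord_lebesgue d) * (\<integral>\<^sup>+y. h (tail_eigs d y) \<partial>PiM ?J (\<lambda>_. lborel))" .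
qed

text \<open>
  The change of variables. The map from chart coordinates and eigenvalues to the tube is injective, and
  its Jacobian is the density of the chart times a ratio of Vandermonde products.
\<close>

lemma tube_volume:
  fixes v :: "'n::finite \<Rightarrow> real" and \<phi> :: "(nat \<Rightarrow> real) \<Rightarrow> 'f::star_division_algebra^'n^'n"
    and \<tau> :: "'k::{finite,wellorder} \<Rightarrow> nat"
  defines "d \<equiv> orbit_dim TYPE('f^'n^'n)" and "M \<equiv> unitary_orbit (diagmat v :: 'f^'n^'n)"
  assumes bij: "bij_betw \<tau> UNIV {..<d + CARD('n)}" and v: "inj v"
    and lp: "local_parametrization d M U \<phi>"
    and A: "A \<in> sets (coord_lebesgue d)" "A \<subseteq> U"
    and meas: "herm_vec \<tau> ` tube v (\<phi> ` A) \<in> sets borel"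
  shows "emeasure lborel (herm_vec \<tau> ` tube v (\<phi> ` A)) * ennreal \<bar>vandermonde DIM('f) v\<bar>
    = (\<integral>\<^sup>+x\<in>A. ennreal (volume_density frobenius d \<phi> x) \<partial>coord_lebesgue d)
      * box_integral d DIM('f) TYPE('n)"
proof -
  let ?N = "d + CARD('n)" and ?\<beta> = "DIM('f)"
  have U: "openin (coord_space d) U" "C1_on_coords d U \<phi>" "openin (top_of_set M) (\<phi> ` U)"
    "homeomorphic_map (subtopology (coord_space d) U) (top_of_set (\<phi> ` U)) \<phi>"
    using lp unfolding local_parametrization_def by blast+
  have Uext: "U \<subseteq> extensional {..<d}"
    using openin_subset[OF U(1)] by (simp add: topspace_coord_space)
  have \<phi>M: "\<phi> x \<in> M" if "x \<in> U" for x using openin_subset[OF U(3)] that by auto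
  have inj\<phi>: "inj_on \<phi> U"
    using homeomorphic_imp_injective_map[OF U(4)] Uext
    by (simp add: topspace_coord_space Int_absorb1)
  define res where "res z = restrict (fun_of \<tau> z) {..<d}" for z
  define lam where "lam z = (tail_eigs d (fun_of \<tau> z) :: 'n \<Rightarrow> real)" for z
  define \<Phi> where "\<Phi> z = reeigen v (lam z) (\<phi> (res z))" for z
  define g where "g z = herm_vec \<tau> (\<Phi> z)" for z
  define S where "S = {z. res z \<in> A \<and> lam z \<in> eig_box}"
  have S: "res z \<in> U" "res z \<in> A" "lam z \<in> eig_box" "\<phi> (res z) \<in> M" if "z \<in> S" for z
    using that A(2) \<phi>M unfolding S_def by auto
  have res_ext: "res z \<in> extensional {..<d}" for z by (simp add: res_def)
  have z_eqI: "z = z'" if "res z = res z'" "lam z = lam z'" for z z'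
  proof -
    have "fun_of \<tau> z j = fun_of \<tau> z' j" if j: "j < ?N" for j
    proof (cases "j < d")
      case True
      then show ?thesis using fun_cong[OF \<open>res z = res z'\<close>, of j] by (simp add: res_def)
    next
      case False
      then have "j - d \<in> {..<CARD('n)}" "d \<le> j" using j by auto
      then obtain a :: 'n where "j = d + rank a"
        using bij_betw_imp_surj_on[OF bij_betw_rank[where 'n='n]] by (metis imageE le_add_diff_inverse)
      then show ?thesis
        using fun_cong[OF \<open>lam z = lam z'\<close>, of a] by (simp add: lam_def tail_eigs_def)
    qed
    then have "vec_of \<tau> (fun_of \<tau> z) = vec_of \<tau> (fun_of \<tau> z')" by (rule vec_of_cong[OF bij])
    then show ?thesis by (simp add: vec_of_fun_of[OF bij])
  qed
  have z_ex: "\<exists>z. res z = x \<and> lam z = w" if "x \<in> extensional {..<d}" for x and w :: "'n \<Rightarrow> real"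
  proof (intro exI conjI)
    let ?x = "\<lambda>j. if j < d then x j else w (inv rank (j - d))"
    show "res (vec_of \<tau> ?x) = x"
    proof
      fix j show "res (vec_of \<tau> ?x) j = x j"
        using extensional_arb[OF that, of j] fun_of_vec_of[OF bij, of j ?x] by (simp add: res_def)
    qed
    show "lam (vec_of \<tau> ?x) = w"
    proof
      fix a :: 'n
      have "fun_of \<tau> (vec_of \<tau> ?x) (d + rank a) = ?x (d + rank a)"
        by (rule fun_of_vec_of[OF bij]) (simp add: rank_less)
      then show "lam (vec_of \<tau> ?x) a = w a"
        by (simp add: lam_def tail_eigs_def inv_f_f[OF inj_rank])
    qed
  qed
  have image: "g ` S = herm_vec \<tau> ` tube v (\<phi> ` A)"
  proof -
    have "\<Phi> ` S = tube v (\<phi> ` A)"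
    proof
      show "\<Phi> ` S \<subseteq> tube v (\<phi> ` A)"
      proof (rule image_subsetI)
        fix z assume z: "z \<in> S"
        then have "(\<phi> (res z), lam z) \<in> \<phi> ` A \<times> eig_box" using S by blast
        then show "\<Phi> z \<in> tube v (\<phi> ` A)" unfolding tube_def \<Phi>_def by (rule rev_image_eqI) simp
      qed
      show "tube v (\<phi> ` A) \<subseteq> \<Phi> ` S"
      proof
        fix Z assume "Z \<in> tube v (\<phi> ` A)"
        then obtain x w where x: "x \<in> A" "w \<in> eig_box" "Z = reeigen v w (\<phi> x)"
          unfolding tube_def by auto
        obtain z where "res z = x" "lam z = w" using z_ex[of x w] x(1) A(2) Uext by blast
        then show "Z \<in> \<Phi> ` S" using x by (intro image_eqI[of _ _ z]) (simp_all add: \<Phi>_def S_def)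
      qed
    qed
    then show ?thesis unfolding g_def image_image[symmetric] by (rule arg_cong)
  qed
  have herm\<Phi>: "hermitian (\<Phi> z)" if "z \<in> S" for z
    unfolding \<Phi>_def by (rule hermitian_reeigen[OF v]) (use S(4)[OF that] in \<open>simp add: M_def\<close>)
  have inj_g: "inj_on g S"
  proof (rule inj_onI)
    fix z z' assume z: "z \<in> S" "z' \<in> S" "g z = g z'"
    have "\<Phi> z = \<Phi> z'" by (rule herm_vec_inj[of \<tau>]) (use bij herm\<Phi> z in \<open>simp_all add: g_def d_def\<close>)
    then have "\<phi> (res z) = \<phi> (res z') \<and> lam z = lam z'"
      unfolding \<Phi>_def
      by (intro reeigen_inj[OF v]) (use S[OF z(1)] S[OF z(2)] in \<open>simp_all add: M_def\<close>)
    then show "z = z'"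
      using inj_onD[OF inj\<phi>, of "res z" "res z'"] S(1)[OF z(1)] S(1)[OF z(2)] by (blast intro: z_eqI)
  qed
  have bounded_g: "bounded (g ` S)"
  proof (rule bounded_subset)
    show "bounded (herm_vec \<tau> ` tube v M)"
      unfolding M_def by (rule compact_imp_bounded[OF compact_herm_vec_tube])
    have "\<phi> ` A \<subseteq> M" using A(2) \<phi>M by blast
    then show "g ` S \<subseteq> herm_vec \<tau> ` tube v M"
      unfolding image tube_def by (intro image_mono Sigma_mono) auto
  qed
  have coord_bl: "bounded_linear (\<lambda>z. fun_of \<tau> z j)" for j
    unfolding fun_of_def by (rule bounded_linear_vec_nth)
  have res_bl: "bounded_linear (\<lambda>z. res z i)" if "i < d" for i
    using coord_bl[of i] that by (simp add: res_def)
  have S_borel: "S \<in> sets borel"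
  proof -
    have comp: "(\<lambda>z. fun_of \<tau> z j) \<in> borel_measurable borel" for j
      by (intro borel_measurable_continuous_onI linear_continuous_on coord_bl)
    have "res \<in> borel \<rightarrow>\<^sub>M coord_lebesgue d"
      unfolding coord_lebesgue_def res_def by (rule measurable_restrict) (simp add: comp)
    then have "res -` A \<in> sets borel" using measurable_sets[OF _ A(1), of res borel] by simp
    moreover have "lam -` eig_box \<in> sets borel"
    proof -
      have m: "(\<lambda>z. indicator eig_box (lam z) :: ennreal) \<in> borel_measurable borel"
        unfolding lam_def by (rule measurable_tail_eigs(2)) (rule comp)
      have "lam -` eig_box = (\<lambda>z. indicator eig_box (lam z) :: ennreal) -` {1}"
        by (auto simp: indicator_def)
      then show ?thesis using measurable_sets[OF m, of "{1}"] by simp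
    qed
    moreover have "S = res -` A \<inter> lam -` eig_box" by (auto simp: S_def)
    ultimately show ?thesis by simp
  qed
  define D\<phi> where "D\<phi> z h = (\<Sum>i<d. res h i *\<^sub>R partial_deriv i \<phi> (res z))" for z h
  define D\<Phi> where "D\<Phi> z h = (\<Sum>a\<in>UNIV. lam z a *\<^sub>R dspectral_proj v a (\<phi> (res z)) (D\<phi> z h)
      + lam h a *\<^sub>R spectral_proj v a (\<phi> (res z)))" for z h
  have deriv\<Phi>: "(\<Phi> has_derivative D\<Phi> z) (at z)" if z: "z \<in> S" for z
  proof -
    have "((\<lambda>z. \<phi> (res z)) has_derivative D\<phi> z) (at z)"
      unfolding D\<phi>_def by (rule C1_on_coords_has_derivative[OF U(1,2) res_ext res_bl S(1)[OF z]])
    then have "((\<lambda>z. spectral_proj v a (\<phi> (res z))) has_derivative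
        (\<lambda>h. dspectral_proj v a (\<phi> (res z)) (D\<phi> z h))) (at z)" for a
      by (rule has_derivative_compose) (rule has_derivative_spectral_proj)
    moreover have "((\<lambda>z. lam z a) has_derivative (\<lambda>h. lam h a)) (at z)" for a
      unfolding lam_def tail_eigs_def by (rule bounded_linear_imp_has_derivative[OF coord_bl])
    ultimately show ?thesis
      unfolding \<Phi>_def[abs_def] D\<Phi>_def[abs_def] reeigen_def
      by (intro has_derivative_sum has_derivative_scaleR)
  qed
  have deriv_g: "(g has_derivative (\<lambda>h. herm_vec \<tau> (D\<Phi> z h))) (at z)" if "z \<in> S" for z
    unfolding g_def[abs_def]
    by (rule bounded_linear.has_derivative[OF bounded_linear_herm_vec deriv\<Phi>[OF that]])
  have jac: "\<bar>det (matrix (\<lambda>h. herm_vec \<tau> (D\<Phi> z h)))\<bar>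
      = \<bar>vandermonde ?\<beta> (lam z)\<bar> / \<bar>vandermonde ?\<beta> v\<bar> * volume_density frobenius d \<phi> (res z)"
    if z: "z \<in> S" for z
  proof -
    define w where "w = lam z"
    have inj_w: "inj w" unfolding w_def by (rule inj_eig_box[OF S(3)[OF z]])
    obtain V where V: "V \<in> unitary_group" "\<phi> (res z) = conj_by V (diagmat v)"
      using S(4)[OF z] unfolding M_def by (rule orbitE)
    define W where "W k = partial_deriv k \<phi> (res z)" for k
    define Y where "Y k = dreeigen v w (\<phi> (res z)) (W k)" for k
    define C where "C k = D\<Phi> z (axis (inv \<tau> k) 1)" for k
    have curve: "((\<lambda>s. \<phi> ((res z)(k := s))) has_vector_derivative W k) (at (res z k))"
      "\<forall>\<^sub>F s in nhds (res z k). \<phi> ((res z)(k := s)) \<in> unitary_orbit (diagmat v)"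
      if k: "k < d" for k
    proof -
      show "((\<lambda>s. \<phi> ((res z)(k := s))) has_vector_derivative W k) (at (res z k))"
        using U(2) S(1)[OF z] k
        by (simp add: C1_on_coords_def W_def partial_deriv_def vector_derivative_works)
      obtain e where e: "e > 0" "\<And>y. y \<in> extensional {..<d} \<Longrightarrow> (\<And>i. i < d \<Longrightarrow> \<bar>y i - res z i\<bar> < e) \<Longrightarrow> y \<in> U"
        by (rule openin_coord_space_ballE[OF U(1) S(1)[OF z]]) (rule that, assumption, blast)
      have "\<phi> ((res z)(k := s)) \<in> M" if "dist s (res z k) < e" for s
      proof (rule \<phi>M[OF e(2)])
        show "(res z)(k := s) \<in> extensional {..<d}" using res_ext k by (auto simp: extensional_def)
        show "\<bar>((res z)(k := s)) i - res z i\<bar> < e" if "i < d" for i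
          using \<open>dist s (res z k) < e\<close> e(1) by (simp add: dist_real_def)
      qed
      then show "\<forall>\<^sub>F s in nhds (res z k). \<phi> ((res z)(k := s)) \<in> unitary_orbit (diagmat v)"
        unfolding eventually_nhds_metric M_def using e(1) by blast
    qed
    have start: "\<phi> ((res z)(k := res z k)) = conj_by V (diagmat v)" for k by (simp add: V(2))
    have e_coord: "fun_of \<tau> (axis (inv \<tau> k) 1) j = (if j = k then 1 else 0)" if jk: "j < ?N" "k < ?N" for j k
    proof -
      have "j \<in> range \<tau>" "k \<in> range \<tau>" using bij_betw_imp_surj_on[OF bij] jk by simp_all
      then obtain i i' where "j = \<tau> i" "k = \<tau> i'" by blast
      then show ?thesis using bij_betw_imp_inj_on[OF bij] by (simp add: fun_of_def axis_def inj_eq)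
    qed
    have lin: "linear (dspectral_proj v a (\<phi> (res z)))" for a
      using has_derivative_spectral_proj by (rule has_derivative_linear)
    have C_chart: "C k = Y k" if k: "k < d" for k
    proof -
      have "D\<phi> z (axis (inv \<tau> k) 1) = (\<Sum>i<d. if i = k then W k else 0)"
        unfolding D\<phi>_def by (rule sum.cong) (use k in \<open>simp_all add: res_def e_coord W_def\<close>)
      then have D: "D\<phi> z (axis (inv \<tau> k) 1) = W k" using k by simp
      have "lam (axis (inv \<tau> k) 1) a = 0" for a
        using k by (simp add: lam_def tail_eigs_def e_coord rank_less)
      then show ?thesis by (simp add: C_def D\<Phi>_def D Y_def dreeigen_def w_def)
    qed
    have C_eig: "C (d + rank a) = conj_by V (diag_unit a)" for a :: 'n
    proof -
      have "D\<phi> z (axis (inv \<tau> (d + rank a)) 1) = 0"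
        unfolding D\<phi>_def by (rule sum.neutral) (simp add: res_def e_coord rank_less)
      moreover have "lam (axis (inv \<tau> (d + rank a)) 1) b = (if b = a then 1 else 0)" for b
        by (simp add: lam_def tail_eigs_def e_coord rank_less inj_eq[OF inj_rank])
      ultimately have "C (d + rank a) = (\<Sum>b\<in>UNIV. (if b = a then 1 else 0) *\<^sub>R spectral_proj v b (\<phi> (res z)))"
        by (simp add: C_def D\<Phi>_def linear_0[OF lin])
      also have "\<dots> = (\<Sum>b\<in>UNIV. if b = a then spectral_proj v a (\<phi> (res z)) else 0)"
        by (rule sum.cong) simp_all
      also have "\<dots> = conj_by V (diag_unit a)"
        by (simp add: V(2) spectral_proj_conj_by[OF V(1)] spectral_proj_diagmat[OF v] diag_unit_def)
      finally show ?thesis .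
    qed
    have "matrix (\<lambda>h. herm_vec \<tau> (D\<Phi> z h)) = (\<chi> i j. herm_coord (\<tau> i) (C (\<tau> j)))"
      using bij_betw_imp_inj_on[OF bij] by (simp add: matrix_def herm_vec_def C_def)
    moreover have "\<bar>det (\<chi> i j. herm_coord (\<tau> i) (C (\<tau> j)))\<bar>
        = \<bar>vandermonde ?\<beta> w\<bar> / \<bar>vandermonde ?\<beta> v\<bar> * sqrt (det_upto d (\<lambda>i j. W i \<bullet> W j))"
      unfolding d_def
    proof (rule tube_jacobian[of \<tau> v V W Y w C, OF bij[unfolded d_def] v V(1)])
      fix k assume "k < orbit_dim TYPE('f^'n^'n)"
      then have k: "k < d" by (simp add: d_def)
      note tangent = tangent_diag_zero[OF v V(1) start curve[OF k]]
      note dre = dreeigen_tangent[OF v inj_w V(1) start curve[OF k]]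
      show "hermitian (W k)" "conj_by (adjoint_matrix V) (W k) $ i $ i = 0" for i by (rule tangent)+
      show "hermitian (Y k)" "conj_by (adjoint_matrix V) (Y k) $ i $ i = 0" for i
        using dre(1,2) by (simp_all add: Y_def)
      show "(v b - v a) *\<^sub>R (conj_by (adjoint_matrix V) (Y k) $ a $ b)
          = (w b - w a) *\<^sub>R (conj_by (adjoint_matrix V) (W k) $ a $ b)" for a b
        using dre(3)[of b a] by (simp add: Y_def)
      show "C k = Y k" by (rule C_chart[OF k])
    next
      show "C (orbit_dim TYPE('f^'n^'n) + rank a) = conj_by V (diag_unit a)" for a
        using C_eig by (simp add: d_def)
    qed
    ultimately show ?thesis by (simp add: volume_density_def frobenius_eq_inner W_def w_def)
  qed
  define V where "V = \<bar>vandermonde ?\<beta> v\<bar>"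
  have V: "V > 0" using vandermonde_nonzero[OF v, of ?\<beta>] by (simp add: V_def)
  define f where "f x = ennreal (volume_density frobenius d \<phi> x) * indicator A x" for x
  define h where "h w = ennreal \<bar>vandermonde ?\<beta> w\<bar> * indicator eig_box w" for w :: "'n \<Rightarrow> real"
  have f_meas: "f \<in> borel_measurable (coord_lebesgue d)"
    unfolding f_def[abs_def] by (rule volume_density_measurable[OF lp A])
  have f_eq: "ennreal \<bar>det (matrix (\<lambda>h. herm_vec \<tau> (D\<Phi> z h)))\<bar> * indicator S z
      = (f (res z) * h (lam z)) * ennreal (1 / V)" for z
  proof (cases "z \<in> S")
    case True
    have "ennreal (\<bar>vandermonde ?\<beta> (lam z)\<bar> / V * volume_density frobenius d \<phi> (res z))
        = ennreal (\<bar>vandermonde ?\<beta> (lam z)\<bar> * (1 / V)) * ennreal (volume_density frobenius d \<phi> (res z))"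
      using V by (subst ennreal_mult') simp_all
    also have "ennreal (\<bar>vandermonde ?\<beta> (lam z)\<bar> * (1 / V)) = ennreal \<bar>vandermonde ?\<beta> (lam z)\<bar> * ennreal (1 / V)"
      by (rule ennreal_mult') simp
    finally have "ennreal (\<bar>vandermonde ?\<beta> (lam z)\<bar> / V * volume_density frobenius d \<phi> (res z))
        = ennreal (volume_density frobenius d \<phi> (res z)) * ennreal \<bar>vandermonde ?\<beta> (lam z)\<bar> * ennreal (1 / V)"
      by (simp only: mult_ac)
    then show ?thesis using True S[OF True] jac[OF True] by (simp add: f_def h_def V_def)
  next
    case False
    then have "f (res z) * h (lam z) = 0" by (auto simp: S_def f_def h_def indicator_def)
    then show ?thesis using False by simp
  qed
  have h_meas: "(\<lambda>y. h (tail_eigs d y)) \<in> borel_measurable (PiM {d..<?N} (\<lambda>_. lborel))"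
    unfolding h_def by (rule measurable_tail_eigs(1)) (rule measurable_tail_component)
  note split = nn_integral_chart_eigs[OF bij f_meas h_meas, folded res_def lam_def]
  have "emeasure lborel (g ` S) = (\<integral>\<^sup>+z. ennreal \<bar>det (matrix (\<lambda>h. herm_vec \<tau> (D\<Phi> z h)))\<bar> * indicator S z \<partial>lborel)"
    by (rule emeasure_differentiable_image[OF S_borel deriv_g inj_g _ bounded_g])
      (simp_all add: image meas)
  also have "\<dots> = (\<integral>\<^sup>+z. f (res z) * h (lam z) \<partial>lborel) * ennreal (1 / V)"
    unfolding f_eq using split(1) by (intro nn_integral_multc) simp
  finally have "emeasure lborel (g ` S) * ennreal V
      = (\<integral>\<^sup>+z. f (res z) * h (lam z) \<partial>lborel) * (ennreal (1 / V) * ennreal V)"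
    by (simp only: mult.assoc)
  also have "ennreal (1 / V) * ennreal V = 1" using V by (simp flip: ennreal_mult')
  finally show ?thesis unfolding split(2) image unfolding V_def box_integral_def f_def h_def by simp
qed

section \<open>The Riemannian measure of an orbit\<close>

lemma local_parametrization_image_sets:
  fixes \<phi> :: "(nat \<Rightarrow> real) \<Rightarrow> 'a::euclidean_space"
  assumes lp: "local_parametrization d M U \<phi>" and A: "A \<in> sets (coord_lebesgue d)" "A \<subseteq> U"
  shows "\<phi> ` A \<in> sets (restrict_space borel M)"
proof -
  have opn: "openin (top_of_set M) (\<phi> ` U)"
    and hm: "homeomorphic_map (subtopology (coord_space d) U) (top_of_set (\<phi> ` U)) \<phi>"
    and U: "openin (coord_space d) U" using lp unfolding local_parametrization_def by blast+
  have top: "topspace (subtopology (coord_space d) U) = U" using openin_subset[OF U] by auto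
  obtain \<kappa> where maps: "homeomorphic_maps (subtopology (coord_space d) U) (top_of_set (\<phi> ` U)) \<phi> \<kappa>"
    using hm unfolding homeomorphic_map_maps by blast
  have \<kappa>: "continuous_map (top_of_set (\<phi> ` U)) (coord_space d) \<kappa>" "\<And>x. x \<in> U \<Longrightarrow> \<kappa> (\<phi> x) = x"
    using maps unfolding homeomorphic_maps_def continuous_map_in_subtopology top by blast+
  have "\<kappa> \<in> restrict_space borel (\<phi> ` U) \<rightarrow>\<^sub>M coord_lebesgue d"
    unfolding coord_lebesgue_def
  proof (rule measurable_PiM_single')
    fix i assume "i \<in> {..<d}"
    then have "continuous_map (top_of_set (\<phi> ` U)) euclideanreal (\<lambda>p. \<kappa> p i)"
      using \<kappa>(1) unfolding coord_space_def continuous_map_componentwise by blast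
    then show "(\<lambda>p. \<kappa> p i) \<in> restrict_space borel (\<phi> ` U) \<rightarrow>\<^sub>M lborel"
      by (simp add: borel_measurable_continuous_on_restrict)
  next
    show "\<kappa> \<in> space (restrict_space borel (\<phi> ` U)) \<rightarrow> (\<Pi>\<^sub>E i\<in>{..<d}. space lborel)"
    proof (rule Pi_I)
      fix p assume "p \<in> space (restrict_space borel (\<phi> ` U))"
      then obtain x where x: "x \<in> U" "p = \<phi> x" by (auto simp: space_restrict_space)
      have "x \<in> extensional {..<d}"
        using openin_subset[OF U] x(1) by (auto simp: topspace_coord_space)
      then show "\<kappa> p \<in> (\<Pi>\<^sub>E i\<in>{..<d}. space lborel)" by (simp add: x \<kappa>(2) PiE_def)
    qed
  qed
  from measurable_sets[OF this A(1)]
  have "\<kappa> -` A \<inter> \<phi> ` U \<in> sets (restrict_space borel (\<phi> ` U))" by (simp add: space_restrict_space)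
  moreover have "\<kappa> -` A \<inter> \<phi> ` U = \<phi> ` A" using \<kappa>(2) A(2) by auto
  ultimately obtain B where B: "B \<in> sets borel" "\<phi> ` A = \<phi> ` U \<inter> B"
    by (auto simp: sets_restrict_space)
  obtain V where "open V" "\<phi> ` U = M \<inter> V" using opn by (auto simp: openin_open)
  then have "\<phi> ` A = M \<inter> (V \<inter> B)" "V \<inter> B \<in> sets borel" using B by auto
  then show ?thesis by (auto simp: sets_restrict_space)
qed

text \<open>
  The measure of a part of the orbit is the volume of the tube over it, up to a constant factor.
\<close>

lemma orbit_riemannian_measure:
  fixes v :: "'n::finite \<Rightarrow> real" and \<tau> :: "'k::{finite,wellorder} \<Rightarrow> nat"
  defines "d \<equiv> orbit_dim TYPE('f::star_division_algebra^'n^'n)"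
    and "M \<equiv> unitary_orbit (diagmat v :: 'f^'n^'n)"
  assumes bij: "bij_betw \<tau> UNIV {..<d + CARD('n)}" and v: "inj v"
    and k: "box_integral d DIM('f) TYPE('n) = ennreal k" "k > 0"
  shows "emeasure (riemannian_measure frobenius d M) M
    = ennreal (\<bar>vandermonde DIM('f) v\<bar> / k) * emeasure lborel (herm_vec \<tau> ` tube v M)"
proof -
  \<comment> \<open>As a continuous injection of a compact set, \<open>H\<close> has a continuous inverse, so the projection \<open>\<pi>\<close>
    of the tube to the orbit is continuous, and the tubes over Borel sets are Borel sets.\<close>
  define H where "H = (\<lambda>(X, y). herm_vec \<tau> (reeigen v (\<lambda>a. y $ a) (X :: 'f^'n^'n)))"
  define T where "T = herm_vec \<tau> ` tube v M"
  have H_image: "H ` (E \<times> eig_cbox) = herm_vec \<tau> ` tube v E" for E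
    unfolding tube_eq_cbox image_image H_def by (rule image_cong) auto
  have H_inj: "X = X' \<and> y = y'"
    if "X \<in> M" "X' \<in> M" "y \<in> eig_cbox" "y' \<in> eig_cbox" "H (X, y) = H (X', y')" for X X' y y'
  proof -
    have "reeigen v (\<lambda>a. y $ a) X = reeigen v (\<lambda>a. y' $ a) X'" by (rule herm_vec_inj[of \<tau>])
        (use that bij v in \<open>simp_all add: H_def d_def M_def hermitian_reeigen\<close>)
    then have "X = X' \<and> (\<lambda>a. y $ a) = (\<lambda>a. y' $ a)"
      by (intro reeigen_inj[OF v]) (use that in \<open>simp_all add: M_def eig_cbox_iff\<close>)
    then show ?thesis by (simp add: vec_eq_iff fun_eq_iff)
  qed
  then have inj: "inj_on H (M \<times> eig_cbox)" by (auto simp: inj_on_def)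
  have "continuous_on (M \<times> eig_cbox) H"
    unfolding H_def case_prod_beta
    by (intro linear_continuous_on_compose[where g = "herm_vec \<tau>"] continuous_on_reeigen
        continuous_intros bounded_linear.linear bounded_linear_herm_vec)
  moreover have "compact (M \<times> (eig_cbox :: (real^'n) set))"
    unfolding M_def by (intro compact_Times compact_unitary_orbit) (simp add: eig_cbox_def compact_cbox)
  moreover define G where "G = the_inv_into (M \<times> eig_cbox) H"
  have GH: "G (H p) = p" if "p \<in> M \<times> eig_cbox" for p
    unfolding G_def by (rule the_inv_into_f_f[OF inj that])
  ultimately have contG: "continuous_on T G"
    unfolding T_def H_image[symmetric] by (intro continuous_on_inv) auto
  define \<pi> where "\<pi> y = fst (G y)" for y
  have cont: "continuous_on T \<pi>" unfolding \<pi>_def by (intro continuous_on_fst contG)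
  have \<pi>H: "\<pi> (H (X, y)) = X" if "X \<in> M" "y \<in> eig_cbox" for X y
    using GH[of "(X, y)"] that by (simp add: \<pi>_def)
  have vimage: "\<pi> -` E \<inter> T = herm_vec \<tau> ` tube v E" if "E \<subseteq> M" for E
    unfolding T_def H_image[symmetric] using that \<pi>H by (fastforce simp: image_iff)
  have "compact T" unfolding T_def M_def by (rule compact_herm_vec_tube)
  then have T: "T \<in> sets borel" by (rule borel_compact)
  define \<nu> where "\<nu> = distr (restrict_space lborel T) (restrict_space borel M) \<pi>"
  define \<mu> where "\<mu> = scale_measure (ennreal (\<bar>vandermonde DIM('f) v\<bar> / k)) \<nu>"
  have \<pi>_meas: "\<pi> \<in> restrict_space lborel T \<rightarrow>\<^sub>M restrict_space borel M"
  proof (rule measurable_restrict_space2)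
    have "\<pi> \<in> borel_measurable (restrict_space borel T)"
      by (rule borel_measurable_continuous_on_restrict[OF cont])
    moreover have "sets (restrict_space lborel T) = sets (restrict_space borel T)"
      by (rule sets_restrict_space_cong) simp
    ultimately show "\<pi> \<in> borel_measurable (restrict_space lborel T)"
      using measurable_cong_sets by blast
    show "\<pi> \<in> space (restrict_space lborel T) \<rightarrow> M"
      using \<pi>H unfolding T_def H_image[symmetric] by (auto simp: space_restrict_space)
  qed
  have E_sets: "herm_vec \<tau> ` tube v E \<in> sets borel"
    and E_measure: "emeasure \<mu> E = ennreal (\<bar>vandermonde DIM('f) v\<bar> / k) * emeasure lborel (herm_vec \<tau> ` tube v E)"
    if E: "E \<in> sets (restrict_space borel M)" for E
  proof -
    have EM: "E \<subseteq> M" using sets.sets_into_space[OF E] by (simp add: space_restrict_space)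
    have pre: "\<pi> -` E \<inter> space (restrict_space lborel T) = herm_vec \<tau> ` tube v E"
      using vimage[OF EM] by (simp add: space_restrict_space)
    have "herm_vec \<tau> ` tube v E \<in> sets (restrict_space lborel T)"
      using measurable_sets[OF \<pi>_meas E] pre by simp
    then show "herm_vec \<tau> ` tube v E \<in> sets borel" using T by (simp add: sets_restrict_space_iff)
    have sub: "herm_vec \<tau> ` tube v E \<subseteq> T" using vimage[OF EM] by blast
    show "emeasure \<mu> E = ennreal (\<bar>vandermonde DIM('f) v\<bar> / k) * emeasure lborel (herm_vec \<tau> ` tube v E)"
      using T sub by (simp add: \<mu>_def \<nu>_def emeasure_distr[OF \<pi>_meas E] pre emeasure_restrict_space vimage[OF EM])
  qed
  have "is_riemannian_measure frobenius d M \<mu>"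
    unfolding is_riemannian_measure_def
  proof (intro conjI allI impI)
    show "space \<mu> = M" by (simp add: \<mu>_def \<nu>_def space_scale_measure space_restrict_space)
    show "sets \<mu> = sets (restrict_space borel M)" by (simp add: \<mu>_def \<nu>_def)
    fix U \<phi> A
    assume lp: "local_parametrization d M U \<phi>" and A: "A \<in> sets (coord_lebesgue d)" "A \<subseteq> U"
    let ?I = "\<integral>\<^sup>+x\<in>A. ennreal (volume_density frobenius d \<phi> x) \<partial>coord_lebesgue d"
    have im: "\<phi> ` A \<in> sets (restrict_space borel M)"
      by (rule local_parametrization_image_sets[OF lp A])
    have tube: "emeasure lborel (herm_vec \<tau> ` tube v (\<phi> ` A)) * ennreal \<bar>vandermonde DIM('f) v\<bar> = ?I * ennreal k"
      using tube_volume[of \<tau> v U \<phi> A] bij v lp A E_sets[OF im] k(1) unfolding d_def M_def by simp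
    have "emeasure \<mu> (\<phi> ` A)
        = ennreal (\<bar>vandermonde DIM('f) v\<bar> * (1 / k)) * emeasure lborel (herm_vec \<tau> ` tube v (\<phi> ` A))"
      by (simp add: E_measure[OF im])
    also have "ennreal (\<bar>vandermonde DIM('f) v\<bar> * (1 / k)) = ennreal \<bar>vandermonde DIM('f) v\<bar> * ennreal (1 / k)"
      by (rule ennreal_mult') simp
    also have "\<dots> * emeasure lborel (herm_vec \<tau> ` tube v (\<phi> ` A))
        = (emeasure lborel (herm_vec \<tau> ` tube v (\<phi> ` A)) * ennreal \<bar>vandermonde DIM('f) v\<bar>) * ennreal (1 / k)"
      by (simp only: mult_ac)
    also have "\<dots> = ?I * (ennreal k * ennreal (1 / k))" by (simp only: tube mult.assoc)
    also have "ennreal k * ennreal (1 / k) = 1" using k(2) by (simp flip: ennreal_mult')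
    finally show "emeasure \<mu> (\<phi> ` A) = ?I" by simp
  qed
  moreover have "embedded_submanifold d M"
    unfolding d_def M_def by (rule embedded_submanifold_orbit[OF v])
  ultimately have "riemannian_measure frobenius d M = \<mu>" by (intro riemannian_measure_eqI)
  moreover have "M \<in> sets (restrict_space borel M)"
    using sets.top[of "restrict_space borel M"] by (simp add: space_restrict_space)
  ultimately show ?thesis using E_measure by simp
qed

text \<open>
  Lebesgue measure on the hermitian matrices needs an index type with as many elements as their real
  dimension.
\<close>

typedef (overloaded) ('f::star_division_algebra, 'n::finite) herm_index =
  "{..<orbit_dim TYPE('f^'n^'n) + CARD('n)}" by (rule exI[of _ 0]) simp

instantiation herm_index :: (star_division_algebra, finite) wellorder
begin

definition less_eq_herm_index :: "('a, 'b) herm_index \<Rightarrow> ('a, 'b) herm_index \<Rightarrow> bool" where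
  "x \<le> y \<longleftrightarrow> Rep_herm_index x \<le> Rep_herm_index y"

definition less_herm_index :: "('a, 'b) herm_index \<Rightarrow> ('a, 'b) herm_index \<Rightarrow> bool" where
  "x < y \<longleftrightarrow> Rep_herm_index x < Rep_herm_index y"

instance
proof
  fix x y z :: "('a, 'b) herm_index" and P :: "('a, 'b) herm_index \<Rightarrow> bool"
  show "x < y \<longleftrightarrow> x \<le> y \<and> \<not> y \<le> x" "x \<le> x" "x \<le> y \<Longrightarrow> y \<le> z \<Longrightarrow> x \<le> z" "x \<le> y \<or> y \<le> x"
    by (auto simp: less_eq_herm_index_def less_herm_index_def)
  show "x \<le> y \<Longrightarrow> y \<le> x \<Longrightarrow> x = y" by (simp add: less_eq_herm_index_def flip: Rep_herm_index_inject)
  show "P x" if step: "\<And>x. (\<And>y. y < x \<Longrightarrow> P y) \<Longrightarrow> P x"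
  proof (induction x rule: measure_induct_rule[of Rep_herm_index])
    case (less x)
    show ?case by (rule step) (rule less, simp only: less_herm_index_def)
  qed
qed

end

lemma bij_betw_Rep_herm_index:
  "bij_betw (Rep_herm_index :: ('f::star_division_algebra, 'n::finite) herm_index \<Rightarrow> nat) UNIV
    {..<orbit_dim TYPE('f^'n^'n) + CARD('n)}"
  by (simp add: bij_betw_def inj_on_def Rep_herm_index_inject
      type_definition.Rep_range[OF type_definition_herm_index])

instance herm_index :: (star_division_algebra, finite) finite
proof
  show "finite (UNIV :: ('a, 'b) herm_index set)"
    using bij_betw_finite[OF bij_betw_Rep_herm_index[where 'f = 'a and 'n = 'b]] by simp
qed

section \<open>The volume of an orbit\<close>

text \<open>
  The tube over the whole orbit, with eigenvalues in the box, does not change with \<open>v\<close>, so the volume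
  depends on \<open>v\<close> only through the factor between tubes and parts of the orbit.
\<close>

lemma orbit_volume:
  "\<exists>c\<ge>0. \<forall>v. inj v \<longrightarrow>
    has_riemannian_volume frobenius (unitary_orbit (diagmat v :: 'f::star_division_algebra^'n^'n))
      (c * \<bar>vandermonde DIM('f) v\<bar>)"
proof -
  let ?d = "orbit_dim TYPE('f^'n^'n)" and ?\<tau> = "Rep_herm_index :: ('f, 'n) herm_index \<Rightarrow> nat"
  obtain k where k: "box_integral ?d DIM('f) TYPE('n) = ennreal k" "k > 0"
    using box_integral_bounds[of ?d "DIM('f)", where 'n = 'n]
    by (cases "box_integral ?d DIM('f) TYPE('n)") auto
  define T where "T = herm_vec ?\<tau> `
    (\<lambda>(U :: 'f^'n^'n, w). conj_by U (diagmat w)) ` (unitary_group \<times> eig_box)"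
  have T: "herm_vec ?\<tau> ` tube v (unitary_orbit (diagmat v :: 'f^'n^'n)) = T" if "inj v" for v
    unfolding T_def tube_orbit[OF that] by (rule refl)
  have "inj (\<lambda>a :: 'n. real (rank a))" using inj_rank by (auto simp: inj_on_def)
  then have "compact T" using compact_herm_vec_tube T by metis
  then have fin: "emeasure lborel T = ennreal (measure lborel T)"
    using emeasure_compact_finite[OF \<open>compact T\<close>] by (intro emeasure_eq_ennreal_measure) auto
  show ?thesis
  proof (intro exI conjI allI impI)
    show "0 \<le> measure lborel T / k" using k(2) by simp
    fix v :: "'n \<Rightarrow> real" assume v: "inj v"
    let ?M = "unitary_orbit (diagmat v :: 'f^'n^'n)" and ?V = "\<bar>vandermonde DIM('f) v\<bar>"
    have "emeasure (riemannian_measure frobenius ?d ?M) ?M = ennreal (?V / k) * emeasure lborel T"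
      using orbit_riemannian_measure[OF bij_betw_Rep_herm_index v k] by (simp add: T[OF v])
    also have "\<dots> = ennreal (measure lborel T / k * ?V)"
      unfolding fin using k(2) by (subst ennreal_mult'[symmetric]) (simp_all add: mult_ac)
    finally show "has_riemannian_volume frobenius ?M (measure lborel T / k * ?V)"
      unfolding has_riemannian_volume_def
      using embedded_submanifold_orbit[OF v] k(2) by (intro exI[of _ ?d]) simp
  qed
qed

lemma vandermonde_eq:
  fixes l :: "nat \<Rightarrow> real"
  shows "(\<Prod>a\<in>{1..CARD('n)}. \<Prod>b\<in>{a<..CARD('n)}. (l a - l b) ^ \<beta>)
    = vandermonde \<beta> (\<lambda>a :: 'n::finite. l (Suc (rank a)))"
proof -
  have bij: "bij_betw (\<lambda>a :: 'n. Suc (rank a)) UNIV {1..CARD('n)}"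
    using bij_betw_trans[OF bij_betw_rank[where 'n = 'n], of Suc "{1..CARD('n)}"]
    by (simp add: bij_betw_def o_def image_Suc_lessThan)
  have inner: "(\<Prod>b\<in>{Suc (rank a)<..CARD('n)}. g b) = (\<Prod>b | rank a < rank (b :: 'n). g (Suc (rank b)))"
    for g :: "nat \<Rightarrow> real" and a :: 'n
  proof -
    have "{Suc (rank a)<..CARD('n)} = (\<lambda>b :: 'n. Suc (rank b)) ` {b. rank a < rank b}"
    proof (intro set_eqI iffI)
      fix j assume "j \<in> {Suc (rank a)<..CARD('n)}"
      then have j: "j \<in> {1..CARD('n)}" "Suc (rank a) < j" by auto
      obtain b :: 'n where "j = Suc (rank b)" using bij_betw_imp_surj_on[OF bij] j(1) by blast
      then show "j \<in> (\<lambda>b :: 'n. Suc (rank b)) ` {b. rank a < rank b}" using j(2) by auto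
    qed (auto simp: Suc_le_eq rank_less)
    then show ?thesis
      using inj_on_subset[OF bij_betw_imp_inj_on[OF bij]] by (simp add: prod.reindex)
  qed
  show ?thesis
    unfolding prod.reindex_bij_betw[OF bij, symmetric] inner vandermonde_def
    by (simp add: prod_power_distrib)
qed

text \<open>
  The eigenvalues, listed in decreasing order, are distinct, so a hermitian matrix with these
  eigenvalues lies on the orbit of their diagonal matrix, and all their differences are positive.
\<close>

lemma ordered_orbit_volume:
  "\<exists>c::real. \<forall>(S :: 'f::star_division_algebra^'n^'n) (l :: nat \<Rightarrow> real).
    S \<in> simple_hermitian \<longrightarrow> strict_antimono_on {1..CARD('n)} l \<longrightarrow>
    eigenvalues S = of_real ` l ` {1..CARD('n)} \<longrightarrow>
    has_riemannian_volume frobenius (unitary_orbit S)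
      (c * (\<Prod>a\<in>{1..CARD('n)}. \<Prod>b\<in>{a<..CARD('n)}. (l a - l b) ^ DIM('f)))"
proof -
  obtain c where c: "\<And>v. inj v \<Longrightarrow>
      has_riemannian_volume frobenius (unitary_orbit (diagmat v :: 'f^'n^'n)) (c * \<bar>vandermonde DIM('f) v\<bar>)"
    using orbit_volume[where 'f = 'f and 'n = 'n] by blast
  show ?thesis
  proof (intro exI allI impI)
    fix S :: "'f^'n^'n" and l :: "nat \<Rightarrow> real"
    assume S: "S \<in> simple_hermitian" and l: "strict_antimono_on {1..CARD('n)} l"
      and ev: "eigenvalues S = of_real ` l ` {1..CARD('n)}"
    define v where "v a = l (Suc (rank a))" for a :: 'n
    have less: "v b < v a" if "rank a < rank b" for a b
      using l that rank_less[of b] unfolding v_def monotone_on_def by (simp add: Suc_le_eq)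
    have inj: "inj v" by (intro injI) (metis less less_irrefl rank_neqE)
    have "\<exists>x. x \<noteq> 0 \<and> S *v x = v a *\<^sub>R x" for a
    proof -
      have "of_real (v a) \<in> eigenvalues S"
        unfolding ev v_def using rank_less[of a] by (intro imageI) auto
      then obtain x where "x \<noteq> 0" "S *v x = (\<chi> i. x $ i * of_real (v a))"
        unfolding eigenvalues_def by blast
      moreover have "(\<chi> i. x $ i * of_real (v a)) = v a *\<^sub>R x" for x :: "'f^'n"
        by (simp add: vec_eq_iff of_real_def)
      ultimately show ?thesis by metis
    qed
    moreover have "hermitian S" using S by (simp add: simple_hermitian_def)
    ultimately obtain U where U: "U \<in> unitary_group" "S = conj_by U (diagmat v)"
      using hermitian_diagonalization[OF _ inj] by blast
    have "vandermonde DIM('f) v \<ge> 0"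
      unfolding vandermonde_def
      by (intro zero_le_power prod_nonneg ballI) (simp add: less less_imp_le)
    then show "has_riemannian_volume frobenius (unitary_orbit S)
        (c * (\<Prod>a\<in>{1..CARD('n)}. \<Prod>b\<in>{a<..CARD('n)}. (l a - l b) ^ DIM('f)))"
      using c[OF inj] unfolding vandermonde_eq U(2) unitary_orbit_conj_by[OF U(1)]
      by (simp add: v_def[abs_def])
  qed
qed

lemma DIM_quat [simp]: "DIM(quat) = 4" by (simp add: Basis_quat_def)

theorem proposition2p2:
  shows
    "(\<exists>c::real. \<forall>(S :: real ^'n ^'n) (l :: nat \<Rightarrow> real).
        S \<in> simple_hermitian \<longrightarrow> strict_antimono_on {1..CARD('n)} l \<longrightarrow>
        eigenvalues S = of_real ` l ` {1..CARD('n)} \<longrightarrow>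
        has_riemannian_volume frobenius (unitary_orbit S)
          (c * (\<Prod>a\<in>{1..CARD('n)}. \<Prod>b\<in>{a<..CARD('n)}. (l a - l b) ^ 1)))
   \<and> (\<exists>c::real. \<forall>(S :: complex ^'n ^'n) (l :: nat \<Rightarrow> real).
        S \<in> simple_hermitian \<longrightarrow> strict_antimono_on {1..CARD('n)} l \<longrightarrow>
        eigenvalues S = of_real ` l ` {1..CARD('n)} \<longrightarrow>
        has_riemannian_volume frobenius (unitary_orbit S)
          (c * (\<Prod>a\<in>{1..CARD('n)}. \<Prod>b\<in>{a<..CARD('n)}. (l a - l b) ^ 2)))
   \<and> (\<exists>c::real. \<forall>(S :: quat ^'n ^'n) (l :: nat \<Rightarrow> real).
        S \<in> simple_hermitian \<longrightarrow> strict_antimono_on {1..CARD('n)} l \<longrightarrow>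
        eigenvalues S = of_real ` l ` {1..CARD('n)} \<longrightarrow>
        has_riemannian_volume frobenius (unitary_orbit S)
          (c * (\<Prod>a\<in>{1..CARD('n)}. \<Prod>b\<in>{a<..CARD('n)}. (l a - l b) ^ 4)))"
  by (rule conjI[OF ordered_orbit_volume[where 'f = real and 'n = 'n, unfolded DIM_real]
      conjI[OF ordered_orbit_volume[where 'f = complex and 'n = 'n, unfolded DIM_complex]
        ordered_orbit_volume[where 'f = quat and 'n = 'n, unfolded DIM_quat]]])

end
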